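(* Let $(S,w)$ be a complete filtered ring and let $(\sigma,\delta)$ be a commuting skew derivation on $S$ which is quasi-compatible with $w$. Then: (i) The set $S^+[[x;\sigma,\delta]]=\{\sum_{n\in\mathbb N}s_nx^n : s_n\in S,\ \exists M\in\mathbb Z \text{ with } w(s_n)\ge M \text{ for all } n\}$, with coefficientwise addition and multiplication $$\Big(\sum_{i\ge 0}a_ix^i\Big)\Big(\sum_{j\ge 0}b_jx^j\Big)=\sum_{k\ge 0}\Big(\sum_{0\le e\le k}\ \sum_{i\ge e}\binom ie a_i\,\sigma^e\delta^{i-e}(b_{k-e})\Big)x^k,$$ is a well-defined ring (the bounded skew power series ring) containing the skew polynomial ring $S[x;\sigma,\delta]$ as a subring. Moreover, for any sufficiently small positive rational $\varepsilon$, it is a topological ring with respect to the topology defined by the filtration of left $S$-modules $v_\varepsilon(\sum_n s_nx^n)=\min_n\{w(s_n)+\varepsilon n\}$ (with values in $(\mathbb Z+\varepsilon\mathbb Z)\cup\{\infty\}$), which satisfies $v_\varepsilon|_S=w$, and $S[x;\sigma,\delta]$ is dense in $S^+[[x;\sigma,\delta]]$. (ii) If $w$ is a positive filtration, then $S^+[[x;\sigma,\delta]]$ is complete with respect to $v_\varepsilon$ and is equal to the ring $S[[x;\sigma,\delta]]$ of all skew power series $\sum_n s_nx^n$ over $S$. (iii) Suppose $A$ is a subring of $S$ which is complete and positively filtered (for the restriction of $w$) and is preserved by $(\sigma,\delta)$, that $T$ is a $\sigma$-invariant denominator set in $A$ with $S=T^{-1}A$, and that for every bounded sequence $(s_n)_{n\in\mathbb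 N}$ of elements of $S$ there exists $t\in T$ such that $ts_n\in A$ for all $n$. Then $T^{-1}(A[[x;\sigma,\delta]])=S\otimes_AA[[x;\sigma,\delta]]$ can be canonically identified with $S^+[[x;\sigma,\delta]]$.
   Context: A filtration on a ring $R$ is a function $u:R\to\mathbb Z\cup\{\infty\}$ with $u(a+b)\ge\min\{u(a),u(b)\}$, $u(a)=\infty$ iff $a=0$, $u(1)=0$ and $u(ab)\ge u(a)+u(b)$; its level sets are $F_nR=u^{-1}([n,\infty])$, which form a neighbourhood base of $0$ for the filtration topology. It is complete if every Cauchy sequence converges, and positive if it takes values in $\mathbb N\cup\{\infty\}$. A sequence $(s_n)$ is bounded if the values $u(s_n)$ are bounded below in $\mathbb Z$. An additive endomorphism $f$ of $R$ is filtered if there is $d\in\mathbb Z$ with $f(F_nR)\subseteq F_{n+d}R$ for all $n$; $\deg_u(f)$ is the largest such $d$. A skew derivation $(\sigma,\delta)$ on $R$ consists of $\sigma\in\mathrm{Aut}(R)$ and an additive map $\delta:R\to R$ with $\delta(rs)=\delta(r)s+\sigma(r)\delta(s)$; it is commuting if $\sigma\delta=\delta\sigma$. A commuting skew derivation is quasi-compatible with $u$ if $\sigma,\sigma^{-1},\delta$ are filtered, there is $B\in\mathbb Z$ with $\deg_u(\sigma^i\delta^j)\ge B$ for all $i\in\mathbb Z$, $j\in\mathbb N$, and $\deg_u(\delta^N)>0$ for some $N\in\mathbb N$. The skew polynomial ring $R[x;\sigma,\delta]$ is the free left $R$-module on $1,x,x^2,\dots$ with $xr=\sigma(r)x+\delta(r)$.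 *)

theory Defs
  imports
    "HOL-Analysis.Product_Topology"
    "HOL-Analysis.Abstract_Limits"
    "HOL-Library.Extended_Real"
    "HOL-Algebra.Subrings"
    "HOL-Algebra.QuotRing"
    "HOL-Algebra.Coset"
    "HOL-Algebra.Generated_Groups"
    "HOL-Algebra.Free_Abelian_Groups"
begin

text \<open>All value functions live in \<open>ereal\<close>, so that the integer-valued filtration of a ring
  and the filtration of its power series with values in a subgroup of the reals are
  treated alike. The intended value group is imposed explicitly. The axioms below do not
  force \<open>u (- a) = u a\<close>: \<open>u (- 1)\<close> may be negative.\<close>

definition ring_filtration :: "('a, 'b) ring_scheme \<Rightarrow> ('a \<Rightarrow> ereal) \<Rightarrow> bool" where
  "ring_filtration R u \<longleftrightarrow>
     (\<forall>a\<in>carrier R. u a \<in> range (\<lambda>n::int. ereal (real_of_int n)) \<union> {\<infinity>}) \<and>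
     (\<forall>a\<in>carrier R. \<forall>b\<in>carrier R. min (u a) (u b) \<le> u (a \<oplus>\<^bsub>R\<^esub> b)) \<and>
     (\<forall>a\<in>carrier R. u a = \<infinity> \<longleftrightarrow> a = \<zero>\<^bsub>R\<^esub>) \<and>
     u \<one>\<^bsub>R\<^esub> = 0 \<and>
     (\<forall>a\<in>carrier R. \<forall>b\<in>carrier R. u a + u b \<le> u (a \<otimes>\<^bsub>R\<^esub> b))"

definition level_set :: "('a, 'b) ring_scheme \<Rightarrow> ('a \<Rightarrow> ereal) \<Rightarrow> int \<Rightarrow> 'a set" where
  "level_set R u n = {a \<in> carrier R. ereal (real_of_int n) \<le> u a}"

text \<open>The topology for which the sets \<open>a + F\<^sub>n\<close> form a neighbourhood base at \<open>a\<close>.\<close>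

definition filtration_topology :: "('a, 'b) ring_scheme \<Rightarrow> ('a \<Rightarrow> ereal) \<Rightarrow> 'a topology" where
  "filtration_topology R u =
     topology (\<lambda>U. U \<subseteq> carrier R \<and>
       (\<forall>a\<in>U. \<exists>n. \<forall>b\<in>carrier R. b \<ominus>\<^bsub>R\<^esub> a \<in> level_set R u n \<longrightarrow> b \<in> U))"

lemma level_set_antimono: "m \<le> n \<Longrightarrow> level_set R u n \<subseteq> level_set R u m"
  unfolding level_set_def by (auto intro: order_trans[rotated])

lemma openin_filtration_topology:
  "openin (filtration_topology R u) U \<longleftrightarrow> U \<subseteq> carrier R \<and>
     (\<forall>a\<in>U. \<exists>n. \<forall>b\<in>carrier R. b \<ominus>\<^bsub>R\<^esub> a \<in> level_set R u n \<longrightarrow> b \<in> U)"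
proof -
  define P where "P = (\<lambda>U. U \<subseteq> carrier R \<and>
       (\<forall>a\<in>U. \<exists>n. \<forall>b\<in>carrier R. b \<ominus>\<^bsub>R\<^esub> a \<in> level_set R u n \<longrightarrow> b \<in> U))"
  have int: "P (U \<inter> V)" if U: "P U" and V: "P V" for U V
    unfolding P_def
  proof (intro conjI ballI)
    show "U \<inter> V \<subseteq> carrier R" using U by (auto simp: P_def)
    fix a assume a: "a \<in> U \<inter> V"
    obtain m where m: "\<forall>b\<in>carrier R. b \<ominus>\<^bsub>R\<^esub> a \<in> level_set R u m \<longrightarrow> b \<in> U"
      using U a by (auto simp: P_def)
    obtain n where n: "\<forall>b\<in>carrier R. b \<ominus>\<^bsub>R\<^esub> a \<in> level_set R u n \<longrightarrow> b \<in> V"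
      using V a by (auto simp: P_def)
    show "\<exists>n. \<forall>b\<in>carrier R. b \<ominus>\<^bsub>R\<^esub> a \<in> level_set R u n \<longrightarrow> b \<in> U \<inter> V"
      using m n level_set_antimono[of m "max m n" R u] level_set_antimono[of n "max m n" R u]
      by (intro exI[of _ "max m n"]) auto
  qed
  have union: "P (\<Union>K)" if "\<forall>V\<in>K. P V" for K
    using that unfolding P_def by (auto; meson)
  have "istopology P"
    using int union by (auto simp: istopology_def)
  then show ?thesis
    using topology_inverse'[of P] by (simp add: filtration_topology_def P_def)
qed

lemma topspace_filtration_topology [simp]: "topspace (filtration_topology R u) = carrier R"
proof (rule antisym)
  show "topspace (filtration_topology R u) \<subseteq> carrier R"
    using openin_topspace[of "filtration_topology R u"]
    unfolding openin_filtration_topology by blast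
  have "openin (filtration_topology R u) (carrier R)"
    by (simp add: openin_filtration_topology)
  then show "carrier R \<subseteq> topspace (filtration_topology R u)"
    by (rule openin_subset)
qed

definition filtration_Cauchy ::
    "('a, 'b) ring_scheme \<Rightarrow> ('a \<Rightarrow> ereal) \<Rightarrow> (nat \<Rightarrow> 'a) \<Rightarrow> bool" where
  "filtration_Cauchy R u s \<longleftrightarrow> (\<forall>n. s n \<in> carrier R) \<and>
     (\<forall>d. \<exists>N. \<forall>m\<ge>N. \<forall>n\<ge>N. s m \<ominus>\<^bsub>R\<^esub> s n \<in> level_set R u d)"

definition filtration_complete :: "('a, 'b) ring_scheme \<Rightarrow> ('a \<Rightarrow> ereal) \<Rightarrow> bool" where
  "filtration_complete R u \<longleftrightarrow>
     (\<forall>s. filtration_Cauchy R u s \<longrightarrow> (\<exists>l. limitin (filtration_topology R u) s l sequentially))"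

definition positive_filtration :: "('a, 'b) ring_scheme \<Rightarrow> ('a \<Rightarrow> ereal) \<Rightarrow> bool" where
  "positive_filtration R u \<longleftrightarrow> (\<forall>a\<in>carrier R. 0 \<le> u a)"

definition bounded_seq :: "('a, 'b) ring_scheme \<Rightarrow> ('a \<Rightarrow> ereal) \<Rightarrow> (nat \<Rightarrow> 'a) \<Rightarrow> bool" where
  "bounded_seq R u s \<longleftrightarrow>
     (\<forall>n. s n \<in> carrier R) \<and> (\<exists>M::int. \<forall>n. ereal (real_of_int M) \<le> u (s n))"

definition filtration_sums ::
    "('a, 'b) ring_scheme \<Rightarrow> ('a \<Rightarrow> ereal) \<Rightarrow> (nat \<Rightarrow> 'a) \<Rightarrow> 'a \<Rightarrow> bool" where
  "filtration_sums R u f l \<longleftrightarrow>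
     limitin (filtration_topology R u) (\<lambda>n. finsum R f {..<n}) l sequentially"

definition filtration_summable ::
    "('a, 'b) ring_scheme \<Rightarrow> ('a \<Rightarrow> ereal) \<Rightarrow> (nat \<Rightarrow> 'a) \<Rightarrow> bool" where
  "filtration_summable R u f \<longleftrightarrow>
     (\<forall>n. f n \<in> carrier R) \<and> (\<exists>l. filtration_sums R u f l)"

definition filtration_suminf ::
    "('a, 'b) ring_scheme \<Rightarrow> ('a \<Rightarrow> ereal) \<Rightarrow> (nat \<Rightarrow> 'a) \<Rightarrow> 'a" where
  "filtration_suminf R u f = (THE l. filtration_sums R u f l)"

definition additive_end :: "('a, 'b) ring_scheme \<Rightarrow> ('a \<Rightarrow> 'a) \<Rightarrow> bool" where
  "additive_end R f \<longleftrightarrow> f \<in> hom (add_monoid R) (add_monoid R)"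

definition filtered_degrees ::
    "('a, 'b) ring_scheme \<Rightarrow> ('a \<Rightarrow> ereal) \<Rightarrow> ('a \<Rightarrow> 'a) \<Rightarrow> int set" where
  "filtered_degrees R u f = {d. \<forall>n. f ` level_set R u n \<subseteq> level_set R u (n + d)}"

definition filtered_map :: "('a, 'b) ring_scheme \<Rightarrow> ('a \<Rightarrow> ereal) \<Rightarrow> ('a \<Rightarrow> 'a) \<Rightarrow> bool" where
  "filtered_map R u f \<longleftrightarrow> additive_end R f \<and> filtered_degrees R u f \<noteq> {}"

text \<open>As a supremum in \<open>ereal\<close> the degree is the largest admissible \<open>d\<close> if there is one,
  and \<open>\<infinity>\<close> for the zero map, for which every \<open>d\<close> is admissible.\<close>

definition filtered_deg :: "('a, 'b) ring_scheme \<Rightarrow> ('a \<Rightarrow> ereal) \<Rightarrow> ('a \<Rightarrow> 'a) \<Rightarrow> ereal" where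
  "filtered_deg R u f = (SUP d\<in>filtered_degrees R u f. ereal (real_of_int d))"

definition topological_ring :: "('a, 'b) ring_scheme \<Rightarrow> 'a topology \<Rightarrow> bool" where
  "topological_ring R X \<longleftrightarrow> ring R \<and> topspace X = carrier R \<and>
     continuous_map (prod_topology X X) X (\<lambda>(a, b). a \<oplus>\<^bsub>R\<^esub> b) \<and>
     continuous_map X X (\<lambda>a. \<ominus>\<^bsub>R\<^esub> a) \<and>
     continuous_map (prod_topology X X) X (\<lambda>(a, b). a \<otimes>\<^bsub>R\<^esub> b)"

text \<open>A filtration, with values in \<open>\<Gamma> \<union> {\<infinity>}\<close>, of the left \<open>R\<close>-module given by the additive
  group of \<open>M\<close> and the scalar multiplication \<open>sm\<close>, where \<open>R\<close> is filtered by \<open>u\<close>.\<close>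

definition left_module_filtration ::
    "('a, 'b) ring_scheme \<Rightarrow> ('a \<Rightarrow> ereal) \<Rightarrow> ('m, 'c) ring_scheme \<Rightarrow> ('a \<Rightarrow> 'm \<Rightarrow> 'm) \<Rightarrow>
      real set \<Rightarrow> ('m \<Rightarrow> ereal) \<Rightarrow> bool" where
  "left_module_filtration R u M sm \<Gamma> v \<longleftrightarrow>
     (\<forall>f\<in>carrier M. v f \<in> ereal ` \<Gamma> \<union> {\<infinity>}) \<and>
     (\<forall>f\<in>carrier M. \<forall>g\<in>carrier M. min (v f) (v g) \<le> v (f \<oplus>\<^bsub>M\<^esub> g)) \<and>
     (\<forall>f\<in>carrier M. v f = \<infinity> \<longleftrightarrow> f = \<zero>\<^bsub>M\<^esub>) \<and>
     (\<forall>r\<in>carrier R. \<forall>f\<in>carrier M. u r + v f \<le> v (sm r f))"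

definition skew_derivation :: "('a, 'b) ring_scheme \<Rightarrow> ('a \<Rightarrow> 'a) \<Rightarrow> ('a \<Rightarrow> 'a) \<Rightarrow> bool" where
  "skew_derivation R \<sigma> \<delta> \<longleftrightarrow> \<sigma> \<in> ring_iso R R \<and> additive_end R \<delta> \<and>
     (\<forall>r\<in>carrier R. \<forall>s\<in>carrier R. \<delta> (r \<otimes>\<^bsub>R\<^esub> s) = \<delta> r \<otimes>\<^bsub>R\<^esub> s \<oplus>\<^bsub>R\<^esub> \<sigma> r \<otimes>\<^bsub>R\<^esub> \<delta> s)"

definition commuting_skew_derivation ::
    "('a, 'b) ring_scheme \<Rightarrow> ('a \<Rightarrow> 'a) \<Rightarrow> ('a \<Rightarrow> 'a) \<Rightarrow> bool" where
  "commuting_skew_derivation R \<sigma> \<delta> \<longleftrightarrow>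
     skew_derivation R \<sigma> \<delta> \<and> (\<forall>r\<in>carrier R. \<sigma> (\<delta> r) = \<delta> (\<sigma> r))"

definition int_iterate :: "('a, 'b) ring_scheme \<Rightarrow> ('a \<Rightarrow> 'a) \<Rightarrow> int \<Rightarrow> 'a \<Rightarrow> 'a" where
  "int_iterate R \<sigma> i =
     (if 0 \<le> i then \<sigma> ^^ nat i else inv_into (carrier R) \<sigma> ^^ nat (- i))"

definition quasi_compatible ::
    "('a, 'b) ring_scheme \<Rightarrow> ('a \<Rightarrow> ereal) \<Rightarrow> ('a \<Rightarrow> 'a) \<Rightarrow> ('a \<Rightarrow> 'a) \<Rightarrow> bool" where
  "quasi_compatible R u \<sigma> \<delta> \<longleftrightarrow>
     filtered_map R u \<sigma> \<and> filtered_map R u (inv_into (carrier R) \<sigma>) \<and> filtered_map R u \<delta> \<and>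
     (\<exists>B::int. \<forall>(i::int) (j::nat).
        ereal (real_of_int B) \<le> filtered_deg R u (int_iterate R \<sigma> i \<circ> (\<delta> ^^ j))) \<and>
     (\<exists>N::nat. 0 < filtered_deg R u (\<delta> ^^ N))"

text \<open>The formal series \<open>\<Sum>\<^sub>n s\<^sub>n x\<^sup>n\<close> is represented by its coefficient sequence \<open>s\<close>.
  The inner series of the product, over \<open>i \<ge> e\<close>, is indexed by \<open>j = i - e\<close>.\<close>

definition skew_term ::
    "('a, 'b) ring_scheme \<Rightarrow> ('a \<Rightarrow> 'a) \<Rightarrow> ('a \<Rightarrow> 'a) \<Rightarrow> (nat \<Rightarrow> 'a) \<Rightarrow> (nat \<Rightarrow> 'a) \<Rightarrow>
      nat \<Rightarrow> nat \<Rightarrow> nat \<Rightarrow> 'a" where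
  "skew_term R \<sigma> \<delta> a b k e j =
     add_pow R ((e + j) choose e) (a (e + j) \<otimes>\<^bsub>R\<^esub> (\<sigma> ^^ e) ((\<delta> ^^ j) (b (k - e))))"

definition skew_series_mult ::
    "('a, 'b) ring_scheme \<Rightarrow> ('a \<Rightarrow> ereal) \<Rightarrow> ('a \<Rightarrow> 'a) \<Rightarrow> ('a \<Rightarrow> 'a) \<Rightarrow>
      (nat \<Rightarrow> 'a) \<Rightarrow> (nat \<Rightarrow> 'a) \<Rightarrow> nat \<Rightarrow> 'a" where
  "skew_series_mult R u \<sigma> \<delta> a b k =
     (\<Oplus>\<^bsub>R\<^esub>e\<in>{..k}. filtration_suminf R u (skew_term R \<sigma> \<delta> a b k e))"

definition const_series :: "('a, 'b) ring_scheme \<Rightarrow> 'a \<Rightarrow> nat \<Rightarrow> 'a" where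
  "const_series R r = (\<lambda>n. if n = 0 then r else \<zero>\<^bsub>R\<^esub>)"

definition series_X :: "('a, 'b) ring_scheme \<Rightarrow> nat \<Rightarrow> 'a" where
  "series_X R = (\<lambda>n. if n = 1 then \<one>\<^bsub>R\<^esub> else \<zero>\<^bsub>R\<^esub>)"

definition series_smult :: "('a, 'b) ring_scheme \<Rightarrow> 'a \<Rightarrow> (nat \<Rightarrow> 'a) \<Rightarrow> nat \<Rightarrow> 'a" where
  "series_smult R r f = (\<lambda>n. r \<otimes>\<^bsub>R\<^esub> f n)"

definition skew_series_ring ::
    "('a, 'b) ring_scheme \<Rightarrow> ('a \<Rightarrow> ereal) \<Rightarrow> ('a \<Rightarrow> 'a) \<Rightarrow> ('a \<Rightarrow> 'a) \<Rightarrow> (nat \<Rightarrow> 'a) ring" where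
  "skew_series_ring R u \<sigma> \<delta> =
     \<lparr>carrier = {s. \<forall>n. s n \<in> carrier R},
      monoid.mult = skew_series_mult R u \<sigma> \<delta>,
      monoid.one = const_series R \<one>\<^bsub>R\<^esub>,
      ring.zero = const_series R \<zero>\<^bsub>R\<^esub>,
      ring.add = (\<lambda>a b n. a n \<oplus>\<^bsub>R\<^esub> b n)\<rparr>"

definition bounded_skew_series_ring ::
    "('a, 'b) ring_scheme \<Rightarrow> ('a \<Rightarrow> ereal) \<Rightarrow> ('a \<Rightarrow> 'a) \<Rightarrow> ('a \<Rightarrow> 'a) \<Rightarrow> (nat \<Rightarrow> 'a) ring" where
  "bounded_skew_series_ring R u \<sigma> \<delta> =
     (skew_series_ring R u \<sigma> \<delta>)\<lparr>carrier := {s. bounded_seq R u s}\<rparr>"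

text \<open>On bounded series the infimum is a minimum if \<open>\<epsilon> > 0\<close>.\<close>

definition series_filtration :: "('a \<Rightarrow> ereal) \<Rightarrow> real \<Rightarrow> (nat \<Rightarrow> 'a) \<Rightarrow> ereal" where
  "series_filtration u \<epsilon> s = (INF n. u (s n) + ereal (\<epsilon> * real n))"

definition finite_seqs :: "('a, 'b) ring_scheme \<Rightarrow> (nat \<Rightarrow> 'a) set" where
  "finite_seqs R = {s. (\<forall>n. s n \<in> carrier R) \<and> finite {n. s n \<noteq> \<zero>\<^bsub>R\<^esub>}}"

text \<open>\<open>P\<close>, with coefficient embedding \<open>\<iota>\<close> and variable \<open>x\<close>, is the skew polynomial ring over
  \<open>R\<close>: it is free as a left \<open>R\<close>-module on the powers of \<open>x\<close>, and \<open>x r = \<sigma>(r) x + \<delta>(r)\<close>.\<close>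

definition is_skew_polynomial_ring ::
    "('a, 'b) ring_scheme \<Rightarrow> ('a \<Rightarrow> 'a) \<Rightarrow> ('a \<Rightarrow> 'a) \<Rightarrow>
      ('p, 'c) ring_scheme \<Rightarrow> ('a \<Rightarrow> 'p) \<Rightarrow> 'p \<Rightarrow> bool" where
  "is_skew_polynomial_ring R \<sigma> \<delta> P \<iota> x \<longleftrightarrow>
     ring P \<and> \<iota> \<in> ring_hom R P \<and> x \<in> carrier P \<and>
     (\<forall>p\<in>carrier P. \<exists>!c. c \<in> finite_seqs R \<and>
        p = (\<Oplus>\<^bsub>P\<^esub>n\<in>{n. c n \<noteq> \<zero>\<^bsub>R\<^esub>}. \<iota> (c n) \<otimes>\<^bsub>P\<^esub> x [^]\<^bsub>P\<^esub> n)) \<and>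
     (\<forall>r\<in>carrier R. x \<otimes>\<^bsub>P\<^esub> \<iota> r = \<iota> (\<sigma> r) \<otimes>\<^bsub>P\<^esub> x \<oplus>\<^bsub>P\<^esub> \<iota> (\<delta> r))"

definition left_denominator_set :: "('a, 'b) ring_scheme \<Rightarrow> 'a set \<Rightarrow> bool" where
  "left_denominator_set R T \<longleftrightarrow>
     T \<subseteq> carrier R \<and> \<one>\<^bsub>R\<^esub> \<in> T \<and> (\<forall>s\<in>T. \<forall>t\<in>T. s \<otimes>\<^bsub>R\<^esub> t \<in> T) \<and>
     (\<forall>r\<in>carrier R. \<forall>t\<in>T. \<exists>r'\<in>carrier R. \<exists>t'\<in>T. t' \<otimes>\<^bsub>R\<^esub> r = r' \<otimes>\<^bsub>R\<^esub> t) \<and>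
     (\<forall>r\<in>carrier R. \<forall>t\<in>T. r \<otimes>\<^bsub>R\<^esub> t = \<zero>\<^bsub>R\<^esub> \<longrightarrow> (\<exists>t'\<in>T. t' \<otimes>\<^bsub>R\<^esub> r = \<zero>\<^bsub>R\<^esub>))"

text \<open>\<open>\<phi> : R \<rightarrow> Q\<close> is the left ring of fractions \<open>T\<^sup>-\<^sup>1 R\<close>.\<close>

definition is_left_localization ::
    "('a, 'b) ring_scheme \<Rightarrow> 'a set \<Rightarrow> ('q, 'c) ring_scheme \<Rightarrow> ('a \<Rightarrow> 'q) \<Rightarrow> bool" where
  "is_left_localization R T Q \<phi> \<longleftrightarrow>
     ring Q \<and> \<phi> \<in> ring_hom R Q \<and> \<phi> ` T \<subseteq> Units Q \<and>
     (\<forall>q\<in>carrier Q. \<exists>t\<in>T. \<exists>r\<in>carrier R. q = inv\<^bsub>Q\<^esub> (\<phi> t) \<otimes>\<^bsub>Q\<^esub> \<phi> r) \<and>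
     (\<forall>r\<in>carrier R. \<phi> r = \<zero>\<^bsub>Q\<^esub> \<longleftrightarrow> (\<exists>t\<in>T. t \<otimes>\<^bsub>R\<^esub> r = \<zero>\<^bsub>R\<^esub>))"

text \<open>The tensor product over \<open>R\<close> of the right module \<open>X\<close> (action \<open>ra\<close>) and the left module
  \<open>M\<close> (action \<open>la\<close>): the free abelian group on pairs modulo the balancedness relations.\<close>

definition tensor_relations ::
    "('a, 'b) ring_scheme \<Rightarrow> ('x, 'c) ring_scheme \<Rightarrow> ('x \<Rightarrow> 'a \<Rightarrow> 'x) \<Rightarrow>
      ('m, 'd) ring_scheme \<Rightarrow> ('a \<Rightarrow> 'm \<Rightarrow> 'm) \<Rightarrow> (('x \<times> 'm) \<Rightarrow>\<^sub>0 int) set" where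
  "tensor_relations R X ra M la =
     {frag_of (x \<oplus>\<^bsub>X\<^esub> y, m) - frag_of (x, m) - frag_of (y, m) | x y m.
        x \<in> carrier X \<and> y \<in> carrier X \<and> m \<in> carrier M} \<union>
     {frag_of (x, m \<oplus>\<^bsub>M\<^esub> n) - frag_of (x, m) - frag_of (x, n) | x m n.
        x \<in> carrier X \<and> m \<in> carrier M \<and> n \<in> carrier M} \<union>
     {frag_of (ra x r, m) - frag_of (x, la r m) | x r m.
        x \<in> carrier X \<and> r \<in> carrier R \<and> m \<in> carrier M}"

definition tensor_kernel ::
    "('a, 'b) ring_scheme \<Rightarrow> ('x, 'c) ring_scheme \<Rightarrow> ('x \<Rightarrow> 'a \<Rightarrow> 'x) \<Rightarrow>
      ('m, 'd) ring_scheme \<Rightarrow> ('a \<Rightarrow> 'm \<Rightarrow> 'm) \<Rightarrow> (('x \<times> 'm) \<Rightarrow>\<^sub>0 int) set" where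
  "tensor_kernel R X ra M la =
     generate (free_Abelian_group (carrier X \<times> carrier M)) (tensor_relations R X ra M la)"

definition tensor_product ::
    "('a, 'b) ring_scheme \<Rightarrow> ('x, 'c) ring_scheme \<Rightarrow> ('x \<Rightarrow> 'a \<Rightarrow> 'x) \<Rightarrow>
      ('m, 'd) ring_scheme \<Rightarrow> ('a \<Rightarrow> 'm \<Rightarrow> 'm) \<Rightarrow> (('x \<times> 'm) \<Rightarrow>\<^sub>0 int) set monoid" where
  "tensor_product R X ra M la =
     free_Abelian_group (carrier X \<times> carrier M) Mod tensor_kernel R X ra M la"

definition pure_tensor ::
    "('a, 'b) ring_scheme \<Rightarrow> ('x, 'c) ring_scheme \<Rightarrow> ('x \<Rightarrow> 'a \<Rightarrow> 'x) \<Rightarrow>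
      ('m, 'd) ring_scheme \<Rightarrow> ('a \<Rightarrow> 'm \<Rightarrow> 'm) \<Rightarrow> 'x \<Rightarrow> 'm \<Rightarrow> (('x \<times> 'm) \<Rightarrow>\<^sub>0 int) set" where
  "pure_tensor R X ra M la x m =
     tensor_kernel R X ra M la #>\<^bsub>free_Abelian_group (carrier X \<times> carrier M)\<^esub> frag_of (x, m)"

end

(* Quasi-compatibility makes sigma^e delta^j raise values by at least C + theta j for constants C and
   theta > 0. So for every slope 0 <= eps <= theta the product of series satisfies
   v_eps(f g) >= v_eps(f) + v_eps(g) + C, which gives convergence and boundedness of products (eps = 0)
   and continuity (eps > 0).
   For associativity, let X be the operator b |-> sigma(b) x + delta(b) of left multiplication by x on
   series; the product is f g = sum_i f_i X^i(g), one has X(f g) = X(f) g, and a double series is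
   summed in two orders.
   For the localisation, elements of T are units, and a bounded series f becomes integral after
   multiplication by some t in T; applied to f t^-1 this yields the Ore condition. A common denominator
   brings each tensor into the form t^-1 (x) f, so the map to the product has trivial kernel. *)
theory Submission
  imports Defs
begin

section \<open>Groups filtered by a value function\<close>

text \<open>The axioms only give u(-a) \<ge> u(a) + u(-1), so level sets need not be subgroups. All
  estimates use symmetrised neighbourhoods instead, which are subgroups; their radii are real
  because the weights \<epsilon> n are. The rate \<theta> originates in a power of \<delta> of
  positive degree, the loss C in the uniform lower bound on all degrees. Coefficient k of X^i(b) is
  a combination of the \<sigma>^e \<delta>^(i-e)(b_(k-e)) with e \<le> k. If b_l may lose \<epsilon>
  l, the gain \<theta> (i - e) outweighs this loss up to the net gain \<epsilon> (i - k), for every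
  \<epsilon> between 0 and \<theta>. A bounded series meets this hypothesis for all these \<epsilon>
  at once, so each estimate may choose its own slope. Associativity depends on this freedom: in a_i
  (X^i b)_j (X^j g)_k equal slopes for b and g would let the growth in j cancel.\<close>

lemma (in abelian_group) add_diff_cancel: "x \<in> carrier G \<Longrightarrow> y \<in> carrier G \<Longrightarrow> (x \<oplus> y) \<ominus> x = y"
  by (simp add: a_minus_def a_comm[of x y] a_assoc r_neg)

lemma (in abelian_group) diff_add_cancel: "x \<in> carrier G \<Longrightarrow> y \<in> carrier G \<Longrightarrow> (x \<ominus> y) \<oplus> y = x"
  by (simp add: a_minus_def a_assoc l_neg)

text \<open>Only the additive structure is assumed, so that the same lemmas serve for S with w, for
  a subring A, and for the series with \<open>series_filtration\<close>. The constant
  \<open>c\<close> bounds the failure of u(-a) = u(a); for a ring filtration it is -u(-1).\<close>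

locale filtered_group = abelian_group R for R (structure) +
  fixes u :: "'a \<Rightarrow> ereal" and c :: real
  assumes value_add: "a \<in> carrier R \<Longrightarrow> b \<in> carrier R \<Longrightarrow> min (u a) (u b) \<le> u (a \<oplus> b)"
    and value_eq_infinity: "a \<in> carrier R \<Longrightarrow> u a = \<infinity> \<longleftrightarrow> a = \<zero>"
    and value_not_minus_infinity: "a \<in> carrier R \<Longrightarrow> u a \<noteq> -\<infinity>"
    and value_neg: "a \<in> carrier R \<Longrightarrow> u a \<le> u (\<ominus> a) + ereal c"
begin

text \<open>Level sets need not be closed under negation, so they are symmetrised.\<close>

definition nbhd :: "real \<Rightarrow> 'a set" where
  "nbhd r = {a \<in> carrier R. ereal r \<le> u a \<and> ereal r \<le> u (\<ominus> a)}"

lemma nbhd_carrier: "a \<in> nbhd r \<Longrightarrow> a \<in> carrier R"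
  by (simp add: nbhd_def)

lemma nbhd_mono: "a \<in> nbhd r \<Longrightarrow> s \<le> r \<Longrightarrow> a \<in> nbhd s"
  by (auto simp: nbhd_def intro: order_trans[of "ereal s" "ereal r"])

lemma neg_zero [simp]: "\<ominus> \<zero> = \<zero>"
  by (rule minus_equality) auto

lemma zero_in_nbhd [simp]: "\<zero> \<in> nbhd r"
  using value_eq_infinity[of \<zero>] by (simp add: nbhd_def)

lemma add_in_nbhd: "a \<in> nbhd r \<Longrightarrow> b \<in> nbhd r \<Longrightarrow> a \<oplus> b \<in> nbhd r"
  using value_add[of a b] value_add[of "\<ominus> a" "\<ominus> b"]
  by (auto simp: nbhd_def minus_add min_le_iff_disj intro: order_trans[of "ereal r"])

lemma neg_in_nbhd: "a \<in> nbhd r \<Longrightarrow> \<ominus> a \<in> nbhd r"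
  by (simp add: nbhd_def)

lemma finsum_in_nbhd:
  assumes "\<And>i. i \<in> I \<Longrightarrow> f i \<in> nbhd r" shows "finsum R f I \<in> nbhd r"
  using assms
proof (induction I rule: infinite_finite_induct)
  case (insert x I)
  then have "finsum R f (insert x I) = f x \<oplus> finsum R f I"
    using nbhd_carrier by (intro finsum_insert) blast+
  then show ?case using insert add_in_nbhd by auto
qed (auto simp: finsum_infinite)

lemma add_pow_in_nbhd: "a \<in> nbhd r \<Longrightarrow> add_pow R (n::nat) a \<in> nbhd r"
  by (induction n) (auto simp: add_in_nbhd nbhd_carrier)

text \<open>Together with \<open>nbhd_in_level_set\<close> this makes level sets and symmetrised
  neighbourhoods cofinal, at the price of |c|. Hence both describe the same topology and the same
  Cauchy sequences.\<close>

lemma level_set_in_nbhd: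
  assumes "a \<in> level_set R u n" and "r + \<bar>c\<bar> \<le> real_of_int n"
  shows "a \<in> nbhd r"
proof -
  have a: "a \<in> carrier R" "ereal (real_of_int n) \<le> u a"
    using assms(1) by (auto simp: level_set_def)
  have "ereal (r + \<bar>c\<bar>) \<le> u a" "ereal r \<le> u a"
    using a(2) assms(2) by (auto intro: order_trans[of _ "ereal (real_of_int n)"])
  moreover have "ereal r \<le> u (\<ominus> a)"
    using value_neg[OF a(1)] \<open>ereal (r + \<bar>c\<bar>) \<le> u a\<close> by (cases "u (\<ominus> a)"; cases "u a") auto
  ultimately show ?thesis
    using a(1) by (simp add: nbhd_def)
qed

lemma nbhd_in_level_set: "a \<in> nbhd r \<Longrightarrow> real_of_int n \<le> r \<Longrightarrow> a \<in> level_set R u n"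
  by (auto simp: nbhd_def level_set_def intro: order_trans[of _ "ereal r"])

text \<open>Holds because the value -\<infinity> is excluded. It gives a fixed factor of a product a
  finite radius, which makes multiplication by that factor continuous.\<close>

lemma nbhd_exhaustive:
  assumes "a \<in> carrier R" obtains r where "a \<in> nbhd r"
proof -
  obtain n where "ereal (real_of_int n) \<le> u a"
  proof (cases "u a")
    case (real x)
    then show ?thesis using that[of "\<lfloor>x\<rfloor>"] by simp
  qed (use assms value_not_minus_infinity that in auto)
  then show ?thesis
    using level_set_in_nbhd[of a n "real_of_int n - \<bar>c\<bar>"] assms that by (auto simp: level_set_def)
qed

text \<open>The Hausdorff property: only zero has the value \<infinity>. Uniqueness of limits rests
  on it.\<close>

lemma nbhd_separated:
  assumes "\<And>r. a \<in> nbhd r" shows "a = \<zero>"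
proof -
  have "ereal r \<le> u a" for r using assms[of r] by (simp add: nbhd_def)
  then have "u a = \<infinity>" by (metis ereal_top)
  then show ?thesis using assms value_eq_infinity nbhd_carrier by blast
qed

section \<open>Differences, balls and the filtration topology\<close>

lemma diff_trans:
  "x \<in> carrier R \<Longrightarrow> y \<in> carrier R \<Longrightarrow> z \<in> carrier R \<Longrightarrow> x \<ominus> z = (x \<ominus> y) \<oplus> (y \<ominus> z)"
  by (metis a_minus_def a_assoc a_inv_closed minus_closed r_neg1)

lemma minus_swap: "x \<in> carrier R \<Longrightarrow> y \<in> carrier R \<Longrightarrow> \<ominus> (x \<ominus> y) = y \<ominus> x"
  by (simp add: a_minus_def minus_add a_comm)

lemma add_diff_add:
  "\<lbrakk>x \<in> carrier R; y \<in> carrier R; z \<in> carrier R; t \<in> carrier R\<rbrakk>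
    \<Longrightarrow> (x \<oplus> y) \<ominus> (z \<oplus> t) = (x \<ominus> z) \<oplus> (y \<ominus> t)"
  by (simp add: a_minus_def minus_add a_ac)

lemma diff_in_nbhd_trans:
  assumes "x \<in> carrier R" "y \<in> carrier R" "z \<in> carrier R" "x \<ominus> y \<in> nbhd r" "y \<ominus> z \<in> nbhd r"
  shows "x \<ominus> z \<in> nbhd r"
  using diff_trans[OF assms(1-3)] add_in_nbhd assms by simp

lemma diff_in_nbhd_sym:
  assumes "x \<in> carrier R" "y \<in> carrier R" "x \<ominus> y \<in> nbhd r"
  shows "y \<ominus> x \<in> nbhd r"
  using minus_swap[OF assms(1,2)] neg_in_nbhd assms(3) by metis

text \<open>A ball is a coset of the subgroup \<open>nbhd r\<close>, so each of its points is a
  centre and the same radius works everywhere.\<close>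

lemma openin_ball:
  assumes "l \<in> carrier R"
  shows "openin (filtration_topology R u) {b \<in> carrier R. b \<ominus> l \<in> nbhd r}"
  unfolding openin_filtration_topology
proof (intro conjI ballI)
  fix a assume a: "a \<in> {b \<in> carrier R. b \<ominus> l \<in> nbhd r}"
  show "\<exists>n. \<forall>b\<in>carrier R. b \<ominus> a \<in> level_set R u n \<longrightarrow> b \<in> {b \<in> carrier R. b \<ominus> l \<in> nbhd r}"
  proof (intro exI ballI impI)
    fix b assume b: "b \<in> carrier R" "b \<ominus> a \<in> level_set R u \<lceil>r + \<bar>c\<bar>\<rceil>"
    then have "b \<ominus> a \<in> nbhd r" by (intro level_set_in_nbhd) auto
    then show "b \<in> {b \<in> carrier R. b \<ominus> l \<in> nbhd r}"
      using diff_in_nbhd_trans[of b a l] a b assms by simp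
  qed
qed auto

lemma openin_filtration_topology_nbhd:
  "openin (filtration_topology R u) U \<longleftrightarrow> U \<subseteq> carrier R \<and>
     (\<forall>a\<in>U. \<exists>r. \<forall>b\<in>carrier R. b \<ominus> a \<in> nbhd r \<longrightarrow> b \<in> U)"
proof -
  have "(\<exists>n. \<forall>b\<in>carrier R. b \<ominus> a \<in> level_set R u n \<longrightarrow> b \<in> U) \<longleftrightarrow>
        (\<exists>r. \<forall>b\<in>carrier R. b \<ominus> a \<in> nbhd r \<longrightarrow> b \<in> U)" for a
  proof
    assume "\<exists>n. \<forall>b\<in>carrier R. b \<ominus> a \<in> level_set R u n \<longrightarrow> b \<in> U"
    then show "\<exists>r. \<forall>b\<in>carrier R. b \<ominus> a \<in> nbhd r \<longrightarrow> b \<in> U"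
      using nbhd_in_level_set by blast
  next
    assume "\<exists>r. \<forall>b\<in>carrier R. b \<ominus> a \<in> nbhd r \<longrightarrow> b \<in> U"
    then obtain r where "\<forall>b\<in>carrier R. b \<ominus> a \<in> nbhd r \<longrightarrow> b \<in> U" by blast
    then show "\<exists>n. \<forall>b\<in>carrier R. b \<ominus> a \<in> level_set R u n \<longrightarrow> b \<in> U"
      using level_set_in_nbhd[of _ "\<lceil>r + \<bar>c\<bar>\<rceil>" r] by (meson le_of_int_ceiling)
  qed
  then show ?thesis by (simp add: openin_filtration_topology)
qed

lemma limitin_filtration_topology:
  "limitin (filtration_topology R u) s l sequentially \<longleftrightarrow> l \<in> carrier R \<and>
     (\<forall>r. \<forall>\<^sub>F n in sequentially. s n \<in> carrier R \<and> s n \<ominus> l \<in> nbhd r)"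
proof
  assume L: "limitin (filtration_topology R u) s l sequentially"
  then have l: "l \<in> carrier R" by (simp add: limitin_def)
  have "\<forall>\<^sub>F n in sequentially. s n \<in> {b \<in> carrier R. b \<ominus> l \<in> nbhd r}" for r
    using L openin_ball[OF l, of r] l by (auto simp: limitin_def a_minus_def r_neg)
  with l show "l \<in> carrier R \<and>
     (\<forall>r. \<forall>\<^sub>F n in sequentially. s n \<in> carrier R \<and> s n \<ominus> l \<in> nbhd r)" by simp
next
  assume R: "l \<in> carrier R \<and>
     (\<forall>r. \<forall>\<^sub>F n in sequentially. s n \<in> carrier R \<and> s n \<ominus> l \<in> nbhd r)"
  show "limitin (filtration_topology R u) s l sequentially"
    unfolding limitin_def
  proof (intro conjI allI impI)
    fix U assume "openin (filtration_topology R u) U \<and> l \<in> U"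
    then obtain r where "\<forall>b\<in>carrier R. b \<ominus> l \<in> nbhd r \<longrightarrow> b \<in> U"
      by (auto simp: openin_filtration_topology_nbhd)
    then show "\<forall>\<^sub>F n in sequentially. s n \<in> U"
      by (intro eventually_mono[OF spec[OF conjunct2[OF R], of r]]) blast
  qed (use R in simp)
qed

lemma limit_unique:
  assumes "limitin (filtration_topology R u) s l sequentially"
    and "limitin (filtration_topology R u) s m sequentially"
  shows "l = m"
proof -
  have lm: "l \<in> carrier R" "m \<in> carrier R"
    using assms by (auto simp: limitin_filtration_topology)
  have "l \<ominus> m \<in> nbhd r" for r
  proof -
    have "\<forall>\<^sub>F n in sequentially. s n \<in> carrier R \<and> s n \<ominus> l \<in> nbhd r \<and> s n \<ominus> m \<in> nbhd r"
      using assms unfolding limitin_filtration_topology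
      by (auto intro: eventually_elim2[of "\<lambda>n. s n \<in> carrier R \<and> s n \<ominus> l \<in> nbhd r" _
            "\<lambda>n. s n \<in> carrier R \<and> s n \<ominus> m \<in> nbhd r"])
    then obtain n where "s n \<in> carrier R" "s n \<ominus> l \<in> nbhd r" "s n \<ominus> m \<in> nbhd r"
      by (auto simp: eventually_sequentially)
    then show ?thesis using lm diff_in_nbhd_trans[of l "s n" m r] diff_in_nbhd_sym by blast
  qed
  then have "l \<ominus> m = \<zero>" by (rule nbhd_separated)
  then show ?thesis using lm by (metis a_minus_def a_inv_closed add.inv_equality minus_minus)
qed

lemma filtration_Cauchy_nbhd:
  "filtration_Cauchy R u s \<longleftrightarrow> (\<forall>n. s n \<in> carrier R) \<and>
     (\<forall>r. \<exists>N. \<forall>m\<ge>N. \<forall>n\<ge>N. s m \<ominus> s n \<in> nbhd r)"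
proof -
  have "(\<forall>d. \<exists>N. \<forall>m\<ge>N. \<forall>n\<ge>N. s m \<ominus> s n \<in> level_set R u d) \<longleftrightarrow>
     (\<forall>r. \<exists>N. \<forall>m\<ge>N. \<forall>n\<ge>N. s m \<ominus> s n \<in> nbhd r)"
  proof
    assume L: "\<forall>d. \<exists>N. \<forall>m\<ge>N. \<forall>n\<ge>N. s m \<ominus> s n \<in> level_set R u d"
    show "\<forall>r. \<exists>N. \<forall>m\<ge>N. \<forall>n\<ge>N. s m \<ominus> s n \<in> nbhd r"
    proof
      fix r
      show "\<exists>N. \<forall>m\<ge>N. \<forall>n\<ge>N. s m \<ominus> s n \<in> nbhd r"
        using L level_set_in_nbhd[of _ "\<lceil>r + \<bar>c\<bar>\<rceil>" r] by (meson le_of_int_ceiling)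
    qed
  qed (use nbhd_in_level_set in blast)
  then show ?thesis by (simp add: filtration_Cauchy_def)
qed

section \<open>Convergent series in a filtered group\<close>

abbreviation "sums_to \<equiv> filtration_sums R u"

lemma sums_iff:
  assumes "\<And>n. f n \<in> carrier R"
  shows "sums_to f l \<longleftrightarrow> l \<in> carrier R \<and>
    (\<forall>r. \<forall>\<^sub>F n in sequentially. finsum R f {..<n} \<ominus> l \<in> nbhd r)"
  using assms by (simp add: filtration_sums_def limitin_filtration_topology Pi_def)

lemma sums_closed: "sums_to f l \<Longrightarrow> l \<in> carrier R"
  by (simp add: filtration_sums_def limitin_filtration_topology)

lemma sums_unique: "sums_to f l \<Longrightarrow> sums_to f m \<Longrightarrow> l = m"
  unfolding filtration_sums_def by (rule limit_unique)

lemma suminf_eq: "sums_to f l \<Longrightarrow> filtration_suminf R u f = l"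
  unfolding filtration_suminf_def using sums_unique by blast

lemma finsum_lessThan_Suc:
  "(\<And>i. f i \<in> carrier R) \<Longrightarrow> finsum R f {..<Suc n} = f n \<oplus> finsum R f {..<n}"
  by (simp add: lessThan_Suc Pi_def)

text \<open>As \<open>nbhd r\<close> is closed under sums, a block of terms is as small as its
  single terms; the length of the block costs nothing.\<close>

lemma finsum_tail_in_nbhd:
  assumes "\<And>i. f i \<in> carrier R" and "\<And>i. N \<le> i \<Longrightarrow> f i \<in> nbhd r" and "N \<le> (n::nat)"
  shows "finsum R f {..<n} \<ominus> finsum R f {..<N} \<in> nbhd r"
  using assms(3)
proof (induction n rule: dec_induct)
  case base
  then show ?case using assms(1) by (simp add: a_minus_def r_neg Pi_def)
next
  case (step n)
  have "finsum R f {..<Suc n} \<ominus> finsum R f {..<N} =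
      f n \<oplus> (finsum R f {..<n} \<ominus> finsum R f {..<N})"
    using assms(1) by (simp add: finsum_lessThan_Suc a_minus_def a_assoc Pi_def)
  then show ?case using step assms(2) add_in_nbhd by simp
qed

text \<open>The error of a partial sum is bounded by the omitted terms alone, whatever the speed of
  convergence: compare with a partial sum so far out that it is close to the limit. This uniformity
  is what the exchange of double sums requires.\<close>

lemma sums_tail_in_nbhd:
  assumes f: "\<And>i. f i \<in> carrier R" and tail: "\<And>i. N \<le> i \<Longrightarrow> f i \<in> nbhd r"
    and "sums_to f l" and n: "N \<le> n"
  shows "finsum R f {..<n} \<ominus> l \<in> nbhd r"
proof -
  have l: "l \<in> carrier R" "\<forall>\<^sub>F n in sequentially. finsum R f {..<n} \<ominus> l \<in> nbhd r"
    using assms(3) f by (auto simp: sums_iff)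
  then obtain M where M: "\<And>m. M \<le> m \<Longrightarrow> finsum R f {..<m} \<ominus> l \<in> nbhd r"
    by (auto simp: eventually_sequentially)
  have "finsum R f {..<max M n} \<ominus> finsum R f {..<n} \<in> nbhd r"
    by (rule finsum_tail_in_nbhd) (use f tail n in auto)
  then have "finsum R f {..<n} \<ominus> finsum R f {..<max M n} \<in> nbhd r"
    using diff_in_nbhd_sym f by (simp add: Pi_def)
  then show ?thesis
    by (rule diff_in_nbhd_trans[rotated 3]) (use M l f in auto)
qed

lemma sums_in_nbhd:
  assumes "\<And>i. f i \<in> nbhd r" and "sums_to f l"
  shows "l \<in> nbhd r"
proof -
  have "finsum R f {..<0::nat} \<ominus> l \<in> nbhd r"
    by (rule sums_tail_in_nbhd[where N = 0]) (use assms nbhd_carrier in auto)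
  then have "\<ominus> l \<in> nbhd r" using sums_closed[OF assms(2)] by (simp add: a_minus_def)
  then show ?thesis using neg_in_nbhd[of "\<ominus> l"] sums_closed[OF assms(2)] by simp
qed

definition null_seq :: "(nat \<Rightarrow> 'a) \<Rightarrow> bool" where
  "null_seq f \<longleftrightarrow> (\<forall>n. f n \<in> carrier R) \<and> (\<forall>r. \<forall>\<^sub>F n in sequentially. f n \<in> nbhd r)"

text \<open>By the strong triangle inequality it suffices for convergence in a complete group that
  the terms tend to zero.\<close>

lemma null_seq_Cauchy:
  assumes "null_seq f" shows "filtration_Cauchy R u (\<lambda>n. finsum R f {..<n})"
  unfolding filtration_Cauchy_nbhd
proof (intro conjI allI)
  have f: "\<And>n. f n \<in> carrier R" using assms by (simp add: null_seq_def)
  then show "finsum R f {..<n} \<in> carrier R" for n by auto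
  fix r
  obtain N where N: "\<And>n. N \<le> n \<Longrightarrow> f n \<in> nbhd r"
    using assms unfolding null_seq_def eventually_sequentially by meson
  have T: "finsum R f {..<n} \<ominus> finsum R f {..<N} \<in> nbhd r" if "N \<le> n" for n
    by (rule finsum_tail_in_nbhd) (use f N that in auto)
  have "finsum R f {..<m} \<ominus> finsum R f {..<n} \<in> nbhd r" if "N \<le> m" "N \<le> n" for m n
    by (rule diff_in_nbhd_trans[of _ "finsum R f {..<N}"])
       (use T that f diff_in_nbhd_sym in auto)
  then show "\<exists>N. \<forall>m\<ge>N. \<forall>n\<ge>N. finsum R f {..<m} \<ominus> finsum R f {..<n} \<in> nbhd r" by blast
qed

lemma null_seq_sums:
  assumes "filtration_complete R u" and "null_seq f"
  shows "sums_to f (filtration_suminf R u f)"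
proof -
  obtain l where "sums_to f l"
    using assms null_seq_Cauchy unfolding filtration_complete_def filtration_sums_def by blast
  then show ?thesis using suminf_eq by simp
qed

lemma sums_add:
  assumes f: "\<And>i. f i \<in> carrier R" and g: "\<And>i. g i \<in> carrier R" and "sums_to f l" and "sums_to g m"
  shows "sums_to (\<lambda>i. f i \<oplus> g i) (l \<oplus> m)"
proof -
  have L: "l \<in> carrier R" "m \<in> carrier R" using assms sums_closed by auto
  have "\<forall>\<^sub>F n in sequentially. finsum R (\<lambda>i. f i \<oplus> g i) {..<n} \<ominus> (l \<oplus> m) \<in> nbhd r" for r
  proof -
    have "\<forall>\<^sub>F n in sequentially. finsum R f {..<n} \<ominus> l \<in> nbhd r"
      "\<forall>\<^sub>F n in sequentially. finsum R g {..<n} \<ominus> m \<in> nbhd r"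
      using assms by (auto simp: sums_iff)
    then show ?thesis
    proof eventually_elim
      case (elim n)
      have "finsum R (\<lambda>i. f i \<oplus> g i) {..<n} \<ominus> (l \<oplus> m) =
          (finsum R f {..<n} \<ominus> l) \<oplus> (finsum R g {..<n} \<ominus> m)"
        using f g L by (simp add: finsum_addf add_diff_add Pi_def)
      then show ?case using elim add_in_nbhd by simp
    qed
  qed
  then show ?thesis using f g L by (simp add: sums_iff)
qed

lemma sums_zero: "sums_to (\<lambda>i. \<zero>) \<zero>"
  by (subst sums_iff) (auto simp: a_minus_def)

lemma sums_finsum:
  assumes "finite E" and "\<And>e i. e \<in> E \<Longrightarrow> f e i \<in> carrier R" and "\<And>e. e \<in> E \<Longrightarrow> sums_to (f e) (l e)"
  shows "sums_to (\<lambda>i. \<Oplus>e\<in>E. f e i) (\<Oplus>e\<in>E. l e)"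
  using assms
proof (induction E rule: finite_induct)
  case empty
  then show ?case by (simp add: sums_zero)
next
  case (insert x E)
  have "sums_to (\<lambda>i. f x i \<oplus> (\<Oplus>e\<in>E. f e i)) (l x \<oplus> (\<Oplus>e\<in>E. l e))"
    by (rule sums_add) (use insert in \<open>auto intro!: finsum_closed\<close>)
  moreover have "l e \<in> carrier R" if "e \<in> insert x E" for e
    using insert that sums_closed by blast
  ultimately show ?case
    using insert by (simp add: Pi_def)
qed

section \<open>Additive maps and reindexing\<close>

lemma additive_zero:
  assumes "additive_end R h" shows "h \<zero> = \<zero>"
  using assms hom_one[of h "add_monoid R" "add_monoid R"] add.is_group by (simp add: additive_end_def)

lemma additive_closed: "additive_end R h \<Longrightarrow> x \<in> carrier R \<Longrightarrow> h x \<in> carrier R"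
  by (auto simp: additive_end_def hom_def)

lemma additive_add:
  "additive_end R h \<Longrightarrow> x \<in> carrier R \<Longrightarrow> y \<in> carrier R \<Longrightarrow> h (x \<oplus> y) = h x \<oplus> h y"
  by (auto simp: additive_end_def hom_def)

lemma additive_neg:
  assumes "additive_end R h" "x \<in> carrier R" shows "h (\<ominus> x) = \<ominus> h x"
  using assms by (metis additive_add additive_closed additive_zero a_inv_closed l_neg minus_equality)

lemma additive_minus:
  "additive_end R h \<Longrightarrow> x \<in> carrier R \<Longrightarrow> y \<in> carrier R \<Longrightarrow> h (x \<ominus> y) = h x \<ominus> h y"
  by (simp add: a_minus_def additive_add additive_neg)

lemma additive_finsum:
  assumes "additive_end R h" and "\<And>i. i \<in> I \<Longrightarrow> f i \<in> carrier R"
  shows "h (finsum R f I) = (\<Oplus>i\<in>I. h (f i))"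
  using assms(2)
  by (induction I rule: infinite_finite_induct)
     (auto simp: additive_zero[OF assms(1)] additive_add[OF assms(1)] additive_closed[OF assms(1)]
        finsum_infinite Pi_def)

lemma additive_add_pow:
  assumes "additive_end R h" and "x \<in> carrier R"
  shows "h (add_pow R (n::nat) x) = add_pow R n (h x)"
  using assms(2)
  by (induction n)
     (auto simp: additive_zero[OF assms(1)] additive_add[OF assms(1)] additive_closed[OF assms(1)])

text \<open>For an additive map continuity at 0 suffices, since it can be applied to the difference
  of partial sum and limit.\<close>

lemma sums_additive:
  assumes h: "additive_end R h" and cont: "\<And>r. \<exists>s. \<forall>x\<in>nbhd s. h x \<in> nbhd r"
    and f: "\<And>i. f i \<in> carrier R" and "sums_to f l"
  shows "sums_to (\<lambda>i. h (f i)) (h l)"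
proof -
  have l: "l \<in> carrier R" using assms sums_closed by auto
  have "\<forall>\<^sub>F n in sequentially. (\<Oplus>i\<in>{..<n}. h (f i)) \<ominus> h l \<in> nbhd r" for r
  proof -
    obtain s where s: "\<forall>x\<in>nbhd s. h x \<in> nbhd r" using cont by blast
    have "\<forall>\<^sub>F n in sequentially. finsum R f {..<n} \<ominus> l \<in> nbhd s"
      using assms by (auto simp: sums_iff)
    then show ?thesis
    proof eventually_elim
      case (elim n)
      have "h (finsum R f {..<n} \<ominus> l) = (\<Oplus>i\<in>{..<n}. h (f i)) \<ominus> h l"
        using f l h by (simp add: additive_minus additive_finsum Pi_def)
      then show ?case using s elim by metis
    qed
  qed
  then show ?thesis using f l h by (simp add: sums_iff additive_closed)
qed

text \<open>Aligns series with different starting points: the inner series of the product formula,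
  indexed by j = i - e, are brought to the common index i, and multiplication by x moves an index by
  one.\<close>

lemma sums_shift:
  assumes g: "\<And>i. g i \<in> carrier R" and "sums_to g l"
  shows "sums_to (\<lambda>i. if i < e then \<zero> else g (i - e)) l"
proof -
  let ?f = "\<lambda>i. if i < e then \<zero> else g (i - e)"
  have f: "?f i \<in> carrier R" for i using g by simp
  have eq: "finsum R ?f {..<n + e} = finsum R g {..<n}" for n
  proof (induction n)
    case 0
    have "finsum R ?f {..<0 + e} = (\<Oplus>i\<in>{..<0+e}. \<zero>)"
      by (rule finsum_cong') auto
    then show ?case by simp
  next
    case (Suc n)
    then show ?case using finsum_lessThan_Suc[of ?f "n + e", OF f] finsum_lessThan_Suc[of g n, OF g] by simp
  qed
  have "\<forall>\<^sub>F n in sequentially. finsum R ?f {..<n} \<ominus> l \<in> nbhd r" for r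
  proof -
    have "\<forall>\<^sub>F n in sequentially. finsum R g {..<n} \<ominus> l \<in> nbhd r"
      using assms by (auto simp: sums_iff)
    then have "\<forall>\<^sub>F n in sequentially. finsum R ?f {..<n + e} \<ominus> l \<in> nbhd r" by (simp only: eq)
    then show ?thesis by (rule iffD1[OF eventually_sequentially_seg[of "\<lambda>n. finsum R ?f {..<n} \<ominus> l \<in> nbhd r" e]])
  qed
  then show ?thesis using sums_iff[of ?f l, OF f] sums_closed[OF assms(2)] by blast
qed

section \<open>Double series\<close>

lemma finsum_swap:
  assumes "finite I" "finite J" "\<And>i j. i \<in> I \<Longrightarrow> j \<in> J \<Longrightarrow> f i j \<in> carrier R"
  shows "(\<Oplus>i\<in>I. \<Oplus>j\<in>J. f i j) = (\<Oplus>j\<in>J. \<Oplus>i\<in>I. f i j)"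
  using assms(1,3)
proof (induction I rule: finite_induct)
  case (insert x I)
  have "(\<Oplus>i\<in>insert x I. \<Oplus>j\<in>J. f i j) = (\<Oplus>j\<in>J. f x j) \<oplus> (\<Oplus>i\<in>I. \<Oplus>j\<in>J. f i j)"
    using insert by (simp add: Pi_def)
  also have "\<dots> = (\<Oplus>j\<in>J. f x j) \<oplus> (\<Oplus>j\<in>J. \<Oplus>i\<in>I. f i j)"
    using insert by simp
  also have "\<dots> = (\<Oplus>j\<in>J. f x j \<oplus> (\<Oplus>i\<in>I. f i j))"
    using insert by (intro finsum_addf[symmetric]) (auto intro!: finsum_closed)
  also have "\<dots> = (\<Oplus>j\<in>J. \<Oplus>i\<in>insert x I. f i j)"
    using insert by (intro finsum_cong') (auto intro!: finsum_closed simp: Pi_def)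
  finally show ?case .
qed simp

lemma finsum_diff_in_nbhd:
  assumes "\<And>i. i \<in> I \<Longrightarrow> f i \<in> carrier R" "\<And>i. i \<in> I \<Longrightarrow> g i \<in> carrier R"
    and "\<And>i. i \<in> I \<Longrightarrow> f i \<ominus> g i \<in> nbhd r"
  shows "finsum R f I \<ominus> finsum R g I \<in> nbhd r"
  using assms
proof (induction I rule: infinite_finite_induct)
  case (insert x I)
  then have "finsum R f (insert x I) \<ominus> finsum R g (insert x I) =
      (f x \<ominus> g x) \<oplus> (finsum R f I \<ominus> finsum R g I)"
    by (simp add: Pi_def add_diff_add)
  then show ?case using insert add_in_nbhd by auto
qed (auto simp: finsum_infinite a_minus_def)

text \<open>The entries are uniformly small outside a K by K square. For n \<ge> K the finite n by n
  sum therefore differs by at most \<open>nbhd r\<close> from the first n row sums and likewise from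
  the first n column sums, and the finite sums may be exchanged. Convergence of the column sums is
  part of the conclusion.\<close>

lemma sums_interchange:
  assumes f: "\<And>i j. f i j \<in> carrier R"
    and small: "\<And>r. \<exists>K. \<forall>i j. K \<le> i \<or> K \<le> j \<longrightarrow> f i j \<in> nbhd r"
    and rows: "\<And>i. sums_to (f i) (row i)" and cols: "\<And>j. sums_to (\<lambda>i. f i j) (col j)"
    and "sums_to row l"
  shows "sums_to col l"
proof -
  have row: "row i \<in> carrier R" and col: "col i \<in> carrier R" and l: "l \<in> carrier R" for i
    using assms sums_closed by blast+
  have "\<forall>\<^sub>F n in sequentially. finsum R col {..<n} \<ominus> l \<in> nbhd r" for r
  proof -
    obtain K where K: "\<And>i j. K \<le> i \<or> K \<le> j \<Longrightarrow> f i j \<in> nbhd r" using small by meson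
    have "finsum R col {..<n} \<ominus> l \<in> nbhd r" if n: "K \<le> n" for n
    proof -
      have 1: "(\<Oplus>j\<in>{..<n}. \<Oplus>i\<in>{..<n}. f i j) \<ominus> finsum R col {..<n} \<in> nbhd r"
        by (rule finsum_diff_in_nbhd)
           (use f col K n in \<open>auto intro!: finsum_closed sums_tail_in_nbhd[OF _ _ cols, of _ K]\<close>)
      have 2: "(\<Oplus>i\<in>{..<n}. \<Oplus>j\<in>{..<n}. f i j) \<ominus> finsum R row {..<n} \<in> nbhd r"
        by (rule finsum_diff_in_nbhd)
           (use f row K n in \<open>auto intro!: finsum_closed sums_tail_in_nbhd[OF _ _ rows, of _ K]\<close>)
      have 3: "finsum R row {..<n} \<ominus> l \<in> nbhd r"
        by (rule sums_tail_in_nbhd[of _ K])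
           (use row n K assms(5) in \<open>auto intro: sums_in_nbhd[OF _ rows]\<close>)
      have cl: "(\<Oplus>j\<in>{..<n}. \<Oplus>i\<in>{..<n}. f i j) \<in> carrier R" "finsum R row {..<n} \<in> carrier R"
        "finsum R col {..<n} \<in> carrier R"
        using f row col by (auto intro!: finsum_closed)
      have "(\<Oplus>i\<in>{..<n}. \<Oplus>j\<in>{..<n}. f i j) = (\<Oplus>j\<in>{..<n}. \<Oplus>i\<in>{..<n}. f i j)"
        using f by (intro finsum_swap) auto
      then show ?thesis
        using 1 2 3 cl l diff_in_nbhd_sym diff_in_nbhd_trans by metis
    qed
    then show ?thesis by (auto simp: eventually_sequentially)
  qed
  then show ?thesis using col l by (simp add: sums_iff)
qed

end

section \<open>Topological rings from filtrations\<close>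

text \<open>Submultiplicativity only up to a constant; this is all that \<open>v\<^sub>\<epsilon>\<close> satisfies.\<close>

locale quasi_filtered_ring = ring R + filtered_group R u c for R (structure) and u c +
  fixes K :: real
  assumes mult_in_nbhd: "a \<in> nbhd r \<Longrightarrow> b \<in> nbhd s \<Longrightarrow> a \<otimes> b \<in> nbhd (r + s + K)"
begin

lemma sums_mult_left:
  assumes "a \<in> carrier R" "\<And>i. f i \<in> carrier R" "sums_to f l"
  shows "sums_to (\<lambda>i. a \<otimes> f i) (a \<otimes> l)"
proof (rule sums_additive[of "\<lambda>x. a \<otimes> x"])
  show "additive_end R (\<lambda>x. a \<otimes> x)"
    using assms(1) by (auto simp: additive_end_def hom_def r_distr)
  obtain s where "a \<in> nbhd s" using assms(1) nbhd_exhaustive by blast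
  then have "\<forall>x\<in>nbhd (r - s - K). a \<otimes> x \<in> nbhd r" for r
    using mult_in_nbhd[of a s _ "r - s - K"] by simp
  then show "\<exists>s. \<forall>x\<in>nbhd s. a \<otimes> x \<in> nbhd r" for r by blast
qed (use assms in auto)

lemma sums_mult_right:
  assumes "a \<in> carrier R" "\<And>i. f i \<in> carrier R" "sums_to f l"
  shows "sums_to (\<lambda>i. f i \<otimes> a) (l \<otimes> a)"
proof (rule sums_additive[of "\<lambda>x. x \<otimes> a"])
  show "additive_end R (\<lambda>x. x \<otimes> a)"
    using assms(1) by (auto simp: additive_end_def hom_def l_distr)
  obtain s where "a \<in> nbhd s" using assms(1) nbhd_exhaustive by blast
  then have "\<forall>x\<in>nbhd (r - s - K). x \<otimes> a \<in> nbhd r" for r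
    using mult_in_nbhd[of _ "r - s - K" a s] by simp
  then show "\<exists>s. \<forall>x\<in>nbhd s. x \<otimes> a \<in> nbhd r" for r by blast
qed (use assms in auto)

lemma continuous_map_binary:
  assumes cl: "\<And>a b. a \<in> carrier R \<Longrightarrow> b \<in> carrier R \<Longrightarrow> g a b \<in> carrier R"
    and cont: "\<And>a b r. a \<in> carrier R \<Longrightarrow> b \<in> carrier R \<Longrightarrow>
      \<exists>s. \<forall>x\<in>carrier R. \<forall>y\<in>carrier R. x \<ominus> a \<in> nbhd s \<longrightarrow> y \<ominus> b \<in> nbhd s \<longrightarrow>
        g x y \<ominus> g a b \<in> nbhd r"
  defines "X \<equiv> filtration_topology R u"
  shows "continuous_map (prod_topology X X) X (\<lambda>(a, b). g a b)"
  unfolding continuous_map_def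
proof (intro conjI allI impI)
  show "(\<lambda>(a, b). g a b) \<in> topspace (prod_topology X X) \<rightarrow> topspace X"
    using cl by (auto simp: X_def)
  fix U assume U: "openin X U"
  show "openin (prod_topology X X) {p \<in> topspace (prod_topology X X). (case p of (a, b) \<Rightarrow> g a b) \<in> U}"
    unfolding openin_prod_topology_alt
  proof (intro allI impI)
    fix a b assume "(a, b) \<in> {p \<in> topspace (prod_topology X X). (case p of (a, b) \<Rightarrow> g a b) \<in> U}"
    then have ab: "a \<in> carrier R" "b \<in> carrier R" "g a b \<in> U" by (auto simp: X_def)
    obtain r where r: "\<forall>z\<in>carrier R. z \<ominus> g a b \<in> nbhd r \<longrightarrow> z \<in> U"
      using U ab(3) by (auto simp: X_def openin_filtration_topology_nbhd)
    obtain s where s: "\<forall>x\<in>carrier R. \<forall>y\<in>carrier R. x \<ominus> a \<in> nbhd s \<longrightarrow> y \<ominus> b \<in> nbhd s \<longrightarrow>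
        g x y \<ominus> g a b \<in> nbhd r"
      using cont[OF ab(1,2)] by blast
    let ?B = "\<lambda>l. {z \<in> carrier R. z \<ominus> l \<in> nbhd s}"
    have "openin X (?B a)" "openin X (?B b)" "a \<in> ?B a" "b \<in> ?B b"
      using ab openin_ball by (auto simp: X_def a_minus_def r_neg)
    moreover have "?B a \<times> ?B b \<subseteq> {p \<in> topspace (prod_topology X X). (case p of (a, b) \<Rightarrow> g a b) \<in> U}"
      using s r cl by (auto simp: X_def)
    ultimately show "\<exists>V W. openin X V \<and> openin X W \<and> a \<in> V \<and> b \<in> W \<and>
        V \<times> W \<subseteq> {p \<in> topspace (prod_topology X X). (case p of (a, b) \<Rightarrow> g a b) \<in> U}"
      by blast
  qed
qed

lemma topological_ring: "topological_ring R (filtration_topology R u)"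
  unfolding topological_ring_def
proof (intro conjI)
  let ?X = "filtration_topology R u"
  show "ring R" by (rule ring_axioms)
  show "continuous_map (prod_topology ?X ?X) ?X (\<lambda>(a, b). a \<oplus> b)"
  proof (rule continuous_map_binary)
    fix a b r assume "a \<in> carrier R" "b \<in> carrier R"
    then have "\<forall>x\<in>carrier R. \<forall>y\<in>carrier R. x \<ominus> a \<in> nbhd r \<longrightarrow> y \<ominus> b \<in> nbhd r \<longrightarrow>
        (x \<oplus> y) \<ominus> (a \<oplus> b) \<in> nbhd r"
      using add_in_nbhd by (simp add: add_diff_add)
    then show "\<exists>s. \<forall>x\<in>carrier R. \<forall>y\<in>carrier R. x \<ominus> a \<in> nbhd s \<longrightarrow> y \<ominus> b \<in> nbhd s \<longrightarrow>
        (x \<oplus> y) \<ominus> (a \<oplus> b) \<in> nbhd r" by blast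
  qed simp
  show "continuous_map (prod_topology ?X ?X) ?X (\<lambda>(a, b). a \<otimes> b)"
  proof (rule continuous_map_binary)
    fix a b r assume ab: "a \<in> carrier R" "b \<in> carrier R"
    obtain p q where pq: "a \<in> nbhd p" "b \<in> nbhd q" using ab nbhd_exhaustive by meson
    \<comment> \<open>With x = a + (x - a) and y = b + (y - b), the first two bounds control the
      terms a (y - b) and (x - a) b. The last two control (x - a) (y - b), because s \<ge> 0 and s
      \<ge> r - K imply 2 s + K \<ge> r.\<close>
    define s where "s = max (max (r - q - K) (r - p - K)) (max 0 (r - K))"
    have "x \<otimes> y \<ominus> a \<otimes> b \<in> nbhd r"
      if xy: "x \<in> carrier R" "y \<in> carrier R" "x \<ominus> a \<in> nbhd s" "y \<ominus> b \<in> nbhd s" for x y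
    proof -
      have "x \<otimes> y = ((x \<ominus> a) \<oplus> a) \<otimes> ((y \<ominus> b) \<oplus> b)"
        using xy ab by (simp add: diff_add_cancel)
      also have "\<dots> = a \<otimes> b \<oplus> (a \<otimes> (y \<ominus> b) \<oplus> ((x \<ominus> a) \<otimes> b \<oplus> (x \<ominus> a) \<otimes> (y \<ominus> b)))"
        using xy(1,2) ab by (simp add: l_distr r_distr a_ac)
      finally have "x \<otimes> y \<ominus> a \<otimes> b =
          a \<otimes> (y \<ominus> b) \<oplus> ((x \<ominus> a) \<otimes> b \<oplus> (x \<ominus> a) \<otimes> (y \<ominus> b))"
        using xy(1,2) ab by (simp add: add_diff_cancel)
      moreover have "a \<otimes> (y \<ominus> b) \<in> nbhd r"
        by (rule nbhd_mono[OF mult_in_nbhd[OF pq(1) xy(4)]]) (auto simp: s_def)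
      moreover have "(x \<ominus> a) \<otimes> b \<in> nbhd r"
        by (rule nbhd_mono[OF mult_in_nbhd[OF xy(3) pq(2)]]) (auto simp: s_def)
      moreover have "0 \<le> s" "r - K \<le> s" by (auto simp: s_def)
      then have "r \<le> s + s + K" by simp
      then have "(x \<ominus> a) \<otimes> (y \<ominus> b) \<in> nbhd r"
        by (rule nbhd_mono[OF mult_in_nbhd[OF xy(3) xy(4)]])
      ultimately show ?thesis by (simp add: add_in_nbhd)
    qed
    then show "\<exists>s. \<forall>x\<in>carrier R. \<forall>y\<in>carrier R. x \<ominus> a \<in> nbhd s \<longrightarrow> y \<ominus> b \<in> nbhd s \<longrightarrow>
        x \<otimes> y \<ominus> a \<otimes> b \<in> nbhd r" by blast
  qed simp
  show "continuous_map ?X ?X (\<lambda>a. \<ominus> a)"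
    unfolding continuous_map_def
  proof (intro conjI allI impI)
    fix U assume U: "openin ?X U"
    show "openin ?X {x \<in> topspace ?X. \<ominus> x \<in> U}"
      unfolding openin_filtration_topology_nbhd
    proof (intro conjI ballI)
      fix a assume a: "a \<in> {x \<in> topspace ?X. \<ominus> x \<in> U}"
      then obtain r where r: "\<forall>z\<in>carrier R. z \<ominus> (\<ominus> a) \<in> nbhd r \<longrightarrow> z \<in> U"
        using U by (auto simp: openin_filtration_topology_nbhd)
      have "\<ominus> b \<ominus> (\<ominus> a) = \<ominus> (b \<ominus> a)" if "b \<in> carrier R" for b
        using a that by (simp add: a_minus_def minus_add)
      then show "\<exists>r. \<forall>b\<in>carrier R. b \<ominus> a \<in> nbhd r \<longrightarrow> b \<in> {x \<in> topspace ?X. \<ominus> x \<in> U}"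
        using r neg_in_nbhd by (intro exI[of _ r] ballI impI) auto
    qed auto
  qed auto
qed simp

end

section \<open>Skew power series\<close>

lemma additive_end_compose: "additive_end R f \<Longrightarrow> additive_end R g \<Longrightarrow> additive_end R (f \<circ> g)"
  unfolding additive_end_def by (rule hom_compose)

lemma additive_end_funpow: "additive_end R f \<Longrightarrow> additive_end R (f ^^ n)"
  by (induction n) (simp_all add: additive_end_compose, simp add: additive_end_def hom_def id_def)

text \<open>Quasi-compatibility enters only through \<open>growth\<close>: with \<open>deg(\<sigma>\<^sup>i \<delta>\<^sup>j) \<ge> B\<close> and
  \<open>deg(\<delta>\<^sup>N) \<ge> 1\<close> one can take \<open>\<theta> = 1/N\<close> and \<open>C = B - 1\<close>.\<close>

locale skew_series = quasi_filtered_ring R u c 0 for R (structure) and u c +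
  fixes \<sigma> \<delta> :: "'a \<Rightarrow> 'a" and C \<theta> :: real
  assumes complete: "filtration_complete R u"
    and \<sigma>_hom: "\<sigma> \<in> ring_hom R R"
    and \<delta>_additive: "additive_end R \<delta>"
    and \<delta>_mult: "a \<in> carrier R \<Longrightarrow> b \<in> carrier R \<Longrightarrow> \<delta> (a \<otimes> b) = \<delta> a \<otimes> b \<oplus> \<sigma> a \<otimes> \<delta> b"
    and \<sigma>_\<delta>_commute: "a \<in> carrier R \<Longrightarrow> \<sigma> (\<delta> a) = \<delta> (\<sigma> a)"
    and \<theta>_pos: "0 < \<theta>"
    and growth: "a \<in> nbhd r \<Longrightarrow> (\<sigma> ^^ e) ((\<delta> ^^ j) a) \<in> nbhd (r + C + \<theta> * real j)"
begin

lemma \<sigma>_additive: "additive_end R \<sigma>"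
  using \<sigma>_hom by (auto simp: additive_end_def hom_def ring_hom_def)

lemma \<sigma>_closed [simp]: "a \<in> carrier R \<Longrightarrow> \<sigma> a \<in> carrier R"
  and \<delta>_closed [simp]: "a \<in> carrier R \<Longrightarrow> \<delta> a \<in> carrier R"
  and \<sigma>_pow_closed [simp]: "a \<in> carrier R \<Longrightarrow> (\<sigma> ^^ n) a \<in> carrier R"
  and \<delta>_pow_closed [simp]: "a \<in> carrier R \<Longrightarrow> (\<delta> ^^ n) a \<in> carrier R"
  using additive_closed \<sigma>_additive \<delta>_additive additive_end_funpow by blast+

lemma \<sigma>_mult: "a \<in> carrier R \<Longrightarrow> b \<in> carrier R \<Longrightarrow> \<sigma> (a \<otimes> b) = \<sigma> a \<otimes> \<sigma> b"
  using \<sigma>_hom by (auto simp: ring_hom_def)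

lemma \<sigma>_one: "\<sigma> \<one> = \<one>"
  using \<sigma>_hom by (auto simp: ring_hom_def)

lemma \<delta>_one: "\<delta> \<one> = \<zero>"
  using \<delta>_mult[of \<one> \<one>] by (simp add: \<sigma>_one)

lemma \<delta>_pow_\<sigma>: "a \<in> carrier R \<Longrightarrow> \<delta> ((\<sigma> ^^ e) a) = (\<sigma> ^^ e) (\<delta> a)"
  by (induction e) (auto simp flip: \<sigma>_\<delta>_commute)

lemma \<sigma>_nbhd: "a \<in> nbhd (r - C) \<Longrightarrow> \<sigma> a \<in> nbhd r"
  using growth[of a "r - C" 1 0] by simp

lemma \<delta>_nbhd: "a \<in> nbhd (r - C) \<Longrightarrow> \<delta> a \<in> nbhd r"
  using growth[of a "r - C" 0 1] \<theta>_pos by (auto intro: nbhd_mono)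

lemma sums_\<sigma>: "(\<And>i. f i \<in> carrier R) \<Longrightarrow> sums_to f l \<Longrightarrow> sums_to (\<lambda>i. \<sigma> (f i)) (\<sigma> l)"
  using \<sigma>_nbhd by (intro sums_additive[OF \<sigma>_additive]) auto

lemma sums_\<delta>: "(\<And>i. f i \<in> carrier R) \<Longrightarrow> sums_to f l \<Longrightarrow> sums_to (\<lambda>i. \<delta> (f i)) (\<delta> l)"
  using \<delta>_nbhd by (intro sums_additive[OF \<delta>_additive]) auto

section \<open>Left multiplication by the variable\<close>

definition lmult_X :: "(nat \<Rightarrow> 'a) \<Rightarrow> nat \<Rightarrow> 'a" where
  "lmult_X b k = \<delta> (b k) \<oplus> (if k = 0 then \<zero> else \<sigma> (b (k - 1)))"

lemma lmult_X_closed: "(\<And>k. b k \<in> carrier R) \<Longrightarrow> lmult_X b k \<in> carrier R"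
  by (simp add: lmult_X_def)

lemma lmult_X_pow_closed: "(\<And>k. b k \<in> carrier R) \<Longrightarrow> (lmult_X ^^ i) b k \<in> carrier R"
  by (induction i arbitrary: k) (auto simp: lmult_X_closed)

lemma sums_lmult_X:
  assumes "\<And>i k. F i k \<in> carrier R" and "\<And>k. sums_to (\<lambda>i. F i k) (L k)"
  shows "sums_to (\<lambda>i. lmult_X (F i) k) (lmult_X L k)"
proof -
  have 1: "sums_to (\<lambda>i. \<delta> (F i k)) (\<delta> (L k))" for k
    by (rule sums_\<delta>[of "\<lambda>i. F i k"]) (rule assms)+
  have 2: "sums_to (\<lambda>i. \<sigma> (F i k)) (\<sigma> (L k))" for k
    by (rule sums_\<sigma>[of "\<lambda>i. F i k"]) (rule assms)+
  have 3: "sums_to (\<lambda>i. if k = 0 then \<zero> else \<sigma> (F i (k - 1))) (if k = 0 then \<zero> else \<sigma> (L (k - 1)))"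
    by (cases "k = 0") (simp_all add: sums_zero 2)
  show ?thesis
    unfolding lmult_X_def by (rule sums_add[OF _ _ 1 3]) (simp_all add: assms(1))
qed

text \<open>The relation x r = \<sigma>(r) x + \<delta>(r) applied to a series b, since x (r b) = (x
  r) b.\<close>

lemma lmult_X_smult:
  assumes "r \<in> carrier R" "\<And>k. b k \<in> carrier R"
  shows "lmult_X (\<lambda>k. r \<otimes> b k) k = \<sigma> r \<otimes> lmult_X b k \<oplus> \<delta> r \<otimes> b k"
  using assms by (simp add: lmult_X_def \<delta>_mult \<sigma>_mult r_distr a_ac)

text \<open>As \<sigma> and \<delta> commute, all words with e letters \<sigma> and i - e letters
  \<delta> agree, and there are i choose e of them. The induction step is Pascal's rule. This links
  the operator to the binomial coefficients of the product formula.\<close>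

lemma lmult_X_pow:
  assumes b: "\<And>k. b k \<in> carrier R"
  shows "(lmult_X ^^ i) b k =
    (\<Oplus>e\<in>{..k}. add_pow R (i choose e) ((\<sigma> ^^ e) ((\<delta> ^^ (i - e)) (b (k - e)))))"
proof (induction i arbitrary: k)
  case 0
  have "(\<Oplus>e\<in>{..k}. add_pow R (0 choose e) ((\<sigma> ^^ e) ((\<delta> ^^ (0 - e)) (b (k - e))))) =
      (\<Oplus>e\<in>{..k}. if 0 = e then b (k - e) else \<zero>)"
    using b by (intro finsum_cong') (auto simp: binomial_eq_0)
  also have "\<dots> = b (k - 0)" using b by (intro finsum_singleton) auto
  finally show ?case by simp
next
  case (Suc i)
  let ?g = "\<lambda>i k e. add_pow R (i choose e) ((\<sigma> ^^ e) ((\<delta> ^^ (i - e)) (b (k - e))))"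
  let ?h = "\<lambda>n e. add_pow R (n::nat) ((\<sigma> ^^ e) ((\<delta> ^^ (Suc i - e)) (b (k - e))))"
  have cl: "?h n e \<in> carrier R" "?g i k e \<in> carrier R" for n i k e
    using b by auto
  have 1: "\<delta> (\<Oplus>e\<in>{..k}. ?g i k e) = (\<Oplus>e\<in>{..k}. ?h (i choose e) e)"
  proof -
    \<comment> \<open>For e > i the truncated difference i - e is harmless because the binomial
      coefficient vanishes.\<close>
    have "\<delta> (?g i k e) = ?h (i choose e) e" for e
      using b by (cases "e \<le> i")
        (auto simp: additive_add_pow[OF \<delta>_additive] \<delta>_pow_\<sigma> Suc_diff_le binomial_eq_0
           additive_zero[OF \<delta>_additive])
    then show ?thesis using cl by (simp add: additive_finsum[OF \<delta>_additive])
  qed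
  \<comment> \<open>Applying \<sigma> and multiplying by x raises e and k by one. Reindexed, this
    sum runs over the same e as the \<delta> part, ready for Pascal's rule.\<close>
  have 2: "(if k = 0 then \<zero> else \<sigma> (\<Oplus>e\<in>{..k-1}. ?g i (k-1) e)) =
      (\<Oplus>e\<in>{..k}. if e = 0 then \<zero> else ?h (i choose (e - 1)) e)"
  proof (cases k)
    case (Suc k')
    have "\<sigma> (?g i k' e) = ?h (i choose e) (Suc e)" for e
      using b by (auto simp: additive_add_pow[OF \<sigma>_additive] Suc)
    then have "\<sigma> (\<Oplus>e\<in>{..k'}. ?g i k' e) = (\<Oplus>e\<in>{..k'}. ?h (i choose e) (Suc e))"
      using cl by (simp add: additive_finsum[OF \<sigma>_additive])
    also have "\<dots> = (\<Oplus>e\<in>{..Suc k'}. if e = 0 then \<zero> else ?h (i choose (e - 1)) e)"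
      by (subst finsum_Suc2) (use b in \<open>auto intro!: finsum_closed r_zero[symmetric]\<close>)
    finally show ?thesis using Suc by simp
  qed simp
  have "(lmult_X ^^ Suc i) b k = (\<Oplus>e\<in>{..k}. ?h (i choose e) e) \<oplus>
      (\<Oplus>e\<in>{..k}. if e = 0 then \<zero> else ?h (i choose (e - 1)) e)"
  proof -
    have "(lmult_X ^^ Suc i) b k = \<delta> ((lmult_X ^^ i) b k) \<oplus>
        (if k = 0 then \<zero> else \<sigma> ((lmult_X ^^ i) b (k - 1)))"
      by (simp add: lmult_X_def)
    then show ?thesis unfolding Suc.IH 1 2 .
  qed
  also have "\<dots> = (\<Oplus>e\<in>{..k}. ?h (i choose e) e \<oplus> (if e = 0 then \<zero> else ?h (i choose (e - 1)) e))"
    using cl by (intro finsum_addf[symmetric]) auto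
  also have "\<dots> = (\<Oplus>e\<in>{..k}. ?g (Suc i) k e)"
  proof (intro finsum_cong' refl)
    fix e assume "e \<in> {..k}"
    show "?h (i choose e) e \<oplus> (if e = 0 then \<zero> else ?h (i choose (e - 1)) e) = ?g (Suc i) k e"
      using b by (cases e) (simp_all add: add.nat_pow_mult add.commute)
  qed (use cl in auto)
  finally show ?case .
qed

text \<open>In the term with index e, \<delta>^(i-e) gains \<theta> (i - e) and the coefficient
  b_(k-e) loses \<epsilon> (k - e). As \<epsilon> \<le> \<theta>, the balance is at least \<epsilon>
  (i - k), which is independent of e.\<close>

lemma lmult_X_pow_nbhd:
  assumes b: "\<And>l. b l \<in> nbhd (m - \<epsilon> * real l)" and \<epsilon>: "0 \<le> \<epsilon>" "\<epsilon> \<le> \<theta>"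
  shows "(lmult_X ^^ i) b k \<in> nbhd (m + C + \<epsilon> * (real i - real k))"
proof -
  have bc: "b l \<in> carrier R" for l using b nbhd_carrier by blast
  have "add_pow R (i choose e) ((\<sigma> ^^ e) ((\<delta> ^^ (i - e)) (b (k - e))))
      \<in> nbhd (m + C + \<epsilon> * (real i - real k))" if e: "e \<le> k" for e
  proof (cases "e \<le> i")
    case True
    have "(\<sigma> ^^ e) ((\<delta> ^^ (i - e)) (b (k - e)))
        \<in> nbhd (m - \<epsilon> * real (k - e) + C + \<theta> * real (i - e))"
      by (rule growth[OF b])
    moreover have "m + C + \<epsilon> * (real i - real k) \<le> m - \<epsilon> * real (k - e) + C + \<theta> * real (i - e)"
    proof -
      have "\<epsilon> * real (i - e) \<le> \<theta> * real (i - e)" using \<epsilon> by (simp add: mult_right_mono)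
      then show ?thesis using True e by (simp add: of_nat_diff algebra_simps)
    qed
    ultimately show ?thesis using add_pow_in_nbhd nbhd_mono by blast
  qed (simp add: binomial_eq_0)
  then show ?thesis
    unfolding lmult_X_pow[OF bc] by (intro finsum_in_nbhd) auto
qed

section \<open>Bounded series and their products\<close>

abbreviation bounded_by :: "real \<Rightarrow> (nat \<Rightarrow> 'a) \<Rightarrow> bool" where
  "bounded_by m b \<equiv> \<forall>l. b l \<in> nbhd m"

lemma bounded_seq_iff: "bounded_seq R u b \<longleftrightarrow> (\<exists>m. bounded_by m b)"
proof
  assume "bounded_seq R u b"
  then obtain M where M: "\<And>n. b n \<in> level_set R u M"
    by (auto simp: bounded_seq_def level_set_def)
  have "bounded_by (real_of_int M - \<bar>c\<bar>) b" using level_set_in_nbhd[OF M] by simp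
  then show "\<exists>m. bounded_by m b" by blast
next
  assume "\<exists>m. bounded_by m b"
  then obtain m where "bounded_by m b" by blast
  then have "b n \<in> level_set R u \<lfloor>m\<rfloor>" for n by (meson nbhd_in_level_set of_int_floor_le)
  then show "bounded_seq R u b" by (auto simp: bounded_seq_def level_set_def)
qed

text \<open>A constant lower bound m is stronger than m - \<epsilon> l, so for bounded series the
  slope is at free disposal.\<close>

lemma bounded_by_lmult_X_pow:
  assumes "bounded_by m b" "0 \<le> \<epsilon>" "\<epsilon> \<le> \<theta>"
  shows "(lmult_X ^^ i) b k \<in> nbhd (m + C + \<epsilon> * (real i - real k))"
  by (rule lmult_X_pow_nbhd) (use assms nbhd_mono[of _ m] in auto)

lemma skew_term_null_seq:
  assumes a: "bounded_by p a" and b: "bounded_by q b"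
  shows "null_seq (skew_term R \<sigma> \<delta> a b k e)"
proof -
  have ac: "a n \<in> carrier R" and bc: "b n \<in> carrier R" for n
    using a b nbhd_carrier by blast+
  have t: "skew_term R \<sigma> \<delta> a b k e j \<in> nbhd (p + (q + C + \<theta> * real j) + 0)" for j
    unfolding skew_term_def using a b by (intro add_pow_in_nbhd mult_in_nbhd growth) auto
  show ?thesis
    unfolding null_seq_def
  proof (intro conjI allI)
    show "skew_term R \<sigma> \<delta> a b k e n \<in> carrier R" for n using t nbhd_carrier by blast
    fix r
    \<comment> \<open>Solves p + q + C + \<theta> j \<ge> r for j; here \<theta> > 0 is
      essential.\<close>
    obtain N where "(r - p - q - C) / \<theta> \<le> real N" using real_arch_simple by blast
    then have "r \<le> p + (q + C + \<theta> * real j) + 0" if "N \<le> j" for j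
    proof -
      have "(r - p - q - C) / \<theta> \<le> real j"
        using that \<open>(r - p - q - C) / \<theta> \<le> real N\<close> by linarith
      then show ?thesis using \<theta>_pos by (simp add: field_simps)
    qed
    then show "\<forall>\<^sub>F j in sequentially. skew_term R \<sigma> \<delta> a b k e j \<in> nbhd r"
      unfolding eventually_sequentially using t nbhd_mono by meson
  qed
qed

lemma skew_term_summable:
  assumes "bounded_seq R u a" "bounded_seq R u b"
  shows "filtration_summable R u (skew_term R \<sigma> \<delta> a b k e)"
proof -
  obtain p q where "bounded_by p a" "bounded_by q b"
    using assms by (auto simp: bounded_seq_iff)
  then have "null_seq (skew_term R \<sigma> \<delta> a b k e)" by (rule skew_term_null_seq)
  then show ?thesis
    using null_seq_sums[OF complete] by (auto simp: filtration_summable_def null_seq_def)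
qed

text \<open>Exchanging the finite sum over \<open>e\<close> with the series over \<open>i\<close> turns the product formula into
  \<open>a b = \<Sum>\<^sub>i a\<^sub>i (x\<^sup>i b)\<close>, from which associativity is accessible.\<close>

lemma series_mult_sums:
  assumes "bounded_by p a" and "bounded_by q b"
  shows "sums_to (\<lambda>i. a i \<otimes> (lmult_X ^^ i) b k) (skew_series_mult R u \<sigma> \<delta> a b k)"
proof -
  have ac: "a n \<in> carrier R" and bc: "b n \<in> carrier R" for n
    using assms nbhd_carrier by blast+
  let ?t = "skew_term R \<sigma> \<delta> a b k"
  have tc: "?t e j \<in> carrier R" for e j using ac bc by (simp add: skew_term_def)
  let ?s = "\<lambda>e i. if i < e then \<zero> else ?t e (i - e)"
  have "sums_to (\<lambda>i. \<Oplus>e\<in>{..k}. ?s e i) (\<Oplus>e\<in>{..k}. filtration_suminf R u (?t e))"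
  proof (rule sums_finsum)
    show "sums_to (?s e) (filtration_suminf R u (?t e))" for e
      by (rule sums_shift[OF tc null_seq_sums[OF complete skew_term_null_seq[OF assms]]])
  qed (use tc in auto)
  moreover have "(\<Oplus>e\<in>{..k}. ?s e i) = a i \<otimes> (lmult_X ^^ i) b k" for i
  proof -
    have "?s e i = a i \<otimes> add_pow R (i choose e) ((\<sigma> ^^ e) ((\<delta> ^^ (i - e)) (b (k - e))))" for e
      using ac bc by (auto simp: skew_term_def binomial_eq_0 add_pow_rdistr)
    then show ?thesis using ac bc by (simp add: lmult_X_pow finsum_rdistr)
  qed
  ultimately show ?thesis by (simp add: skew_series_mult_def)
qed

text \<open>The loss \<epsilon> i of a_i cancels against the gain \<epsilon> i of X^i(b), so all
  summands satisfy one bound, which then passes to the sum. The bounds p and q guarantee convergence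
  and do not enter the estimate.\<close>

lemma series_mult_nbhd:
  assumes bd: "bounded_by p a" "bounded_by q b" and \<epsilon>: "0 \<le> \<epsilon>" "\<epsilon> \<le> \<theta>"
    and a: "\<And>i. a i \<in> nbhd (l - \<epsilon> * real i)" and b: "\<And>i. b i \<in> nbhd (m - \<epsilon> * real i)"
  shows "skew_series_mult R u \<sigma> \<delta> a b k \<in> nbhd (l + m + C - \<epsilon> * real k)"
proof (rule sums_in_nbhd[OF _ series_mult_sums[OF bd]])
  fix i
  have "a i \<otimes> (lmult_X ^^ i) b k
      \<in> nbhd (l - \<epsilon> * real i + (m + C + \<epsilon> * (real i - real k)) + 0)"
    by (intro mult_in_nbhd a lmult_X_pow_nbhd b \<epsilon>)
  then show "a i \<otimes> (lmult_X ^^ i) b k \<in> nbhd (l + m + C - \<epsilon> * real k)"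
    by (simp add: algebra_simps)
qed

lemma series_mult_bounded:
  assumes "bounded_by p a" "bounded_by q b"
  shows "bounded_by (p + q + C) (skew_series_mult R u \<sigma> \<delta> a b)"
  using series_mult_nbhd[OF assms, of 0 p q] assms \<theta>_pos by simp

lemma lmult_X_bounded: "bounded_by q b \<Longrightarrow> bounded_by (q + C) (lmult_X b)"
  using \<sigma>_nbhd[of _ "q + C"] \<delta>_nbhd[of _ "q + C"] by (auto simp: lmult_X_def intro!: add_in_nbhd)

text \<open>X applied to sum_i b_i X^i(g) gives the terms \<sigma>(b_i) X^(i+1)(g) + \<delta>(b_i)
  X^i(g). Collected by powers of X, their coefficients are those of X(b).\<close>

lemma lmult_X_series_mult:
  assumes b: "bounded_by p b" and g: "bounded_by q g"
  shows "lmult_X (skew_series_mult R u \<sigma> \<delta> b g) = skew_series_mult R u \<sigma> \<delta> (lmult_X b) g"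
proof
  fix k
  have bc [simp]: "b n \<in> carrier R" and gc [simp]: "g n \<in> carrier R" for n
    using assms nbhd_carrier by blast+
  have gX [simp]: "(lmult_X ^^ i) g n \<in> carrier R" for i n by (rule lmult_X_pow_closed) simp
  have S: "sums_to (\<lambda>i. b i \<otimes> (lmult_X ^^ i) g k) (skew_series_mult R u \<sigma> \<delta> b g k)" for k
    by (rule series_mult_sums[OF b g])
  have X: "sums_to (\<lambda>i. lmult_X (\<lambda>k. b i \<otimes> (lmult_X ^^ i) g k) k)
      (lmult_X (skew_series_mult R u \<sigma> \<delta> b g) k)"
    by (rule sums_lmult_X[of "\<lambda>i k. b i \<otimes> (lmult_X ^^ i) g k", OF _ S]) simp
  have T: "lmult_X (\<lambda>k. b i \<otimes> (lmult_X ^^ i) g k) k =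
      \<sigma> (b i) \<otimes> (lmult_X ^^ Suc i) g k \<oplus> \<delta> (b i) \<otimes> (lmult_X ^^ i) g k" for i
    by (simp add: lmult_X_smult)
  have "bounded_by (p + C) (\<lambda>i. \<sigma> (b i))" "bounded_by (p + C) (\<lambda>i. \<delta> (b i))"
    using b \<sigma>_nbhd[of _ "p + C"] \<delta>_nbhd[of _ "p + C"] by auto
  note bs = this
  have D: "sums_to (\<lambda>i. \<delta> (b i) \<otimes> (lmult_X ^^ i) g k)
      (skew_series_mult R u \<sigma> \<delta> (\<lambda>i. \<delta> (b i)) g k)"
    by (rule series_mult_sums[OF bs(2) g])
  \<comment> \<open>The \<sigma> part of X(b): the coefficient of degree 0 is zero, and the others
    are moved up by one to match X^(i+1).\<close>
  let ?b' = "\<lambda>i. if i = 0 then \<zero> else \<sigma> (b (i - 1))"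
  have b': "bounded_by (p + C) ?b'" using bs by auto
  have E: "sums_to (\<lambda>i. ?b' i \<otimes> (lmult_X ^^ i) g k) (skew_series_mult R u \<sigma> \<delta> ?b' g k)"
    by (rule series_mult_sums[OF b' g])
  \<comment> \<open>So far only the combined series is known to converge to X(b g). Splitting it
    requires convergence of the \<sigma> part by itself.\<close>
  have "null_seq (\<lambda>i. \<sigma> (b i) \<otimes> (lmult_X ^^ Suc i) g k)"
    unfolding null_seq_def
  proof (intro conjI allI)
    fix r
    obtain N where N: "(r - (p + C) - (q + C) + \<theta> * real k) / \<theta> \<le> real N"
      using real_arch_simple by blast
    have "\<sigma> (b i) \<otimes> (lmult_X ^^ Suc i) g k \<in> nbhd r" if i: "N \<le> i" for i
    proof (rule nbhd_mono[OF mult_in_nbhd])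
      show "\<sigma> (b i) \<in> nbhd (p + C)" using bs by blast
      show "(lmult_X ^^ Suc i) g k \<in> nbhd (q + C + \<theta> * (real (Suc i) - real k))"
        by (rule bounded_by_lmult_X_pow) (use g \<theta>_pos in auto)
      have "(r - (p + C) - (q + C) + \<theta> * real k) / \<theta> \<le> real (Suc i)" using N i by simp
      then show "r \<le> p + C + (q + C + \<theta> * (real (Suc i) - real k)) + 0"
        using \<theta>_pos by (simp add: pos_divide_le_eq algebra_simps)
    qed
    then show "\<forall>\<^sub>F i in sequentially. \<sigma> (b i) \<otimes> (lmult_X ^^ Suc i) g k \<in> nbhd r"
      unfolding eventually_sequentially by blast
  qed (simp only: m_closed \<sigma>_closed bc gX)
  then obtain l where l: "sums_to (\<lambda>i. \<sigma> (b i) \<otimes> (lmult_X ^^ Suc i) g k) l"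
    using null_seq_sums[OF complete] by blast
  have "sums_to (\<lambda>i. if i < 1 then \<zero> else \<sigma> (b (i - 1)) \<otimes> (lmult_X ^^ Suc (i - 1)) g k) l"
    by (rule sums_shift[OF _ l]) (simp only: m_closed \<sigma>_closed bc gX)
  moreover have "(\<lambda>i. if i < 1 then \<zero> else \<sigma> (b (i - 1)) \<otimes> (lmult_X ^^ Suc (i - 1)) g k) =
      (\<lambda>i. ?b' i \<otimes> (lmult_X ^^ i) g k)"
    by (rule ext, rename_tac i, case_tac i) (simp_all del: funpow.simps add: l_null)
  ultimately have "sums_to (\<lambda>i. ?b' i \<otimes> (lmult_X ^^ i) g k) l" by (simp only:)
  then have "l = skew_series_mult R u \<sigma> \<delta> ?b' g k" using sums_unique[OF _ E] by blast
  have "sums_to (\<lambda>i. \<sigma> (b i) \<otimes> (lmult_X ^^ Suc i) g k \<oplus> \<delta> (b i) \<otimes> (lmult_X ^^ i) g k)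
     (l \<oplus> skew_series_mult R u \<sigma> \<delta> (\<lambda>i. \<delta> (b i)) g k)"
    by (rule sums_add[OF _ _ l D]) (simp_all only: m_closed \<sigma>_closed \<delta>_closed bc gX)
  then have "lmult_X (skew_series_mult R u \<sigma> \<delta> b g) k =
      l \<oplus> skew_series_mult R u \<sigma> \<delta> (\<lambda>i. \<delta> (b i)) g k"
    using sums_unique[OF X] unfolding T by blast
  also have "\<dots> = skew_series_mult R u \<sigma> \<delta> ?b' g k \<oplus> skew_series_mult R u \<sigma> \<delta> (\<lambda>i. \<delta> (b i)) g k"
    by (simp add: \<open>l = _\<close>)
  also have "\<dots> = skew_series_mult R u \<sigma> \<delta> (lmult_X b) g k"
  proof (rule sums_unique)
    have "sums_to (\<lambda>i. ?b' i \<otimes> (lmult_X ^^ i) g k \<oplus> \<delta> (b i) \<otimes> (lmult_X ^^ i) g k)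
        (skew_series_mult R u \<sigma> \<delta> ?b' g k \<oplus> skew_series_mult R u \<sigma> \<delta> (\<lambda>i. \<delta> (b i)) g k)"
      by (rule sums_add[OF _ _ E D]) auto
    moreover have "?b' i \<otimes> (lmult_X ^^ i) g k \<oplus> \<delta> (b i) \<otimes> (lmult_X ^^ i) g k =
        lmult_X b i \<otimes> (lmult_X ^^ i) g k" for i
      unfolding lmult_X_def[of b] by (simp add: l_distr a_comm)
    ultimately show "sums_to (\<lambda>i. lmult_X b i \<otimes> (lmult_X ^^ i) g k)
        (skew_series_mult R u \<sigma> \<delta> ?b' g k \<oplus> skew_series_mult R u \<sigma> \<delta> (\<lambda>i. \<delta> (b i)) g k)"
      by simp
    show "sums_to (\<lambda>i. lmult_X b i \<otimes> (lmult_X ^^ i) g k) (skew_series_mult R u \<sigma> \<delta> (lmult_X b) g k)"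
      by (rule series_mult_sums[OF lmult_X_bounded[OF b] g])
  qed
  finally show "lmult_X (skew_series_mult R u \<sigma> \<delta> b g) k = skew_series_mult R u \<sigma> \<delta> (lmult_X b) g k" .
qed

lemma lmult_X_pow_bounded: "bounded_by q b \<Longrightarrow> \<exists>q'. bounded_by q' ((lmult_X ^^ i) b)"
  by (induction i) (auto dest: lmult_X_bounded)

lemma lmult_X_pow_series_mult:
  assumes b: "bounded_by p b" and g: "bounded_by q g"
  shows "(lmult_X ^^ i) (skew_series_mult R u \<sigma> \<delta> b g) = skew_series_mult R u \<sigma> \<delta> ((lmult_X ^^ i) b) g"
proof (induction i)
  case (Suc i)
  obtain p' where "bounded_by p' ((lmult_X ^^ i) b)" using lmult_X_pow_bounded[OF b] by blast
  then show ?case using Suc lmult_X_series_mult[OF _ g] by simp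
qed simp

text \<open>Coefficient k of either side is an iterated sum of a_i (X^i b)_j (X^j g)_k. Summing over
  i first yields (a b) g; summing over j first yields a (b g), because X^i(b) g = X^i(b g).\<close>

lemma series_mult_assoc:
  assumes a: "bounded_by p a" and b: "bounded_by q b" and g: "bounded_by t g"
  defines "m \<equiv> skew_series_mult R u \<sigma> \<delta>"
  shows "m (m a b) g = m a (m b g)"
proof
  fix k
  have bd: "bounded_by (p + q + C) (m a b)" "bounded_by (q + t + C) (m b g)"
    unfolding m_def using series_mult_bounded a b g by blast+
  have ac [simp]: "a n \<in> carrier R" and bc: "b n \<in> carrier R" and gc: "g n \<in> carrier R" for n
    using assms nbhd_carrier by blast+
  have gX [simp]: "(lmult_X ^^ i) g n \<in> carrier R" and bX [simp]: "(lmult_X ^^ i) b n \<in> carrier R" for i n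
    using gc bc by (simp_all add: lmult_X_pow_closed)
  let ?f = "\<lambda>i j. a i \<otimes> ((lmult_X ^^ i) b j \<otimes> (lmult_X ^^ j) g k)"
  have "sums_to (\<lambda>j. m a b j \<otimes> (lmult_X ^^ j) g k) (m a (m b g) k)"
  proof (rule sums_interchange)
    show "?f i j \<in> carrier R" for i j by simp
    show "sums_to (?f i) (a i \<otimes> (lmult_X ^^ i) (m b g) k)" for i
    proof -
      obtain q' where "bounded_by q' ((lmult_X ^^ i) b)" using lmult_X_pow_bounded[OF b] by blast
      then have "sums_to (\<lambda>j. (lmult_X ^^ i) b j \<otimes> (lmult_X ^^ j) g k) ((lmult_X ^^ i) (m b g) k)"
        unfolding m_def lmult_X_pow_series_mult[OF b g] by (rule series_mult_sums[OF _ g])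
      then show ?thesis by (intro sums_mult_left) auto
    qed
    show "sums_to (\<lambda>i. ?f i j) (m a b j \<otimes> (lmult_X ^^ j) g k)" for j
    proof -
      have "sums_to (\<lambda>i. (a i \<otimes> (lmult_X ^^ i) b j) \<otimes> (lmult_X ^^ j) g k)
          (m a b j \<otimes> (lmult_X ^^ j) g k)"
        unfolding m_def by (intro sums_mult_right series_mult_sums[OF a b]) auto
      then show ?thesis by (simp add: m_assoc)
    qed
    show "sums_to (\<lambda>i. a i \<otimes> (lmult_X ^^ i) (m b g) k) (m a (m b g) k)"
      using series_mult_sums[OF a bd(2)] by (simp add: m_def)
    text \<open>Different slopes \<open>\<theta>/2\<close> and \<open>\<theta>\<close> for \<open>b\<close> and \<open>g\<close> leave a positive rate in both indices.\<close>
    show "\<exists>K. \<forall>i j. K \<le> i \<or> K \<le> j \<longrightarrow> ?f i j \<in> nbhd r" for r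
    proof -
      let ?c = "p + (q + C) + (t + C) - \<theta> * real k"
      obtain K where K: "(r - ?c) / (\<theta> / 2) \<le> real K" using real_arch_simple by blast
      have "?f i j \<in> nbhd r" if ij: "K \<le> i \<or> K \<le> j" for i j
      proof (rule nbhd_mono[OF mult_in_nbhd[OF _ mult_in_nbhd]])
        show "a i \<in> nbhd p" using a by blast
        show "(lmult_X ^^ i) b j \<in> nbhd (q + C + \<theta> / 2 * (real i - real j))"
          by (rule bounded_by_lmult_X_pow) (use b \<theta>_pos in auto)
        show "(lmult_X ^^ j) g k \<in> nbhd (t + C + \<theta> * (real j - real k))"
          by (rule bounded_by_lmult_X_pow) (use g \<theta>_pos in auto)
        \<comment> \<open>The exponents \<theta>/2 (i - j) and \<theta> (j - k) add up to \<theta>/2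
          (i + j) - \<theta> k; \<open>?c\<close> collects what does not grow with i or j.\<close>
        have "(r - ?c) / (\<theta> / 2) \<le> real i + real j" using K ij by auto
        then have "r - ?c \<le> (real i + real j) * (\<theta> / 2)"
          using \<theta>_pos by (simp add: pos_divide_le_eq)
        then show "r \<le> p + (q + C + \<theta> / 2 * (real i - real j) +
            (t + C + \<theta> * (real j - real k)) + 0) + 0"
          by (simp add: field_simps)
      qed
      then show ?thesis by blast
    qed
  qed
  moreover have "sums_to (\<lambda>j. m a b j \<otimes> (lmult_X ^^ j) g k) (m (m a b) g k)"
    using series_mult_sums[OF bd(1) g] by (simp add: m_def)
  ultimately show "m (m a b) g k = m a (m b g) k" by (rule sums_unique[rotated])
qed

end

section \<open>The ring of bounded skew power series\<close>

context skew_series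
begin

abbreviation "P \<equiv> bounded_skew_series_ring R u \<sigma> \<delta>"

lemma P_simps [simp]:
  "f \<otimes>\<^bsub>P\<^esub> g = skew_series_mult R u \<sigma> \<delta> f g"
  "f \<oplus>\<^bsub>P\<^esub> g = (\<lambda>n. f n \<oplus> g n)"
  "\<one>\<^bsub>P\<^esub> = const_series R \<one>"
  "\<zero>\<^bsub>P\<^esub> = const_series R \<zero>"
  by (simp_all add: bounded_skew_series_ring_def skew_series_ring_def)

lemma carrier_P: "f \<in> carrier P \<longleftrightarrow> (\<exists>m. bounded_by m f)"
  by (simp add: bounded_skew_series_ring_def bounded_seq_iff)

lemma P_bounded: "f \<in> carrier P \<Longrightarrow> bounded_seq R u f"
  by (simp add: carrier_P bounded_seq_iff)

lemma coeff_closed [simp]: "f \<in> carrier P \<Longrightarrow> f n \<in> carrier R"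
  using nbhd_carrier by (auto simp: carrier_P)

lemma sums_single:
  assumes "x \<in> carrier R" shows "sums_to (\<lambda>i. if i = n then x else \<zero>) x"
proof -
  have "finsum R (\<lambda>i. if i = n then x else \<zero>) {..<m} = x" if "n < m" for m
    using add.finprod_singleton_swap[of n "{..<m}" "\<lambda>_. x"] that assms by simp
  then have "\<forall>\<^sub>F m in sequentially. finsum R (\<lambda>i. if i = n then x else \<zero>) {..<m} \<ominus> x \<in> nbhd r" for r
    using assms by (auto simp: a_minus_def r_neg eventually_sequentially intro!: exI[of _ "Suc n"])
  then show ?thesis using assms by (simp add: sums_iff)
qed

lemma mult_P_sums:
  "f \<in> carrier P \<Longrightarrow> g \<in> carrier P \<Longrightarrow> sums_to (\<lambda>i. f i \<otimes> (lmult_X ^^ i) g k) ((f \<otimes>\<^bsub>P\<^esub> g) k)"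
  using series_mult_sums by (auto simp: carrier_P)

text \<open>Limits are unique, so a product is identified by exhibiting the candidate as the sum of
  its defining series. The unit and distributive laws are checked this way.\<close>

lemma mult_P_eqI:
  "f \<in> carrier P \<Longrightarrow> g \<in> carrier P \<Longrightarrow> (\<And>k. sums_to (\<lambda>i. f i \<otimes> (lmult_X ^^ i) g k) (h k))
    \<Longrightarrow> f \<otimes>\<^bsub>P\<^esub> g = h"
  using sums_unique[OF mult_P_sums] by (simp add: fun_eq_iff)

definition monomial :: "'a \<Rightarrow> nat \<Rightarrow> nat \<Rightarrow> 'a" where
  "monomial r n = (\<lambda>k. if k = n then r else \<zero>)"

lemma const_series_monomial: "const_series R r = monomial r 0"
  and series_X_monomial: "series_X R = monomial \<one> 1"
  by (simp_all add: const_series_def series_X_def monomial_def fun_eq_iff)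

lemma monomial_closed [simp]:
  assumes "r \<in> carrier R" shows "monomial r n \<in> carrier P"
proof -
  obtain m where "r \<in> nbhd m" using assms nbhd_exhaustive by blast
  then show ?thesis by (auto simp: carrier_P monomial_def)
qed

lemma const_series_closed [simp]: "r \<in> carrier R \<Longrightarrow> const_series R r \<in> carrier P"
  by (simp add: const_series_monomial)

lemma lmult_X_pow_P [simp]: "f \<in> carrier P \<Longrightarrow> (lmult_X ^^ i) f n \<in> carrier R"
  by (rule lmult_X_pow_closed) simp

lemma monomial_mult:
  assumes "r \<in> carrier R" "f \<in> carrier P"
  shows "monomial r n \<otimes>\<^bsub>P\<^esub> f = (\<lambda>k. r \<otimes> (lmult_X ^^ n) f k)"
proof (rule mult_P_eqI)
  fix k
  have "monomial r n i \<otimes> (lmult_X ^^ i) f k = (if i = n then r \<otimes> (lmult_X ^^ n) f k else \<zero>)" for i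
    using assms by (simp add: monomial_def)
  then show "sums_to (\<lambda>i. monomial r n i \<otimes> (lmult_X ^^ i) f k) (r \<otimes> (lmult_X ^^ n) f k)"
    using sums_single assms by simp
qed (use assms in auto)

lemma const_mult:
  "r \<in> carrier R \<Longrightarrow> f \<in> carrier P \<Longrightarrow> const_series R r \<otimes>\<^bsub>P\<^esub> f = series_smult R r f"
  using monomial_mult[of r f 0] by (simp add: const_series_monomial series_smult_def)

lemma X_mult: "f \<in> carrier P \<Longrightarrow> series_X R \<otimes>\<^bsub>P\<^esub> f = lmult_X f"
  using monomial_mult[of \<one> f 1] by (simp add: series_X_monomial fun_eq_iff lmult_X_closed)

lemma lmult_X_pow_monomial: "(lmult_X ^^ i) (monomial \<one> n) = monomial \<one> (n + i)"
proof (induction i)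
  case (Suc i)
  have "lmult_X (monomial \<one> m) = monomial \<one> (Suc m)" for m
    by (auto simp: fun_eq_iff lmult_X_def monomial_def \<delta>_one \<sigma>_one
        additive_zero[OF \<sigma>_additive] additive_zero[OF \<delta>_additive])
  then show ?case using Suc by simp
qed simp

lemma lmult_X_add:
  assumes "\<And>k. f k \<in> carrier R" "\<And>k. g k \<in> carrier R"
  shows "lmult_X (\<lambda>n. f n \<oplus> g n) = (\<lambda>n. lmult_X f n \<oplus> lmult_X g n)"
  using assms
  by (simp add: fun_eq_iff lmult_X_def a_ac additive_add[OF \<sigma>_additive] additive_add[OF \<delta>_additive])

lemma lmult_X_pow_add:
  assumes "\<And>k. f k \<in> carrier R" "\<And>k. g k \<in> carrier R"
  shows "(lmult_X ^^ i) (\<lambda>n. f n \<oplus> g n) = (\<lambda>n. (lmult_X ^^ i) f n \<oplus> (lmult_X ^^ i) g n)"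
proof (induction i)
  case (Suc i)
  have c: "(lmult_X ^^ i) f n \<in> carrier R" "(lmult_X ^^ i) g n \<in> carrier R" for n
    using assms by (simp_all add: lmult_X_pow_closed)
  show ?case using Suc lmult_X_add[OF c] by simp
qed simp

lemma add_P_closed:
  assumes "f \<in> carrier P" "g \<in> carrier P" shows "f \<oplus>\<^bsub>P\<^esub> g \<in> carrier P"
proof -
  obtain m n where mn: "bounded_by m f" "bounded_by n g" using assms by (auto simp: carrier_P)
  then have "bounded_by (min m n) (f \<oplus>\<^bsub>P\<^esub> g)"
    using nbhd_mono[of _ m "min m n"] nbhd_mono[of _ n "min m n"] by (simp add: add_in_nbhd)
  then show ?thesis unfolding carrier_P by blast
qed

lemma mult_P_closed: "f \<in> carrier P \<Longrightarrow> g \<in> carrier P \<Longrightarrow> f \<otimes>\<^bsub>P\<^esub> g \<in> carrier P"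
  using series_mult_bounded unfolding carrier_P P_simps by blast

lemma ring_P: "ring P"
proof (rule ringI)
  have cs: "const_series R \<zero> = (\<lambda>n. \<zero>)" by (simp add: const_series_def fun_eq_iff)
  show "abelian_group P"
  proof (rule abelian_groupI)
    fix f assume f: "f \<in> carrier P"
    then have "(\<lambda>n. \<ominus> f n) \<in> carrier P" using neg_in_nbhd unfolding carrier_P by blast
    moreover have "(\<lambda>n. \<ominus> f n) \<oplus>\<^bsub>P\<^esub> f = \<zero>\<^bsub>P\<^esub>" using f by (simp add: cs l_neg)
    ultimately show "\<exists>g\<in>carrier P. g \<oplus>\<^bsub>P\<^esub> f = \<zero>\<^bsub>P\<^esub>" by blast
  qed (simp_all add: add_P_closed[unfolded P_simps] cs a_ac, simp_all add: carrier_P)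
  show "monoid P"
  proof (rule monoidI)
    fix f assume f: "f \<in> carrier P"
    show "\<one>\<^bsub>P\<^esub> \<otimes>\<^bsub>P\<^esub> f = f"
      using const_mult[of \<one> f] f by (simp add: series_smult_def)
    show "f \<otimes>\<^bsub>P\<^esub> \<one>\<^bsub>P\<^esub> = f"
    proof (rule mult_P_eqI)
      fix k
      \<comment> \<open>X^i(1) = x^i, so in degree k only the term with i = k survives.\<close>
      have "(lmult_X ^^ i) \<one>\<^bsub>P\<^esub> k = (if i = k then \<one> else \<zero>)" for i
        using lmult_X_pow_monomial[of i 0] by (auto simp: const_series_monomial) (auto simp: monomial_def)
      then have "f i \<otimes> (lmult_X ^^ i) \<one>\<^bsub>P\<^esub> k = (if i = k then f k else \<zero>)" for i
        using f by simp
      then show "sums_to (\<lambda>i. f i \<otimes> (lmult_X ^^ i) \<one>\<^bsub>P\<^esub> k) (f k)"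
        using sums_single f by simp
    qed (use f in auto)
  next
    fix f g h assume "f \<in> carrier P" "g \<in> carrier P" "h \<in> carrier P"
    then show "(f \<otimes>\<^bsub>P\<^esub> g) \<otimes>\<^bsub>P\<^esub> h = f \<otimes>\<^bsub>P\<^esub> (g \<otimes>\<^bsub>P\<^esub> h)"
      using series_mult_assoc unfolding carrier_P P_simps by blast
  qed (simp_all add: mult_P_closed[unfolded P_simps])
next
  fix f g h assume c: "f \<in> carrier P" "g \<in> carrier P" "h \<in> carrier P"
  show "(f \<oplus>\<^bsub>P\<^esub> g) \<otimes>\<^bsub>P\<^esub> h = f \<otimes>\<^bsub>P\<^esub> h \<oplus>\<^bsub>P\<^esub> g \<otimes>\<^bsub>P\<^esub> h"
  proof (rule mult_P_eqI)
    fix k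
    have "sums_to (\<lambda>i. f i \<otimes> (lmult_X ^^ i) h k \<oplus> g i \<otimes> (lmult_X ^^ i) h k)
        ((f \<otimes>\<^bsub>P\<^esub> h) k \<oplus> (g \<otimes>\<^bsub>P\<^esub> h) k)"
      by (intro sums_add mult_P_sums) (use c in auto)
    moreover have "f i \<otimes> (lmult_X ^^ i) h k \<oplus> g i \<otimes> (lmult_X ^^ i) h k =
        (f \<oplus>\<^bsub>P\<^esub> g) i \<otimes> (lmult_X ^^ i) h k" for i
      using c by (simp add: l_distr)
    ultimately show "sums_to (\<lambda>i. (f \<oplus>\<^bsub>P\<^esub> g) i \<otimes> (lmult_X ^^ i) h k)
        ((f \<otimes>\<^bsub>P\<^esub> h \<oplus>\<^bsub>P\<^esub> g \<otimes>\<^bsub>P\<^esub> h) k)"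
      by simp
  qed (use c in \<open>simp_all only: add_P_closed\<close>)
  show "h \<otimes>\<^bsub>P\<^esub> (f \<oplus>\<^bsub>P\<^esub> g) = h \<otimes>\<^bsub>P\<^esub> f \<oplus>\<^bsub>P\<^esub> h \<otimes>\<^bsub>P\<^esub> g"
  proof (rule mult_P_eqI)
    fix k
    have "sums_to (\<lambda>i. h i \<otimes> (lmult_X ^^ i) f k \<oplus> h i \<otimes> (lmult_X ^^ i) g k)
        ((h \<otimes>\<^bsub>P\<^esub> f) k \<oplus> (h \<otimes>\<^bsub>P\<^esub> g) k)"
      by (intro sums_add mult_P_sums) (use c in auto)
    moreover have "h i \<otimes> (lmult_X ^^ i) f k \<oplus> h i \<otimes> (lmult_X ^^ i) g k =
        h i \<otimes> (lmult_X ^^ i) (f \<oplus>\<^bsub>P\<^esub> g) k" for i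
      using c by (simp add: r_distr lmult_X_pow_add)
    ultimately show "sums_to (\<lambda>i. h i \<otimes> (lmult_X ^^ i) (f \<oplus>\<^bsub>P\<^esub> g) k)
        ((h \<otimes>\<^bsub>P\<^esub> f \<oplus>\<^bsub>P\<^esub> h \<otimes>\<^bsub>P\<^esub> g) k)"
      by simp
  qed (use c in \<open>simp_all only: add_P_closed\<close>)
qed

sublocale P: ring P by (rule ring_P)

lemma neg_P: assumes "f \<in> carrier P" shows "\<ominus>\<^bsub>P\<^esub> f = (\<lambda>n. \<ominus> f n)"
proof (rule P.minus_equality)
  show "(\<lambda>n. \<ominus> f n) \<in> carrier P" using assms neg_in_nbhd unfolding carrier_P by blast
  show "(\<lambda>n. \<ominus> f n) \<oplus>\<^bsub>P\<^esub> f = \<zero>\<^bsub>P\<^esub>"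
    using assms by (simp add: l_neg const_series_def fun_eq_iff)
qed (use assms in simp)

lemma minus_P: "f \<in> carrier P \<Longrightarrow> g \<in> carrier P \<Longrightarrow> f \<ominus>\<^bsub>P\<^esub> g = (\<lambda>n. f n \<ominus> g n)"
  unfolding P.minus_eq by (simp add: neg_P a_minus_def)

section \<open>Skew polynomials\<close>

lemma finite_seqs_iff:
  "f \<in> finite_seqs R \<longleftrightarrow> (\<forall>n. f n \<in> carrier R) \<and> (\<exists>N. \<forall>n>N. f n = \<zero>)"
  unfolding finite_seqs_def finite_nat_set_iff_bounded_le by (auto simp: not_le[symmetric])

lemma finite_seqs_P: "finite_seqs R \<subseteq> carrier P"
proof
  fix f assume f: "f \<in> finite_seqs R"
  have "\<forall>n. \<exists>r. f n \<in> nbhd r"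
  proof
    fix n
    have "f n \<in> carrier R" using f by (simp add: finite_seqs_def)
    then show "\<exists>r. f n \<in> nbhd r" using nbhd_exhaustive by blast
  qed
  from choice[OF this] obtain r where r: "\<forall>n. f n \<in> nbhd (r n)" by blast
  let ?A = "{n. f n \<noteq> \<zero>}"
  have fin: "finite ?A" using f by (simp add: finite_seqs_def)
  \<comment> \<open>Inserting 0 keeps the minimum defined for the zero polynomial.\<close>
  have "f n \<in> nbhd (Min (insert 0 (r ` ?A)))" for n
    using nbhd_mono[OF r[rule_format, of n], of "Min (insert 0 (r ` ?A))"] fin by (cases "f n = \<zero>") (auto simp: Min_le)
  then show "f \<in> carrier P" unfolding carrier_P by blast
qed

lemma lmult_X_pow_degree:
  assumes "\<forall>l>D. b l = \<zero>" "D + i < k"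
  shows "(lmult_X ^^ i) b k = \<zero>"
  using assms(2)
proof (induction i arbitrary: k)
  case (Suc i)
  then show ?case
    by (simp add: lmult_X_def additive_zero[OF \<sigma>_additive] additive_zero[OF \<delta>_additive])
qed (use assms(1) in simp)

lemma finite_seqs_mult:
  assumes "f \<in> finite_seqs R" "g \<in> finite_seqs R" shows "f \<otimes>\<^bsub>P\<^esub> g \<in> finite_seqs R"
proof -
  have c: "f \<in> carrier P" "g \<in> carrier P" using assms finite_seqs_P by auto
  obtain A B where AB: "\<forall>n>A. f n = \<zero>" "\<forall>n>B. g n = \<zero>" using assms by (auto simp: finite_seqs_iff)
  have "(f \<otimes>\<^bsub>P\<^esub> g) k = \<zero>" if k: "A + B < k" for k
  proof (rule sums_unique[OF mult_P_sums[OF c]])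
    have "f i \<otimes> (lmult_X ^^ i) g k = \<zero>" for i
      using AB(1) lmult_X_pow_degree[OF AB(2), of i k] k c by (cases "A < i") auto
    then show "sums_to (\<lambda>i. f i \<otimes> (lmult_X ^^ i) g k) \<zero>" using sums_zero by simp
  qed
  moreover have "(f \<otimes>\<^bsub>P\<^esub> g) k \<in> carrier R" for k
    using mult_P_closed[OF c] by (rule coeff_closed)
  ultimately show ?thesis unfolding finite_seqs_iff by blast
qed

lemma monomial_finite_seqs: "r \<in> carrier R \<Longrightarrow> monomial r n \<in> finite_seqs R"
  by (auto simp: finite_seqs_def monomial_def)

lemma finite_seqs_subring: "subring (finite_seqs R) P"
proof (rule P.subringI)
  show "\<one>\<^bsub>P\<^esub> \<in> finite_seqs R" by (simp add: const_series_monomial monomial_finite_seqs)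
  show "\<ominus>\<^bsub>P\<^esub> f \<in> finite_seqs R" if "f \<in> finite_seqs R" for f
    using that neg_P[OF subsetD[OF finite_seqs_P that]] by (auto simp: finite_seqs_iff)
  show "f \<oplus>\<^bsub>P\<^esub> g \<in> finite_seqs R" if fg: "f \<in> finite_seqs R" "g \<in> finite_seqs R" for f g
  proof -
    obtain A B where "\<forall>n>A. f n = \<zero>" "\<forall>n>B. g n = \<zero>"
      using fg unfolding finite_seqs_iff by blast
    then have "\<forall>n>A+B. f n \<oplus> g n = \<zero>" by simp
    then show ?thesis using fg by (auto simp: finite_seqs_iff)
  qed
qed (use finite_seqs_P finite_seqs_mult in blast)+

text \<open>Formulated for a subring because the expansion of a polynomial in powers of x is a sum
  in the polynomial ring itself, not in \<open>P\<close>.\<close>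

lemma finsum_coeff:
  assumes "subring H P" and "finite I" and "\<And>i. i \<in> I \<Longrightarrow> f i \<in> H"
  shows "finsum (P\<lparr>carrier := H\<rparr>) f I k = (\<Oplus>i\<in>I. f i k)"
proof -
  interpret H: ring "P\<lparr>carrier := H\<rparr>" using P.subring_is_ring[OF assms(1)] .
  have HP: "H \<subseteq> carrier P" using subringE(1)[OF assms(1)] .
  show ?thesis
    using assms(2,3)
  proof (induction I arbitrary: k rule: finite_induct)
    case empty
    then show ?case by (simp add: const_series_def)
  next
    case (insert x I)
    then have "finsum (P\<lparr>carrier := H\<rparr>) f (insert x I) =
        f x \<oplus>\<^bsub>P\<lparr>carrier := H\<rparr>\<^esub> finsum (P\<lparr>carrier := H\<rparr>) f I"
      by (intro H.finsum_insert) auto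
    then show ?case using insert HP by (simp add: Pi_def subset_iff)
  qed
qed

lemma is_skew_polynomial_ring_finite_seqs:
  "is_skew_polynomial_ring R \<sigma> \<delta> (P\<lparr>carrier := finite_seqs R\<rparr>) (const_series R) (series_X R)"
  unfolding is_skew_polynomial_ring_def
proof (intro conjI ballI)
  let ?F = "P\<lparr>carrier := finite_seqs R\<rparr>"
  show "ring ?F" by (rule P.subring_is_ring[OF finite_seqs_subring])
  show "const_series R \<in> ring_hom R ?F"
  proof (rule ring_hom_memI)
    fix r s assume rs: "r \<in> carrier R" "s \<in> carrier R"
    show "const_series R r \<in> carrier ?F" using rs by (simp add: const_series_monomial monomial_finite_seqs)
    show "const_series R (r \<otimes> s) = const_series R r \<otimes>\<^bsub>?F\<^esub> const_series R s"
      using const_mult[of r "const_series R s"] rs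
      by (simp add: series_smult_def) (simp add: const_series_def fun_eq_iff)
    show "const_series R (r \<oplus> s) = const_series R r \<oplus>\<^bsub>?F\<^esub> const_series R s"
      by (simp add: const_series_def fun_eq_iff)
  qed simp
  show "series_X R \<in> carrier ?F" by (simp add: series_X_monomial monomial_finite_seqs)
  have pow: "series_X R [^]\<^bsub>?F\<^esub> n = monomial \<one> n" for n
  proof (induction n)
    case 0
    then show ?case by (simp add: nat_pow_def const_series_monomial)
  next
    case (Suc n)
    then have "series_X R [^]\<^bsub>?F\<^esub> Suc n = monomial \<one> n \<otimes>\<^bsub>P\<^esub> monomial \<one> 1"
      by (simp add: nat_pow_def series_X_monomial)
    also have "\<dots> = (\<lambda>k. \<one> \<otimes> monomial \<one> (1 + n) k)"
      using monomial_mult[of \<one> "monomial \<one> 1" n] by (simp add: lmult_X_pow_monomial)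
    also have "\<dots> = monomial \<one> (Suc n)" by (simp add: monomial_def fun_eq_iff)
    finally show ?case .
  qed
  \<comment> \<open>Evaluating the expansion with coefficients f returns f itself. This yields
    existence of the expansion and also its uniqueness.\<close>
  have repr: "(\<Oplus>\<^bsub>?F\<^esub>n\<in>{n. f n \<noteq> \<zero>}. const_series R (f n) \<otimes>\<^bsub>?F\<^esub> series_X R [^]\<^bsub>?F\<^esub> n) = f"
    if f: "f \<in> finite_seqs R" for f
  proof
    fix k
    have fc: "f n \<in> carrier R" for n using f by (simp add: finite_seqs_def)
    let ?A = "{n. f n \<noteq> \<zero>}"
    have fin: "finite ?A" using f by (simp add: finite_seqs_def)
    have trm: "const_series R (f n) \<otimes>\<^bsub>?F\<^esub> series_X R [^]\<^bsub>?F\<^esub> n = monomial (f n) n" for n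
      unfolding pow using const_mult[of "f n" "monomial \<one> n"] fc
      by (simp add: series_smult_def) (simp add: monomial_def fun_eq_iff)
    have "(\<Oplus>\<^bsub>?F\<^esub>n\<in>?A. monomial (f n) n) k = (\<Oplus>n\<in>?A. monomial (f n) n k)"
      by (rule finsum_coeff[OF finite_seqs_subring fin]) (simp add: monomial_finite_seqs fc)
    \<comment> \<open>The index k may lie outside the support; adjoining it contributes zero and
      leaves a sum concentrated at k in both cases.\<close>
    also have "\<dots> = (\<Oplus>n\<in>insert k ?A. if k = n then f n else \<zero>)"
      using fin fc by (intro add.finprod_mono_neutral_cong_left) (auto simp: monomial_def)
    also have "\<dots> = f k" using fin fc by (intro finsum_singleton) auto
    finally show "(\<Oplus>\<^bsub>?F\<^esub>n\<in>?A. const_series R (f n) \<otimes>\<^bsub>?F\<^esub> series_X R [^]\<^bsub>?F\<^esub> n) k = f k"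
      unfolding trm .
  qed
  fix p assume p: "p \<in> carrier ?F"
  show "\<exists>!c. c \<in> finite_seqs R \<and>
      p = (\<Oplus>\<^bsub>?F\<^esub>n\<in>{n. c n \<noteq> \<zero>}. const_series R (c n) \<otimes>\<^bsub>?F\<^esub> series_X R [^]\<^bsub>?F\<^esub> n)"
  proof (rule ex1I[of _ p])
    show "p \<in> finite_seqs R \<and>
      p = (\<Oplus>\<^bsub>?F\<^esub>n\<in>{n. p n \<noteq> \<zero>}. const_series R (p n) \<otimes>\<^bsub>?F\<^esub> series_X R [^]\<^bsub>?F\<^esub> n)"
      using p repr[of p] by simp
    fix q assume "q \<in> finite_seqs R \<and>
      p = (\<Oplus>\<^bsub>?F\<^esub>n\<in>{n. q n \<noteq> \<zero>}. const_series R (q n) \<otimes>\<^bsub>?F\<^esub> series_X R [^]\<^bsub>?F\<^esub> n)"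
    then show "q = p" using repr[of q] by (elim conjE) (simp only:)
  qed
next
  fix r assume r: "r \<in> carrier R"
  have "series_X R \<otimes>\<^bsub>P\<^esub> const_series R r = lmult_X (const_series R r)"
    by (rule X_mult) (use r in simp)
  also have "\<dots> = series_smult R (\<sigma> r) (series_X R) \<oplus>\<^bsub>P\<^esub> const_series R (\<delta> r)"
    using r by (auto simp: fun_eq_iff lmult_X_def series_smult_def const_series_def series_X_def
        additive_zero[OF \<sigma>_additive] additive_zero[OF \<delta>_additive])
  also have "series_smult R (\<sigma> r) (series_X R) = const_series R (\<sigma> r) \<otimes>\<^bsub>P\<^esub> series_X R"
    by (rule const_mult[symmetric]) (use r in \<open>simp_all add: series_X_monomial\<close>)
  finally show "series_X R \<otimes>\<^bsub>P\<lparr>carrier := finite_seqs R\<rparr>\<^esub> const_series R r =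
      const_series R (\<sigma> r) \<otimes>\<^bsub>P\<lparr>carrier := finite_seqs R\<rparr>\<^esub> series_X R
        \<oplus>\<^bsub>P\<lparr>carrier := finite_seqs R\<rparr>\<^esub> const_series R (\<delta> r)"
    by simp
qed

end

section \<open>The filtrations \<open>v\<^sub>\<epsilon>\<close>\<close>

locale skew_series_slope = skew_series +
  fixes \<epsilon> :: real
  assumes slope: "0 < \<epsilon>" "\<epsilon> \<le> \<theta>"
begin

abbreviation "v \<equiv> series_filtration u \<epsilon>"

lemma v_le: "v f \<le> u (f n) + ereal (\<epsilon> * real n)"
  unfolding series_filtration_def by (rule INF_lower) simp

lemma le_v_iff: "x \<le> v f \<longleftrightarrow> (\<forall>n. x \<le> u (f n) + ereal (\<epsilon> * real n))"
  by (simp add: series_filtration_def le_INF_iff)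

text \<open>The coefficients have values bounded below and \<epsilon> > 0, so the weighted values
  grow without bound. Beyond some K they exceed the finite weighted value at a nonzero coefficient,
  and only finitely many indices compete. For the zero series all values are \<infinity>.\<close>

lemma v_attained:
  assumes f: "f \<in> carrier P"
  shows "\<exists>n. v f = u (f n) + ereal (\<epsilon> * real n)"
proof (cases "\<exists>n. f n \<noteq> \<zero>")
  case True
  let ?t = "\<lambda>n. u (f n) + ereal (\<epsilon> * real n)"
  obtain n0 where n0: "f n0 \<noteq> \<zero>" using True by blast
  obtain m where m: "bounded_by m f" using f by (auto simp: carrier_P)
  have "u (f n0) \<noteq> \<infinity>" "u (f n0) \<noteq> -\<infinity>"
    using n0 f value_eq_infinity value_not_minus_infinity by auto
  then obtain V where V: "?t n0 = ereal V" by (cases "u (f n0)") auto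
  obtain K where K: "(V - m) / \<epsilon> \<le> real K" using real_arch_simple by blast
  have far: "?t n0 \<le> ?t n" if "K \<le> n" for n
  proof -
    have "(V - m) / \<epsilon> \<le> real n" using K that by linarith
    then have "V \<le> m + \<epsilon> * real n" using slope(1) by (simp add: pos_divide_le_eq algebra_simps)
    moreover have "ereal m \<le> u (f n)" using m by (simp add: nbhd_def)
    ultimately show ?thesis unfolding V by (cases "u (f n)") auto
  qed
  \<comment> \<open>The range contains \<open>n0\<close>, so the minimum also lies below the terms
    beyond K, which were compared with the term at \<open>n0\<close>.\<close>
  let ?M = "Min (?t ` {..max K n0})"
  obtain n where n: "?M = ?t n"
    using Min_in[of "?t ` {..max K n0}"] by (auto simp del: Min_in)
  have le: "?M \<le> ?t k" if "k \<le> max K n0" for k using that by (intro Min_le) auto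
  have "?M \<le> ?t k" for k
  proof (cases "k \<le> max K n0")
    case False
    then show ?thesis using order_trans[OF le[of n0] far[of k]] by simp
  qed (rule le)
  then have "?t n \<le> v f" unfolding le_v_iff n by blast
  then have "v f = ?t n" using v_le[of f n] by (rule antisym[rotated])
  then show ?thesis by blast
next
  case False
  then have "v f = \<infinity>" using value_eq_infinity[of \<zero>] by (simp add: series_filtration_def)
  then show ?thesis using False value_eq_infinity[of \<zero>] by auto
qed

lemma v_add: 
  assumes "f \<in> carrier P" "g \<in> carrier P" shows "min (v f) (v g) \<le> v (f \<oplus>\<^bsub>P\<^esub> g)"
  unfolding le_v_iff
proof
  fix n
  have "min (v f) (v g) \<le> min (u (f n)) (u (g n)) + ereal (\<epsilon> * real n)"
    using v_le[of f n] v_le[of g n] by (cases "u (f n) \<le> u (g n)") (auto simp: min_def intro: order_trans)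
  also have "\<dots> \<le> u (f n \<oplus> g n) + ereal (\<epsilon> * real n)"
    using assms by (intro add_right_mono value_add) auto
  finally show "min (v f) (v g) \<le> u ((f \<oplus>\<^bsub>P\<^esub> g) n) + ereal (\<epsilon> * real n)" by simp
qed

lemma v_eq_infinity:
  assumes "f \<in> carrier P" shows "v f = \<infinity> \<longleftrightarrow> f = \<zero>\<^bsub>P\<^esub>"
proof
  assume "v f = \<infinity>"
  then have "u (f n) = \<infinity>" for n using v_le[of f n] by (cases "u (f n)") auto
  then show "f = \<zero>\<^bsub>P\<^esub>" using assms value_eq_infinity by (simp add: const_series_def fun_eq_iff)
next
  assume "f = \<zero>\<^bsub>P\<^esub>"
  then show "v f = \<infinity>"
    using value_eq_infinity[of \<zero>] by (simp add: series_filtration_def const_series_def)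
qed

sublocale V: filtered_group P v c
proof
  fix f assume f: "f \<in> carrier P"
  obtain n where n: "v f = u (f n) + ereal (\<epsilon> * real n)" using v_attained[OF f] by blast
  show "v f \<noteq> -\<infinity>" using n value_not_minus_infinity[of "f n"] f by (cases "u (f n)") auto
  show "v f = \<infinity> \<longleftrightarrow> f = \<zero>\<^bsub>P\<^esub>" by (rule v_eq_infinity[OF f])
  \<comment> \<open>At an index where the minimum for -f is attained, the inequality for a single
    coefficient carries over with the same constant c.\<close>
  obtain k where k: "v (\<ominus>\<^bsub>P\<^esub> f) = u (\<ominus> f k) + ereal (\<epsilon> * real k)"
    using v_attained[OF P.a_inv_closed[OF f]] unfolding neg_P[OF f] by blast
  have "v f \<le> u (f k) + ereal (\<epsilon> * real k)" by (rule v_le)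
  also have "\<dots> \<le> u (\<ominus> f k) + ereal c + ereal (\<epsilon> * real k)"
    using f by (intro add_right_mono value_neg) simp
  finally show "v f \<le> v (\<ominus>\<^bsub>P\<^esub> f) + ereal c" unfolding k by (simp add: ac_simps)
qed (rule v_add)

text \<open>Translates the neighbourhoods of \<open>v\<close> into the weighted coefficient bounds
  used in \<open>series_mult_nbhd\<close>, which thereby becomes the continuity estimate for the
  product.\<close>

lemma V_nbhd: "f \<in> V.nbhd r \<longleftrightarrow> f \<in> carrier P \<and> (\<forall>n. f n \<in> nbhd (r - \<epsilon> * real n))"
proof -
  have eq: "ereal r \<le> x + ereal y \<longleftrightarrow> ereal (r - y) \<le> x" for x y
    by (cases x) (auto simp: algebra_simps)
  show ?thesis
    by (auto simp: V.nbhd_def nbhd_def le_v_iff eq neg_P)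
qed

sublocale V: quasi_filtered_ring P v c C
proof
  fix f g r s assume fg: "f \<in> V.nbhd r" "g \<in> V.nbhd s"
  then obtain p q where "bounded_by p f" "bounded_by q g" by (auto simp: V_nbhd carrier_P)
  then have "(f \<otimes>\<^bsub>P\<^esub> g) k \<in> nbhd (r + s + C - \<epsilon> * real k)" for k
    unfolding P_simps using fg slope by (intro series_mult_nbhd) (auto simp: V_nbhd)
  then show "f \<otimes>\<^bsub>P\<^esub> g \<in> V.nbhd (r + s + C)"
    using fg P.m_closed by (simp only: V_nbhd) blast
qed

lemma v_const_series: "s \<in> carrier R \<Longrightarrow> v (const_series R s) = u s"
proof (rule antisym)
  show "v (const_series R s) \<le> u s" using v_le[of "const_series R s" 0] by (simp add: const_series_def)
  show "u s \<le> v (const_series R s)"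
    using value_eq_infinity[of \<zero>] by (simp add: le_v_iff const_series_def)
qed

text \<open>The truncations of f converge to f: the omitted coefficients are bounded below by m, and
  the weight \<epsilon> n lifts them beyond any r.\<close>

lemma finite_seqs_dense:
  "filtration_topology P v closure_of finite_seqs R = carrier P"
proof -
  have "\<exists>g. g \<in> finite_seqs R \<and> g \<in> T"
    if f: "f \<in> carrier P" and T: "f \<in> T" "openin (filtration_topology P v) T" for f T
  proof -
    obtain r where r: "\<forall>g\<in>carrier P. g \<ominus>\<^bsub>P\<^esub> f \<in> V.nbhd r \<longrightarrow> g \<in> T"
      using T by (auto simp: V.openin_filtration_topology_nbhd)
    obtain m where m: "bounded_by m f" using f by (auto simp: carrier_P)
    obtain K where K: "(r - m) / \<epsilon> \<le> real K" using real_arch_simple by blast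
    define g where "g = (\<lambda>n. if n < K then f n else \<zero>)"
    have gF: "g \<in> finite_seqs R"
      using f by (auto simp: finite_seqs_def g_def intro: finite_subset[of _ "{..<K}"])
    then have gP: "g \<in> carrier P" using finite_seqs_P by blast
    have "(g \<ominus>\<^bsub>P\<^esub> f) n \<in> nbhd (r - \<epsilon> * real n)" for n
    proof (cases "n < K")
      case False
      then have "(r - m) / \<epsilon> \<le> real n" using K by linarith
      then have "r - \<epsilon> * real n \<le> m" using slope(1) by (simp add: pos_divide_le_eq algebra_simps)
      then have "\<ominus> f n \<in> nbhd (r - \<epsilon> * real n)" using m nbhd_mono neg_in_nbhd by blast
      then show ?thesis using False f gP by (simp add: minus_P) (simp add: g_def a_minus_def)
    qed (use f gP in \<open>simp add: minus_P, simp add: g_def a_minus_def r_neg\<close>)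
    then have "g \<ominus>\<^bsub>P\<^esub> f \<in> V.nbhd r" using gP f by (simp add: V_nbhd)
    then show ?thesis using r gP gF by blast
  qed
  then show ?thesis by (auto simp: in_closure_of set_eq_iff)
qed

text \<open>Each coefficient sequence is Cauchy in \<open>R\<close> and converges there. A Cauchy
  sequence for \<open>v\<close> controls coefficient n only up to \<epsilon> n, so boundedness of
  the limit series is not automatic; positivity supplies the bound 0.\<close>

lemma positive_complete:
  assumes pos: "positive_filtration R u"
  shows "filtration_complete P v"
  unfolding filtration_complete_def
proof (intro allI impI)
  fix f assume "filtration_Cauchy P v f"
  then have fP: "\<And>m. f m \<in> carrier P"
    and ca: "\<And>r. \<exists>N. \<forall>m\<ge>N. \<forall>l\<ge>N. f m \<ominus>\<^bsub>P\<^esub> f l \<in> V.nbhd r"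
    by (auto simp: V.filtration_Cauchy_nbhd)
  have cc: "\<exists>N. \<forall>m\<ge>N. \<forall>l\<ge>N. \<forall>n. f m n \<ominus> f l n \<in> nbhd (r - \<epsilon> * real n)" for r
    using ca[of r] fP by (simp add: V_nbhd minus_P) blast
  have "\<exists>l. limitin (filtration_topology R u) (\<lambda>m. f m n) l sequentially" for n
  proof -
    have "\<exists>N. \<forall>m\<ge>N. \<forall>l\<ge>N. f m n \<ominus> f l n \<in> nbhd r" for r
      using cc[of "r + \<epsilon> * real n"] by (metis add_diff_cancel_right')
    then have "filtration_Cauchy R u (\<lambda>m. f m n)" using fP by (simp add: filtration_Cauchy_nbhd)
    then show ?thesis using complete by (simp add: filtration_complete_def)
  qed
  then obtain g where g: "\<And>n. limitin (filtration_topology R u) (\<lambda>m. f m n) (g n) sequentially"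
    by metis
  have gR: "g n \<in> carrier R" for n using g by (simp add: limitin_filtration_topology)
  have "bounded_seq R u g"
    using pos gR by (auto simp: bounded_seq_def positive_filtration_def zero_ereal_def intro!: exI[of _ 0])
  then have gP: "g \<in> carrier P" by (simp add: bounded_seq_iff carrier_P)
  have "\<forall>\<^sub>F m in sequentially. f m \<ominus>\<^bsub>P\<^esub> g \<in> V.nbhd r" for r
  proof -
    obtain N where N: "\<And>m l n. N \<le> m \<Longrightarrow> N \<le> l \<Longrightarrow> f m n \<ominus> f l n \<in> nbhd (r - \<epsilon> * real n)"
      using cc by meson
    have "f m n \<ominus> g n \<in> nbhd (r - \<epsilon> * real n)" if m: "N \<le> m" for m n
    proof -
      \<comment> \<open>The auxiliary index l, chosen beyond M, depends on n, whereas N does not;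
        the resulting bound is therefore uniform in n, as \<open>v\<close> demands.\<close>
      have "\<forall>\<^sub>F l in sequentially. f l n \<ominus> g n \<in> nbhd (r - \<epsilon> * real n)"
        using g[of n] by (simp add: limitin_filtration_topology eventually_conj_iff)
      then obtain M where M: "\<And>l. M \<le> l \<Longrightarrow> f l n \<ominus> g n \<in> nbhd (r - \<epsilon> * real n)"
        by (auto simp: eventually_sequentially)
      show ?thesis
        by (rule diff_in_nbhd_trans[OF _ _ _ N[OF m, of "max M N"] M]) (use fP gR in auto)
    qed
    then have "f m \<ominus>\<^bsub>P\<^esub> g \<in> V.nbhd r" if "N \<le> m" for m
      using that fP gP P.minus_closed[OF fP gP] by (simp add: V_nbhd minus_P)
    then show ?thesis unfolding eventually_sequentially by blast
  qed
  then show "\<exists>g. limitin (filtration_topology P v) f g sequentially"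
    using gP fP by (auto simp: V.limitin_filtration_topology)
qed

end

section \<open>Localisation\<close>

text \<open>Needed because the multiplication of the power series ring over A agrees with that of
  \<open>P\<close> only on the carrier.\<close>

lemma ring_cong:
  assumes "ring R" and "carrier R' = carrier R" and "\<one>\<^bsub>R'\<^esub> = \<one>\<^bsub>R\<^esub>" and "\<zero>\<^bsub>R'\<^esub> = \<zero>\<^bsub>R\<^esub>"
    and "\<And>a b. a \<in> carrier R \<Longrightarrow> b \<in> carrier R \<Longrightarrow> a \<oplus>\<^bsub>R'\<^esub> b = a \<oplus>\<^bsub>R\<^esub> b"
    and "\<And>a b. a \<in> carrier R \<Longrightarrow> b \<in> carrier R \<Longrightarrow> a \<otimes>\<^bsub>R'\<^esub> b = a \<otimes>\<^bsub>R\<^esub> b"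
  shows "ring R'"
proof -
  interpret R: ring R by fact
  show ?thesis
    by (intro ringI abelian_groupI monoidI)
       (auto simp: assms R.a_assoc R.m_assoc R.l_distr R.r_distr intro: R.a_comm R.l_neg)
qed

locale skew_series_localization = skew_series +
  fixes A T :: "'a set"
  assumes A_subring: "subring A R"
    and A_complete: "filtration_complete (R\<lparr>carrier := A\<rparr>) u"
    and A_positive: "positive_filtration (R\<lparr>carrier := A\<rparr>) u"
    and \<sigma>_A: "\<sigma> ` A \<subseteq> A" and \<delta>_A: "\<delta> ` A \<subseteq> A"
    and T_denominators: "left_denominator_set (R\<lparr>carrier := A\<rparr>) T"
    and localization: "is_left_localization (R\<lparr>carrier := A\<rparr>) T R id"
    and bounded_denominator: "bounded_seq R u s \<Longrightarrow> \<exists>t\<in>T. \<forall>n. t \<otimes> s n \<in> A"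
begin

abbreviation "RA \<equiv> R\<lparr>carrier := A\<rparr>"
abbreviation "Q \<equiv> skew_series_ring RA u \<sigma> \<delta>"

section \<open>Power series over the subring A\<close>

lemma A_carrier: "a \<in> A \<Longrightarrow> a \<in> carrier R"
  using subringE(1)[OF A_subring] by blast

lemmas A_closed = subringE(2,3,5-7)[OF A_subring]

interpretation RA: ring RA by (rule subring_is_ring[OF A_subring])

lemma neg_A: "a \<in> A \<Longrightarrow> \<ominus>\<^bsub>RA\<^esub> a = \<ominus> a"
  by (rule RA.minus_equality) (auto simp: l_neg A_carrier A_closed)

lemma minus_A: "a \<in> A \<Longrightarrow> b \<in> A \<Longrightarrow> a \<ominus>\<^bsub>RA\<^esub> b = a \<ominus> b"
  by (simp add: a_minus_def neg_A)

interpretation RA: filtered_group RA u c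
  by unfold_locales
     (auto simp: neg_A A_carrier value_eq_infinity intro: value_add value_neg dest: value_not_minus_infinity[OF A_carrier])

lemma A_nbhd: "RA.nbhd r = A \<inter> nbhd r"
  by (auto simp: RA.nbhd_def nbhd_def neg_A A_carrier)

lemma finsum_A: "(\<And>i. i \<in> I \<Longrightarrow> f i \<in> A) \<Longrightarrow> finsum RA f I = finsum R f I"
  by (induction I rule: infinite_finite_induct)
     (auto simp: finsum_infinite RA.finsum_infinite A_carrier Pi_def)

lemma finsum_A_closed: "(\<And>i. i \<in> I \<Longrightarrow> f i \<in> A) \<Longrightarrow> finsum R f I \<in> A"
  using RA.finsum_closed[of f I] finsum_A[of I f] by auto

text \<open>A carries the subspace topology, and its finite sums are those of \<open>R\<close>, so a
  sum found in A is also a sum in \<open>R\<close>.\<close>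

lemma sums_A:
  assumes f: "\<And>n. f n \<in> A" and S: "filtration_sums RA u f l"
  shows "sums_to f l"
proof -
  have l: "l \<in> A" using RA.sums_closed[OF S] by simp
  have "finsum RA f {..<n} \<ominus>\<^bsub>RA\<^esub> l = finsum R f {..<n} \<ominus> l" for n :: nat
    using minus_A[OF finsum_A_closed[of "{..<n}" f] l] finsum_A[of "{..<n}" f] f by simp
  then show ?thesis
    using S f l by (simp add: RA.sums_iff sums_iff A_nbhd A_carrier eventually_conj_iff)
qed

text \<open>By positivity 0 is a lower bound for all coefficients. This is why every power series
  over A lies in \<open>P\<close>.\<close>

lemma A_series_bounded: "(\<And>n. f n \<in> A) \<Longrightarrow> f \<in> carrier P"
  using A_positive A_carrier unfolding carrier_P bounded_seq_iff[symmetric]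
  by (auto simp: bounded_seq_def positive_filtration_def zero_ereal_def intro!: exI[of _ 0])

lemma add_pow_A: "add_pow RA (n::nat) a = add_pow R n a"
  by (simp add: add_pow_def nat_pow_def)

lemma add_pow_A_closed: "a \<in> A \<Longrightarrow> add_pow R (n::nat) a \<in> A"
  by (induction n) (auto simp: A_closed)

lemma skew_pow_A_closed: "a \<in> A \<Longrightarrow> (\<sigma> ^^ e) ((\<delta> ^^ j) a) \<in> A"
proof -
  assume "a \<in> A"
  then have "(\<delta> ^^ j) a \<in> A" using \<delta>_A by (induction j) auto
  then show ?thesis using \<sigma>_A by (induction e) auto
qed

text \<open>The two products take their inner sums in A and in \<open>R\<close>, respectively.
  Completeness of A provides a sum inside A, and uniqueness of limits in \<open>R\<close> identifies
  it with the other one.\<close>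

lemma series_mult_A:
  assumes f: "\<And>n. f n \<in> A" and g: "\<And>n. g n \<in> A"
  shows "skew_series_mult RA u \<sigma> \<delta> f g = skew_series_mult R u \<sigma> \<delta> f g"
    and "skew_series_mult R u \<sigma> \<delta> f g k \<in> A"
proof -
  let ?t = "skew_term R \<sigma> \<delta> f g"
  have t: "skew_term RA \<sigma> \<delta> f g = ?t" by (simp add: fun_eq_iff skew_term_def add_pow_A)
  have tA: "?t k e j \<in> A" for k e j
    unfolding skew_term_def by (intro add_pow_A_closed A_closed skew_pow_A_closed f g)
  have sums: "filtration_sums RA u (?t k e) (filtration_suminf RA u (?t k e))" for k e
  proof (rule RA.null_seq_sums[OF A_complete])
    obtain p q where "bounded_by p f" "bounded_by q g"
      using A_series_bounded[of f] A_series_bounded[of g] f g by (auto simp: carrier_P)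
    then have "null_seq (?t k e)" by (rule skew_term_null_seq)
    then show "RA.null_seq (?t k e)"
      using tA by (simp add: RA.null_seq_def null_seq_def A_nbhd)
  qed
  have suminf: "filtration_suminf RA u (?t k e) = filtration_suminf R u (?t k e)" for k e
    using suminf_eq[OF sums_A[OF tA sums]] by simp
  have mem: "filtration_suminf R u (?t k e) \<in> A" for k e
    using RA.sums_closed[OF sums] suminf by simp
  show "skew_series_mult RA u \<sigma> \<delta> f g = skew_series_mult R u \<sigma> \<delta> f g"
    unfolding skew_series_mult_def t suminf by (intro ext finsum_A mem)
  show "skew_series_mult R u \<sigma> \<delta> f g k \<in> A"
    unfolding skew_series_mult_def by (intro finsum_A_closed mem)
qed

lemma carrier_Q: "f \<in> carrier Q \<longleftrightarrow> (\<forall>n. f n \<in> A)"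
  by (simp add: skew_series_ring_def)

lemma Q_P: "f \<in> carrier Q \<Longrightarrow> f \<in> carrier P"
  by (simp add: carrier_Q A_series_bounded)

lemma Q_simps:
  "f \<oplus>\<^bsub>Q\<^esub> g = f \<oplus>\<^bsub>P\<^esub> g" "\<one>\<^bsub>Q\<^esub> = \<one>\<^bsub>P\<^esub>" "\<zero>\<^bsub>Q\<^esub> = \<zero>\<^bsub>P\<^esub>"
  by (simp_all add: skew_series_ring_def const_series_def fun_eq_iff)

lemma mult_Q: "f \<in> carrier Q \<Longrightarrow> g \<in> carrier Q \<Longrightarrow> f \<otimes>\<^bsub>Q\<^esub> g = f \<otimes>\<^bsub>P\<^esub> g"
  using series_mult_A(1) by (simp add: carrier_Q) (simp add: skew_series_ring_def)

lemma Q_subring: "subring (carrier Q) P"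
proof (rule P.subringI)
  show "\<ominus>\<^bsub>P\<^esub> f \<in> carrier Q" if "f \<in> carrier Q" for f
    using that A_closed by (simp add: neg_P[OF Q_P[OF that]] carrier_Q)
  show "f \<otimes>\<^bsub>P\<^esub> g \<in> carrier Q" if "f \<in> carrier Q" "g \<in> carrier Q" for f g
    using that series_mult_A(2) by (simp add: carrier_Q)
qed (auto simp: Q_P, auto simp: carrier_Q const_series_def A_closed)

lemma ring_Q: "ring Q"
  by (rule ring_cong[OF P.subring_is_ring[OF Q_subring]]) (simp_all add: Q_simps mult_Q del: P_simps)

section \<open>Denominators and the Ore localisation\<close>

lemma T_A: "t \<in> T \<Longrightarrow> t \<in> A"
  using T_denominators by (auto simp: left_denominator_set_def)

lemma one_T: "\<one> \<in> T" and mult_T: "s \<in> T \<Longrightarrow> t \<in> T \<Longrightarrow> s \<otimes> t \<in> T"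
  using T_denominators by (auto simp: left_denominator_set_def)

lemma T_Units: "t \<in> T \<Longrightarrow> t \<in> Units R"
  using localization by (auto simp: is_left_localization_def)

lemma T_carrier: "t \<in> T \<Longrightarrow> t \<in> carrier R"
  using T_Units by blast

lemma const_series_mult:
  "r \<in> carrier R \<Longrightarrow> s \<in> carrier R \<Longrightarrow> const_series R r \<otimes>\<^bsub>P\<^esub> const_series R s = const_series R (r \<otimes> s)"
  by (subst const_mult) (simp_all, simp add: series_smult_def const_series_def fun_eq_iff)

lemma const_T_inverse:
  assumes "t \<in> T"
  shows "const_series R t \<in> Units P" and "inv\<^bsub>P\<^esub> (const_series R t) = const_series R (inv t)"
proof -
  have t: "t \<in> carrier R" "inv t \<in> carrier R" using T_Units[OF assms] by auto
  have eq: "const_series R (inv t) \<otimes>\<^bsub>P\<^esub> const_series R t = \<one>\<^bsub>P\<^esub>"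
    "const_series R t \<otimes>\<^bsub>P\<^esub> const_series R (inv t) = \<one>\<^bsub>P\<^esub>"
    using t T_Units[OF assms] by (simp_all add: const_series_mult del: P_simps(1))
  have P: "const_series R t \<in> carrier P" "const_series R (inv t) \<in> carrier P" using t by auto
  show "const_series R t \<in> Units P"
    unfolding Units_def using eq P by blast
  show "inv\<^bsub>P\<^esub> (const_series R t) = const_series R (inv t)"
    using P.inv_char[OF P(1) P(2) eq(2) eq(1)] .
qed

lemma const_T_Q: "t \<in> T \<Longrightarrow> const_series R t \<in> carrier Q"
  using T_A by (auto simp: carrier_Q const_series_def A_closed)

text \<open>A constant multiplies from the left coefficientwise, so a single t clearing the bounded
  coefficient sequence clears the whole series.\<close>

lemma P_denominator:
  assumes "f \<in> carrier P" obtains t where "t \<in> T" "const_series R t \<otimes>\<^bsub>P\<^esub> f \<in> carrier Q"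
proof -
  obtain t where t: "t \<in> T" "\<forall>n. t \<otimes> f n \<in> A"
    using bounded_denominator[OF P_bounded[OF assms]] by blast
  then have "const_series R t \<otimes>\<^bsub>P\<^esub> f \<in> carrier Q"
    using const_mult[of t f] T_carrier assms by (simp add: carrier_Q series_smult_def)
  with t show ?thesis using that by blast
qed

lemma left_denominator_set_Q: "left_denominator_set Q (const_series R ` T)"
  unfolding left_denominator_set_def
proof (intro conjI ballI impI)
  show "const_series R ` T \<subseteq> carrier Q" using const_T_Q by blast
  show "\<one>\<^bsub>Q\<^esub> \<in> const_series R ` T" using one_T by (simp add: Q_simps)
next
  fix x y assume "x \<in> const_series R ` T" "y \<in> const_series R ` T"
  then show "x \<otimes>\<^bsub>Q\<^esub> y \<in> const_series R ` T"
    using mult_T by (auto simp: mult_Q const_T_Q const_series_mult T_carrier simp del: P_simps)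
next
  fix f x assume f: "f \<in> carrier Q" and "x \<in> const_series R ` T"
  then obtain t where t: "t \<in> T" "x = const_series R t" by blast
  have x: "x \<in> Units P" "x \<in> carrier P" "x \<in> carrier Q" using const_T_inverse t const_T_Q Q_P by auto
  have "f \<otimes>\<^bsub>P\<^esub> inv\<^bsub>P\<^esub> x \<in> carrier P" using x(1) Q_P[OF f] by (intro P.m_closed P.Units_inv_closed)
  then obtain t' where t': "t' \<in> T"
    "const_series R t' \<otimes>\<^bsub>P\<^esub> (f \<otimes>\<^bsub>P\<^esub> inv\<^bsub>P\<^esub> x) \<in> carrier Q"
    using P_denominator by blast
  let ?f' = "const_series R t' \<otimes>\<^bsub>P\<^esub> (f \<otimes>\<^bsub>P\<^esub> inv\<^bsub>P\<^esub> x)"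
  have "const_series R t' \<otimes>\<^bsub>P\<^esub> f = ?f' \<otimes>\<^bsub>P\<^esub> x"
    using x Q_P[OF f] Q_P[OF const_T_Q[OF t'(1)]] by (simp add: P.m_assoc del: P_simps)
  then have "const_series R t' \<otimes>\<^bsub>Q\<^esub> f = ?f' \<otimes>\<^bsub>Q\<^esub> x"
    using mult_Q[OF const_T_Q[OF t'(1)] f] mult_Q[OF t'(2) x(3)] by (simp only:)
  then show "\<exists>f'\<in>carrier Q. \<exists>t'\<in>const_series R ` T. t' \<otimes>\<^bsub>Q\<^esub> f = f' \<otimes>\<^bsub>Q\<^esub> x"
    using t' by blast
next
  fix f x assume f: "f \<in> carrier Q" and "x \<in> const_series R ` T" and fx: "f \<otimes>\<^bsub>Q\<^esub> x = \<zero>\<^bsub>Q\<^esub>"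
  then have x: "x \<in> Units P" "x \<in> carrier Q" using const_T_inverse const_T_Q by auto
  have "f \<otimes>\<^bsub>P\<^esub> x = \<zero>\<^bsub>P\<^esub>" using fx mult_Q[OF f x(2)] by (simp add: Q_simps)
  \<comment> \<open>As x is invertible in \<open>P\<close>, f x = 0 forces f = 0, and x itself can
    serve as the element annihilating f from the left.\<close>
  then have "f \<otimes>\<^bsub>P\<^esub> x \<otimes>\<^bsub>P\<^esub> inv\<^bsub>P\<^esub> x = \<zero>\<^bsub>P\<^esub>"
    using P.l_null[OF P.Units_inv_closed[OF x(1)]] by (simp only:)
  then have "f = \<zero>\<^bsub>P\<^esub>" using x Q_P[OF f] Q_P[OF x(2)] by (simp add: P.m_assoc del: P_simps)
  then have "x \<otimes>\<^bsub>Q\<^esub> f = \<zero>\<^bsub>Q\<^esub>"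
    using mult_Q[OF x(2) f] P.r_null[OF Q_P[OF x(2)]] Q_simps(3) by (simp only:)
  then show "\<exists>t'\<in>const_series R ` T. t' \<otimes>\<^bsub>Q\<^esub> f = \<zero>\<^bsub>Q\<^esub>"
    using \<open>x \<in> const_series R ` T\<close> by blast
qed

lemma is_left_localization_Q: "is_left_localization Q (const_series R ` T) P id"
  unfolding is_left_localization_def
proof (intro conjI ballI)
  show "ring P" by (rule ring_P)
  show "id \<in> ring_hom Q P"
    by (rule ring_hom_memI) (simp_all add: Q_P mult_Q Q_simps del: P_simps)
  show "id ` const_series R ` T \<subseteq> Units P" using const_T_inverse by auto
next
  fix f assume f: "f \<in> carrier P"
  obtain t where t: "t \<in> T" "const_series R t \<otimes>\<^bsub>P\<^esub> f \<in> carrier Q" using P_denominator[OF f] by blast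
  have x: "const_series R t \<in> Units P" "const_series R t \<in> carrier P" using const_T_inverse t by auto
  then have "f = inv\<^bsub>P\<^esub> const_series R t \<otimes>\<^bsub>P\<^esub> (const_series R t \<otimes>\<^bsub>P\<^esub> f)"
    using f by (simp add: P.m_assoc[symmetric] del: P_simps)
  then show "\<exists>t\<in>const_series R ` T. \<exists>r\<in>carrier Q. f = inv\<^bsub>P\<^esub> id t \<otimes>\<^bsub>P\<^esub> id r"
    using t by auto
next
  fix f assume f: "f \<in> carrier Q"
  show "id f = \<zero>\<^bsub>P\<^esub> \<longleftrightarrow> (\<exists>t\<in>const_series R ` T. t \<otimes>\<^bsub>Q\<^esub> f = \<zero>\<^bsub>Q\<^esub>)"
  proof
    assume "id f = \<zero>\<^bsub>P\<^esub>"
    then have "const_series R \<one> \<otimes>\<^bsub>Q\<^esub> f = \<zero>\<^bsub>Q\<^esub>"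
      using mult_Q[OF const_T_Q[OF one_T] f] P.r_null[OF Q_P[OF const_T_Q[OF one_T]]] Q_simps(3)
      by (simp only: id_apply)
    then show "\<exists>t\<in>const_series R ` T. t \<otimes>\<^bsub>Q\<^esub> f = \<zero>\<^bsub>Q\<^esub>" using one_T by blast
  next
    assume "\<exists>t\<in>const_series R ` T. t \<otimes>\<^bsub>Q\<^esub> f = \<zero>\<^bsub>Q\<^esub>"
    then obtain x where xT: "x \<in> const_series R ` T" and xf: "x \<otimes>\<^bsub>Q\<^esub> f = \<zero>\<^bsub>Q\<^esub>" by blast
    have x: "x \<in> Units P" "x \<in> carrier Q" using xT const_T_inverse const_T_Q by auto
    have "x \<otimes>\<^bsub>P\<^esub> f = \<zero>\<^bsub>P\<^esub>" using xf mult_Q[OF x(2) f] by (simp add: Q_simps)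
    then have "inv\<^bsub>P\<^esub> x \<otimes>\<^bsub>P\<^esub> (x \<otimes>\<^bsub>P\<^esub> f) = \<zero>\<^bsub>P\<^esub>"
      using P.r_null[OF P.Units_inv_closed[OF x(1)]] by (simp only:)
    then show "id f = \<zero>\<^bsub>P\<^esub>"
      using x Q_P[OF f] Q_P[OF x(2)] by (simp add: P.m_assoc[symmetric] del: P_simps)
  qed
qed

section \<open>The tensor product\<close>

abbreviation "tensors \<equiv> free_Abelian_group (carrier R \<times> carrier Q)"
abbreviation "relations \<equiv> tensor_relations RA R (\<otimes>) Q (series_smult R)"
abbreviation "tkernel \<equiv> tensor_kernel RA R (\<otimes>) Q (series_smult R)"

lemma smult_Q_closed: "a \<in> A \<Longrightarrow> f \<in> carrier Q \<Longrightarrow> series_smult R a f \<in> carrier Q"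
  using A_closed by (simp add: carrier_Q series_smult_def)

lemma add_Q_closed: "f \<in> carrier Q \<Longrightarrow> g \<in> carrier Q \<Longrightarrow> f \<oplus>\<^bsub>Q\<^esub> g \<in> carrier Q"
  using ring.ring_simprules(1)[OF ring_Q] .

lemma zero_Q_closed: "\<zero>\<^bsub>Q\<^esub> \<in> carrier Q"
  using ring.ring_simprules(2)[OF ring_Q] .

lemma relations_tensors: "relations \<subseteq> carrier tensors"
proof
  fix c assume "c \<in> relations"
  moreover have "frag_of (x, m) - frag_of (y, n) - frag_of (z, l) \<in> carrier tensors"
    if "(x, m) \<in> carrier R \<times> carrier Q" "(y, n) \<in> carrier R \<times> carrier Q" "(z, l) \<in> carrier R \<times> carrier Q"
    for x y z m n l
    using that by (auto dest!: subsetD[OF keys_diff])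
  moreover have "frag_of (x, m) - frag_of (y, n) \<in> carrier tensors"
    if "(x, m) \<in> carrier R \<times> carrier Q" "(y, n) \<in> carrier R \<times> carrier Q" for x y m n
    using that by (auto dest!: subsetD[OF keys_diff])
  ultimately show "c \<in> carrier tensors"
    unfolding tensor_relations_def
    using add_Q_closed smult_Q_closed A_carrier by (elim UnE CollectE exE conjE) auto
qed

lemma subgroup_tkernel: "subgroup tkernel tensors"
  unfolding tensor_kernel_def
  by (rule group.generate_is_subgroup[OF group_free_Abelian_group relations_tensors])

lemma tkernel_add: "x \<in> tkernel \<Longrightarrow> y \<in> tkernel \<Longrightarrow> x + y \<in> tkernel"
  using subgroup.m_closed[OF subgroup_tkernel] by simp

lemma tkernel_zero: "0 \<in> tkernel"
  using subgroup.one_closed[OF subgroup_tkernel] by simp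

lemma tkernel_neg: "x \<in> tkernel \<Longrightarrow> - x \<in> tkernel"
  using subgroup.m_inv_closed[OF subgroup_tkernel, of x] subgroup.mem_carrier[OF subgroup_tkernel, of x]
  by simp

lemma tkernel_diff: "x \<in> tkernel \<Longrightarrow> y \<in> tkernel \<Longrightarrow> x - y \<in> tkernel"
  using tkernel_add[OF _ tkernel_neg, of x y] by simp

lemma tkernel_add_right:
  "x \<in> carrier R \<Longrightarrow> f \<in> carrier Q \<Longrightarrow> g \<in> carrier Q
    \<Longrightarrow> frag_of (x, f \<oplus>\<^bsub>Q\<^esub> g) - frag_of (x, f) - frag_of (x, g) \<in> tkernel"
  unfolding tensor_kernel_def tensor_relations_def by (intro generate.incl) blast

lemma tkernel_balanced:
  "x \<in> carrier R \<Longrightarrow> a \<in> A \<Longrightarrow> f \<in> carrier Q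
    \<Longrightarrow> frag_of (x \<otimes> a, f) - frag_of (x, series_smult R a f) \<in> tkernel"
  unfolding tensor_kernel_def tensor_relations_def by (intro generate.incl) auto

text \<open>Two elements form a bounded sequence when the second is repeated forever, so the
  hypothesis on bounded sequences provides their common denominator.\<close>

lemma finite_denominator:
  assumes "r \<in> carrier R" "s \<in> carrier R"
  obtains t where "t \<in> T" "t \<otimes> r \<in> A" "t \<otimes> s \<in> A"
proof -
  let ?f = "\<lambda>n::nat. if n = 0 then r else s"
  obtain p q where "r \<in> nbhd p" "s \<in> nbhd q" using assms nbhd_exhaustive by meson
  then have "bounded_by (min p q) ?f"
    using nbhd_mono[of r p "min p q"] nbhd_mono[of s q "min p q"] by simp
  then have "bounded_seq R u ?f" unfolding bounded_seq_iff by blast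
  then obtain t where "t \<in> T" and t: "\<forall>n. t \<otimes> ?f n \<in> A" using bounded_denominator by blast
  with spec[OF t, of 0] spec[OF t, of 1] show ?thesis using that by simp
qed

text \<open>A common denominator brings every tensor into the form \<open>t\<^sup>-\<^sup>1 \<otimes> f\<close>.\<close>

lemma tensor_reduce:
  assumes "s \<in> carrier R" "g \<in> carrier Q" "t \<in> T" "t \<otimes> s \<in> A"
  shows "frag_of (s, g) - frag_of (inv t, series_smult R (t \<otimes> s) g) \<in> tkernel"
proof -
  have "inv t \<otimes> (t \<otimes> s) = s"
    using T_Units[OF assms(3)] T_carrier[OF assms(3)] assms(1) by (simp add: m_assoc[symmetric])
  then show ?thesis
    using tkernel_balanced[of "inv t" "t \<otimes> s" g] T_Units[OF assms(3)] assms by simp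
qed

text \<open>The induction principle asks for zero, differences and generators. For a difference, an
  element k of T with both k t^-1 and k t'^-1 in A rewrites the two tensors over the same left
  factor k^-1, where their right factors can be subtracted.\<close>

lemma tensor_normal_form:
  assumes "Poly_Mapping.keys z \<subseteq> carrier R \<times> carrier Q"
  shows "\<exists>t\<in>T. \<exists>f\<in>carrier Q. z - frag_of (inv t, f) \<in> tkernel"
proof (rule free_Abelian_group_induct[OF assms])
  have one: "inv \<one> \<in> carrier R" by simp
  have "\<zero>\<^bsub>Q\<^esub> \<oplus>\<^bsub>Q\<^esub> \<zero>\<^bsub>Q\<^esub> = \<zero>\<^bsub>Q\<^esub>"
    using ring.ring_simprules(8)[OF ring_Q zero_Q_closed] .
  \<comment> \<open>Additivity in the second factor for 0 + 0 = 0 says precisely that the pair with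
    second entry 0 lies in the kernel, up to sign.\<close>
  then have "0 - frag_of (inv \<one>, \<zero>\<^bsub>Q\<^esub>) \<in> tkernel"
    using tkernel_add_right[OF one zero_Q_closed zero_Q_closed] by simp
  then show "\<exists>t\<in>T. \<exists>f\<in>carrier Q. 0 - frag_of (inv t, f) \<in> tkernel"
    using one_T zero_Q_closed by blast
next
  fix x y assume "\<exists>t\<in>T. \<exists>f\<in>carrier Q. x - frag_of (inv t, f) \<in> tkernel"
    "\<exists>t\<in>T. \<exists>f\<in>carrier Q. y - frag_of (inv t, f) \<in> tkernel"
  then obtain t f t' g where tf: "t \<in> T" "f \<in> carrier Q" "x - frag_of (inv t, f) \<in> tkernel"
    and tg: "t' \<in> T" "g \<in> carrier Q" "y - frag_of (inv t', g) \<in> tkernel" by blast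
  have i: "inv t \<in> carrier R" "inv t' \<in> carrier R" using T_Units tf tg by auto
  obtain k where k: "k \<in> T" "k \<otimes> inv t \<in> A" "k \<otimes> inv t' \<in> A"
    using finite_denominator[OF i] by blast
  let ?F = "series_smult R (k \<otimes> inv t) f" and ?G = "series_smult R (k \<otimes> inv t') g"
  have FG: "?F \<in> carrier Q" "?G \<in> carrier Q" using smult_Q_closed k tf tg by auto
  have D: "?F \<ominus>\<^bsub>Q\<^esub> ?G \<in> carrier Q" "(?F \<ominus>\<^bsub>Q\<^esub> ?G) \<oplus>\<^bsub>Q\<^esub> ?G = ?F"
    using FG by (simp_all add: ring.ring_simprules(4)[OF ring_Q]
        abelian_group.diff_add_cancel[OF ring.is_abelian_group[OF ring_Q]])
  have ki: "inv k \<in> carrier R" using T_Units k by auto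
  have 1: "frag_of (inv t, f) - frag_of (inv k, ?F) \<in> tkernel"
    by (rule tensor_reduce) (use i k tf in auto)
  have 2: "frag_of (inv t', g) - frag_of (inv k, ?G) \<in> tkernel"
    by (rule tensor_reduce) (use i k tg in auto)
  have 3: "frag_of (inv k, ?F) - frag_of (inv k, ?F \<ominus>\<^bsub>Q\<^esub> ?G) - frag_of (inv k, ?G) \<in> tkernel"
    using tkernel_add_right[OF ki D(1) FG(2)] D(2) by simp
  \<comment> \<open>Telescoping: x and y are replaced by their normal forms, these by pairs with
    left entry k^-1, and the last summand combines the two pairs into one.\<close>
  have "(x - frag_of (inv t, f)) - (y - frag_of (inv t', g)) +
      ((frag_of (inv t, f) - frag_of (inv k, ?F)) - (frag_of (inv t', g) - frag_of (inv k, ?G))) +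
      (frag_of (inv k, ?F) - frag_of (inv k, ?F \<ominus>\<^bsub>Q\<^esub> ?G) - frag_of (inv k, ?G)) \<in> tkernel"
    by (intro tkernel_add tkernel_diff tf tg 1 2 3)
  then have "(x - y) - frag_of (inv k, ?F \<ominus>\<^bsub>Q\<^esub> ?G) \<in> tkernel"
    by (simp add: algebra_simps)
  then show "\<exists>t\<in>T. \<exists>f\<in>carrier Q. x - y - frag_of (inv t, f) \<in> tkernel" using k D by blast
next
  fix a assume "a \<in> carrier R \<times> carrier Q"
  then obtain s g where sg: "a = (s, g)" "s \<in> carrier R" "g \<in> carrier Q" by blast
  obtain t where t: "t \<in> T" "t \<otimes> s \<in> A" using finite_denominator[OF sg(2,2)] by blast
  then show "\<exists>t\<in>T. \<exists>f\<in>carrier Q. frag_of a - frag_of (inv t, f) \<in> tkernel"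
    using tensor_reduce[OF sg(2,3) t] smult_Q_closed[OF t(2) sg(3)] sg(1) by blast
qed

lemma smult_P_closed: "r \<in> carrier R \<Longrightarrow> f \<in> carrier P \<Longrightarrow> series_smult R r f \<in> carrier P"
  using P.m_closed[OF const_series_closed] const_mult by metis

text \<open>Obtained from the first isomorphism theorem: scalar multiplication extends to the free
  abelian group on pairs, and its kernel is shown to be exactly the subgroup generated by the
  relations. No inverse map has to be constructed, so the choice of denominators never needs to be
  shown irrelevant.\<close>

lemma tensor_iso:
  "\<exists>h. h \<in> iso (tensor_product RA R (\<otimes>) Q (series_smult R)) (add_monoid P) \<and>
     (\<forall>s\<in>carrier R. \<forall>f\<in>carrier Q.
        h (pure_tensor RA R (\<otimes>) Q (series_smult R) s f) = const_series R s \<otimes>\<^bsub>P\<^esub> f)"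
proof -
  have "(\<lambda>(s, f). series_smult R s f) ` (carrier R \<times> carrier Q) \<subseteq> carrier (add_monoid P)"
    using smult_P_closed Q_P by auto
  then obtain h where h: "h \<in> hom tensors (add_monoid P)"
    and hf': "\<And>x. x \<in> carrier R \<times> carrier Q \<Longrightarrow> h (frag_of x) = (\<lambda>(s, f). series_smult R s f) x"
    using comm_group.free_Abelian_group_universal[OF P.a_comm_group] by blast
  have hf: "h (frag_of (s, f)) = series_smult R s f" if "s \<in> carrier R" "f \<in> carrier Q" for s f
    using hf'[of "(s, f)"] that by simp
  interpret h: group_hom tensors "add_monoid P" h
    by (intro group_hom.intro group_hom_axioms.intro group_free_Abelian_group P.add.is_group h)
  have h_closed: "h x \<in> carrier P" if "x \<in> carrier tensors" for x using h.hom_closed[OF that] by simp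
  have diff_closed: "x - y \<in> carrier tensors" if "x \<in> carrier tensors" "y \<in> carrier tensors" for x y
    using that by (auto dest!: subsetD[OF keys_diff])
  have h_diff: "h (x - y) = h x \<ominus>\<^bsub>P\<^esub> h y" if xy: "x \<in> carrier tensors" "y \<in> carrier tensors" for x y
  proof -
    have "h x = h (x - y) \<oplus>\<^bsub>P\<^esub> h y"
      using h.hom_mult[OF diff_closed[OF xy] xy(2)] by simp
    then show ?thesis
      using h_closed[OF diff_closed[OF xy]] h_closed[OF xy(2)]
      by (simp only:) (simp add: P.minus_eq P.a_assoc P.r_neg del: P_simps)
  qed
  have pure_carrier: "frag_of (s, f) \<in> carrier tensors" if "s \<in> carrier R" "f \<in> carrier Q" for s f
    using that by simp
  have "relations \<subseteq> kernel tensors (add_monoid P) h"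
  proof
    fix c assume c: "c \<in> relations"
    then have cc: "c \<in> carrier tensors" using relations_tensors by blast
    from c consider
      (1) x y f where "c = frag_of (x \<oplus> y, f) - frag_of (x, f) - frag_of (y, f)"
        "x \<in> carrier R" "y \<in> carrier R" "f \<in> carrier Q"
    | (2) x f g where "c = frag_of (x, f \<oplus>\<^bsub>Q\<^esub> g) - frag_of (x, f) - frag_of (x, g)"
        "x \<in> carrier R" "f \<in> carrier Q" "g \<in> carrier Q"
    | (3) x a f where "c = frag_of (x \<otimes> a, f) - frag_of (x, series_smult R a f)"
        "x \<in> carrier R" "a \<in> A" "f \<in> carrier Q"
      unfolding tensor_relations_def by auto
    then have "h c = \<zero>\<^bsub>P\<^esub>"
    proof cases
      case 1
      then have eq: "series_smult R (x \<oplus> y) f = series_smult R x f \<oplus>\<^bsub>P\<^esub> series_smult R y f"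
        by (simp add: series_smult_def l_distr Q_P)
      have "h c = series_smult R (x \<oplus> y) f \<ominus>\<^bsub>P\<^esub> series_smult R x f \<ominus>\<^bsub>P\<^esub> series_smult R y f"
        using 1 by (simp add: h_diff diff_closed pure_carrier hf del: carrier_free_Abelian_group_iff)
      then show ?thesis
        using 1 Q_P[OF 1(4)] unfolding eq
        by (simp add: P.add_diff_cancel smult_P_closed del: P_simps)
    next
      case 2
      have eq: "series_smult R x (f \<oplus>\<^bsub>Q\<^esub> g) = series_smult R x f \<oplus>\<^bsub>P\<^esub> series_smult R x g"
        using 2 by (simp add: Q_simps) (simp add: series_smult_def r_distr Q_P)
      have "h c = series_smult R x (f \<oplus>\<^bsub>Q\<^esub> g) \<ominus>\<^bsub>P\<^esub> series_smult R x f \<ominus>\<^bsub>P\<^esub> series_smult R x g"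
        using 2 add_Q_closed
        by (simp add: h_diff diff_closed pure_carrier hf del: carrier_free_Abelian_group_iff)
      then show ?thesis
        using 2 Q_P[OF 2(3)] Q_P[OF 2(4)] unfolding eq
        by (simp add: P.add_diff_cancel smult_P_closed del: P_simps)
    next
      case 3
      have eq: "series_smult R x (series_smult R a f) = series_smult R (x \<otimes> a) f"
        using 3 by (simp add: series_smult_def m_assoc A_carrier Q_P)
      have "h c = series_smult R (x \<otimes> a) f \<ominus>\<^bsub>P\<^esub> series_smult R x (series_smult R a f)"
        using 3 smult_Q_closed A_carrier
        by (simp add: h_diff pure_carrier hf del: carrier_free_Abelian_group_iff)
      then show ?thesis
        using 3 Q_P[OF 3(4)] unfolding eq
        by (simp add: P.minus_eq P.r_neg smult_P_closed A_carrier del: P_simps)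
    qed
    then show "c \<in> kernel tensors (add_monoid P) h" using cc by (simp add: kernel_def)
  qed
  then have sub: "tkernel \<subseteq> kernel tensors (add_monoid P) h"
    unfolding tensor_kernel_def
    by (rule group.generate_subgroup_incl[OF group_free_Abelian_group _ h.subgroup_kernel])
  have ker: "kernel tensors (add_monoid P) h = tkernel"
  proof (rule antisym[OF _ sub], rule subsetI)
    fix c assume c: "c \<in> kernel tensors (add_monoid P) h"
    then have cc: "c \<in> carrier tensors" and hc: "h c = \<zero>\<^bsub>P\<^esub>" by (auto simp: kernel_def)
    obtain t f where t: "t \<in> T" "f \<in> carrier Q" and d: "c - frag_of (inv t, f) \<in> tkernel"
      using tensor_normal_form[of c] cc by auto
    have it: "inv t \<in> carrier R" "t \<in> carrier R" using T_Units[OF t(1)] by auto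
    have "h (c - frag_of (inv t, f)) = \<zero>\<^bsub>P\<^esub>" using subsetD[OF sub d] by (simp add: kernel_def)
    then have "\<zero>\<^bsub>P\<^esub> \<ominus>\<^bsub>P\<^esub> series_smult R (inv t) f = \<zero>\<^bsub>P\<^esub>"
      using h_diff[OF cc pure_carrier[OF it(1) t(2)]] hc hf[OF it(1) t(2)] by (simp only:)
    then have "series_smult R (inv t) f = \<zero>\<^bsub>P\<^esub>"
      using smult_P_closed[OF it(1) Q_P[OF t(2)]]
      by (metis P.a_inv_closed P.l_zero P.minus_eq P.minus_minus P.minus_zero)
    then have "inv t \<otimes> f n = \<zero>" for n
      by (simp add: series_smult_def const_series_def fun_eq_iff)
    \<comment> \<open>Cancelling the unit t^-1 shows f = 0; the normal form of c is then a trivial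
      tensor and c lies in the generated subgroup.\<close>
    then have "t \<otimes> (inv t \<otimes> f n) = \<zero>" for n using it by simp
    then have f0: "f = \<zero>\<^bsub>Q\<^esub>"
      using T_Units[OF t(1)] it Q_P[OF t(2)]
      by (simp add: m_assoc[symmetric] Q_simps const_series_def fun_eq_iff)
    have "\<zero>\<^bsub>Q\<^esub> \<oplus>\<^bsub>Q\<^esub> \<zero>\<^bsub>Q\<^esub> = \<zero>\<^bsub>Q\<^esub>"
      using ring.ring_simprules(8)[OF ring_Q zero_Q_closed] .
    then have "- frag_of (inv t, f) \<in> tkernel"
      using tkernel_add_right[OF it(1) zero_Q_closed zero_Q_closed] unfolding f0 by simp
    then have "(c - frag_of (inv t, f)) - (- frag_of (inv t, f)) \<in> tkernel"
      by (rule tkernel_diff[OF d])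
    then show "c \<in> tkernel" by simp
  qed
  have surj: "h ` carrier tensors = carrier (add_monoid P)"
  proof
    show "h ` carrier tensors \<subseteq> carrier (add_monoid P)" using h_closed by auto
    show "carrier (add_monoid P) \<subseteq> h ` carrier tensors"
    proof
      fix p assume "p \<in> carrier (add_monoid P)"
      then have p: "p \<in> carrier P" by simp
      obtain t where t: "t \<in> T" "const_series R t \<otimes>\<^bsub>P\<^esub> p \<in> carrier Q" using P_denominator[OF p] by blast
      have it: "inv t \<in> carrier R" "t \<in> carrier R" using T_Units[OF t(1)] by auto
      have q: "series_smult R t p \<in> carrier Q" using t const_mult[OF it(2) p] by simp
      have "h (frag_of (inv t, series_smult R t p)) = series_smult R (inv t) (series_smult R t p)"
        by (rule hf[OF it(1) q])
      also have "\<dots> = p"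
        using T_Units[OF t(1)] it p by (simp add: series_smult_def m_assoc[symmetric])
      finally show "p \<in> h ` carrier tensors" using pure_carrier[OF it(1) q] by (metis image_eqI)
    qed
  qed
  \<comment> \<open>The value that h takes on all representatives of the coset X.\<close>
  let ?H = "\<lambda>X. the_elem (h ` X)"
  have "?H \<in> iso (tensor_product RA R (\<otimes>) Q (series_smult R)) (add_monoid P)"
    using h.FactGroup_iso_set[OF surj] unfolding ker tensor_product_def .
  moreover have "?H (pure_tensor RA R (\<otimes>) Q (series_smult R) s f) = const_series R s \<otimes>\<^bsub>P\<^esub> f"
    if sf: "s \<in> carrier R" "f \<in> carrier Q" for s f
  proof -
    have "h (k + frag_of (s, f)) = h (frag_of (s, f))" if k: "k \<in> tkernel" for k
    proof -
      have "k \<in> carrier tensors" "h k = \<zero>\<^bsub>P\<^esub>" using k unfolding ker[symmetric] by (auto simp: kernel_def)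
      then have "h (k + frag_of (s, f)) = \<zero>\<^bsub>P\<^esub> \<oplus>\<^bsub>P\<^esub> h (frag_of (s, f))"
        using h.hom_mult[of k "frag_of (s, f)"] sf by simp
      then show ?thesis using P.l_zero[OF h_closed[OF pure_carrier[OF sf]]] by (simp only:)
    qed
    then have "h ` pure_tensor RA R (\<otimes>) Q (series_smult R) s f = {h (frag_of (s, f))}"
      using tkernel_zero unfolding pure_tensor_def r_coset_def by auto
    then show ?thesis using hf[OF sf] const_mult[OF sf(1) Q_P[OF sf(2)]] by simp
  qed
  ultimately show ?thesis by blast
qed

end

section \<open>Quasi-compatibility\<close>

lemma filtered_degrees_antimono:
  assumes "d \<in> filtered_degrees R u f" "d' \<le> d" shows "d' \<in> filtered_degrees R u f"
  unfolding filtered_degrees_def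
proof (intro CollectI allI)
  fix n
  have "f ` level_set R u n \<subseteq> level_set R u (n + d)" using assms(1) by (simp add: filtered_degrees_def)
  also have "\<dots> \<subseteq> level_set R u (n + d')" using assms(2) by (intro level_set_antimono) simp
  finally show "f ` level_set R u n \<subseteq> level_set R u (n + d')" .
qed

text \<open>The degree is a supremum of integers, so a lower bound d is realised: some admissible
  integer exceeds d - 1, hence is at least d.\<close>

lemma le_filtered_deg:
  assumes "ereal (real_of_int d) \<le> filtered_deg R u f" shows "d \<in> filtered_degrees R u f"
proof -
  have "ereal (real_of_int d - 1) < filtered_deg R u f"
    using assms by (rule order.strict_trans2[rotated]) simp
  then obtain d' where "d' \<in> filtered_degrees R u f" "real_of_int d - 1 < real_of_int d'"
    by (auto simp: filtered_deg_def less_SUP_iff)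
  then show ?thesis using filtered_degrees_antimono[of d' R u f d] by linarith
qed

lemma filtered_degreesD:
  "d \<in> filtered_degrees R u f \<Longrightarrow> a \<in> level_set R u n \<Longrightarrow> f a \<in> level_set R u (n + d)"
  by (auto simp: filtered_degrees_def)

lemma ring_filtration_values:
  "ring_filtration R u \<Longrightarrow> a \<in> carrier R
    \<Longrightarrow> u a \<in> range (\<lambda>n::int. ereal (real_of_int n)) \<union> {\<infinity>}"
  unfolding ring_filtration_def by blast

text \<open>From -a = (-1) a one gets u(-a) \<ge> u(-1) + u(a), so c = -u(-1) works. It is finite:
  -1 = 0 would force 1 = 0, contrary to u(1) = 0. The symmetrised neighbourhoods remain
  multiplicative without loss because -(a b) = (-a) b.\<close>

lemma (in ring) ring_filtration_quasi_filtered_ring: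
  assumes "ring_filtration R u"
  obtains c where "quasi_filtered_ring R u c 0"
proof -
  have int: "u a \<in> range (\<lambda>n::int. ereal (real_of_int n)) \<union> {\<infinity>}"
    and add: "b \<in> carrier R \<Longrightarrow> min (u a) (u b) \<le> u (a \<oplus> b)"
    and zero: "u a = \<infinity> \<longleftrightarrow> a = \<zero>"
    and mult: "b \<in> carrier R \<Longrightarrow> u a + u b \<le> u (a \<otimes> b)" if "a \<in> carrier R" for a b
    using assms that by (auto simp: ring_filtration_def)
  have one: "u \<one> = 0" using assms by (simp add: ring_filtration_def)
  have "\<ominus> \<one> \<noteq> \<zero>"
  proof
    assume "\<ominus> \<one> = \<zero>"
    then have "\<one> = \<zero>" by (metis minus_minus minus_zero one_closed)
    then show False using one zero[of \<one>] by simp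
  qed
  then obtain n :: int where n: "u (\<ominus> \<one>) = ereal (real_of_int n)"
    using int[of "\<ominus> \<one>"] zero[of "\<ominus> \<one>"] by auto
  have neg: "u a \<le> u (\<ominus> a) + ereal (- real_of_int n)" if "a \<in> carrier R" for a
    using mult[of "\<ominus> \<one>" a] that n by (cases "u a"; cases "u (\<ominus> a)") (auto simp: l_minus)
  have "filtered_group R u (- real_of_int n)"
  proof
    fix a assume a: "a \<in> carrier R"
    show "u a \<noteq> -\<infinity>" using int[OF a] by auto
  qed (fact add zero neg)+
  then interpret G: filtered_group R u "- real_of_int n" .
  have "quasi_filtered_ring R u (- real_of_int n) 0"
  proof
    fix a b r s assume ab: "a \<in> G.nbhd r" "b \<in> G.nbhd s"
    then have c: "a \<in> carrier R" "b \<in> carrier R" by (auto simp: G.nbhd_def)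
    have "ereal (r + s) \<le> u a + u b" "ereal (r + s) \<le> u (\<ominus> a) + u b"
      using ab add_mono[of "ereal r" _ "ereal s" "u b"] by (auto simp: G.nbhd_def)
    then have "ereal (r + s) \<le> u (a \<otimes> b)" "ereal (r + s) \<le> u (\<ominus> a \<otimes> b)"
      using mult[of a b] mult[of "\<ominus> a" b] c by (auto intro: order_trans)
    then show "a \<otimes> b \<in> G.nbhd (r + s + 0)" using c by (simp add: G.nbhd_def l_minus)
  qed
  then show ?thesis using that by blast
qed

text \<open>Split \<delta>^j into \<delta>^(j mod N) after the power of \<delta>^N with exponent j
  div N. Each factor \<delta>^N gains at least one, and the rest, together with \<sigma>^e, has
  degree at least B.\<close>

lemma quasi_compatible_growth:
  fixes R (structure)
  assumes "ring R" "ring_filtration R u" "quasi_compatible R u \<sigma> \<delta>"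
  obtains B :: int and N :: nat where "0 < N"
    and "\<And>a n e j. a \<in> level_set R u n \<Longrightarrow>
      (\<sigma> ^^ e) ((\<delta> ^^ j) a) \<in> level_set R u (n + int (j div N) + B)"
proof -
  interpret ring R by fact
  obtain B :: int where "\<And>(i::int) (j::nat).
        ereal (real_of_int B) \<le> filtered_deg R u (int_iterate R \<sigma> i \<circ> (\<delta> ^^ j))"
    using assms(3) unfolding quasi_compatible_def by blast
  then have B: "B \<in> filtered_degrees R u (int_iterate R \<sigma> i \<circ> (\<delta> ^^ j))" for i j
    by (rule le_filtered_deg)
  obtain N where "0 < filtered_deg R u (\<delta> ^^ N)"
    using assms(3) unfolding quasi_compatible_def by blast
  then obtain d where "d \<in> filtered_degrees R u (\<delta> ^^ N)" "0 < d"
    by (auto simp: filtered_deg_def less_SUP_iff)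
  \<comment> \<open>Degrees are integers, so a positive one is at least 1.\<close>
  then have N: "1 \<in> filtered_degrees R u (\<delta> ^^ N)"
    using filtered_degrees_antimono[of d R u "\<delta> ^^ N" 1] by simp
  \<comment> \<open>Otherwise the identity would have positive degree, although the value of 1 is
    exactly 0.\<close>
  have "N \<noteq> 0"
  proof
    assume "N = 0"
    then have "(\<delta> ^^ 0) \<one> \<in> level_set R u (0 + 1)"
      using filtered_degreesD[OF N, of \<one> 0] assms(2)
      by (simp add: level_set_def ring_filtration_def zero_ereal_def)
    then show False using assms(2) by (simp add: level_set_def ring_filtration_def)
  qed
  have pow: "((\<delta> ^^ N) ^^ q) a \<in> level_set R u (n + int q)" if "a \<in> level_set R u n" for a n q
  proof (induction q)
    case (Suc q)
    then show ?case using filtered_degreesD[OF N, of _ "n + int q"] by (simp add: ac_simps)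
  qed (use that in simp)
  have "(\<sigma> ^^ e) ((\<delta> ^^ j) a) \<in> level_set R u (n + int (j div N) + B)"
    if a: "a \<in> level_set R u n" for a n e j
  proof -
    have "\<delta> ^^ j = (\<delta> ^^ (j mod N)) \<circ> ((\<delta> ^^ N) ^^ (j div N))"
      by (simp add: funpow_mult flip: funpow_add)
    then show ?thesis
      using filtered_degreesD[OF B[of "int e" "j mod N"] pow[OF a, of "j div N"]]
      by (simp add: int_iterate_def)
  qed
  then show ?thesis using that \<open>N \<noteq> 0\<close> by blast
qed

lemma quasi_compatible_skew_series:
  fixes R (structure)
  assumes "ring R" "ring_filtration R u" "filtration_complete R u"
    "commuting_skew_derivation R \<sigma> \<delta>" "quasi_compatible R u \<sigma> \<delta>"
  obtains c C \<theta> where "skew_series R u c \<sigma> \<delta> C \<theta>"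
proof -
  interpret ring R by fact
  obtain c where c: "quasi_filtered_ring R u c 0"
    using ring_filtration_quasi_filtered_ring[OF assms(2)] by blast
  then interpret G: quasi_filtered_ring R u c 0 .
  obtain B :: int and N :: nat where N: "0 < N"
    and gr: "\<And>a n e j. a \<in> level_set R u n \<Longrightarrow>
      (\<sigma> ^^ e) ((\<delta> ^^ j) a) \<in> level_set R u (n + int (j div N) + B)"
    by (rule quasi_compatible_growth[OF assms(1,2,5)], rule that)
  have \<sigma>: "\<sigma> \<in> ring_hom R R" and \<delta>: "additive_end R \<delta>"
    using assms(4) by (auto simp: commuting_skew_derivation_def skew_derivation_def ring_iso_def)
  have \<delta>_mult: "\<delta> (a \<otimes> b) = \<delta> a \<otimes> b \<oplus> \<sigma> a \<otimes> \<delta> b" if "a \<in> carrier R" "b \<in> carrier R" for a b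
    using assms(4) that by (simp add: commuting_skew_derivation_def skew_derivation_def)
  have \<sigma>_\<delta>: "\<sigma> (\<delta> a) = \<delta> (\<sigma> a)" if "a \<in> carrier R" for a
    using assms(4) that by (simp add: commuting_skew_derivation_def)
  have \<sigma>_add: "additive_end R \<sigma>" using \<sigma> by (auto simp: additive_end_def hom_def ring_hom_def)
  \<comment> \<open>Values are integers, so a real radius may be rounded up without losing
    elements.\<close>
  have ceil: "a \<in> level_set R u \<lceil>r\<rceil>" if "a \<in> carrier R" "ereal r \<le> u a" for a r
  proof -
    have "u a \<in> range (\<lambda>n::int. ereal (real_of_int n)) \<union> {\<infinity>}"
      by (rule ring_filtration_values[OF assms(2) that(1)])
    then show ?thesis using that by (auto simp: level_set_def ceiling_le_iff)
  qed
  have "skew_series R u c \<sigma> \<delta> (real_of_int B - 1) (1 / real N)"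
  proof
    fix a r e j assume a: "a \<in> G.nbhd r"
    then have aR: "a \<in> carrier R" "ereal r \<le> u a" "ereal r \<le> u (\<ominus> a)" by (auto simp: G.nbhd_def)
    let ?f = "\<lambda>a. (\<sigma> ^^ e) ((\<delta> ^^ j) a)"
    let ?m = "\<lceil>r\<rceil> + int (j div N) + B"
    have "additive_end R ((\<sigma> ^^ e) \<circ> (\<delta> ^^ j))"
      by (intro additive_end_compose additive_end_funpow \<sigma>_add \<delta>)
    then have "?f (\<ominus> a) = \<ominus> ?f a" using G.additive_neg[of "(\<sigma> ^^ e) \<circ> (\<delta> ^^ j)" a] aR by simp
    then have "?f a \<in> level_set R u ?m" "\<ominus> ?f a \<in> level_set R u ?m"
      using gr[OF ceil[OF aR(1,2)], of e j] gr[OF ceil[of "\<ominus> a" r], of e j] aR by auto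
    then have "?f a \<in> G.nbhd (real_of_int ?m)" by (simp add: G.nbhd_def level_set_def)
    \<comment> \<open>The -1 in the constant pays for the rounding j/N \<le> j div N + 1.\<close>
    moreover have "r + (real_of_int B - 1) + 1 / real N * real j \<le> real_of_int ?m"
    proof -
      have "j < N * (j div N + 1)"
        using N by (metis Suc_eq_plus1 dividend_less_times_div mult_Suc_right)
      then have "real j \<le> real N * (real (j div N) + 1)"
        by (metis of_nat_1 of_nat_add of_nat_le_iff of_nat_mult order_less_imp_le)
      then have "real j / real N \<le> real (j div N) + 1"
        using N by (simp add: pos_divide_le_eq mult.commute)
      then show ?thesis
        using le_of_int_ceiling[of r]
        by (simp only: of_int_add of_int_of_nat_eq times_divide_eq_left mult_1)
    qed
    ultimately show "?f a \<in> G.nbhd (r + (real_of_int B - 1) + 1 / real N * real j)"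
      by (rule G.nbhd_mono)
  next
    show "0 < 1 / real N" using N by simp
  qed (fact assms(3) \<sigma> \<delta> \<delta>_mult \<sigma>_\<delta>)+
  then show ?thesis using that by blast
qed

section \<open>The three statements assembled\<close>

theorem theoremA:
  fixes S :: "('a, 'b) ring_scheme" (structure)
    and w :: "'a \<Rightarrow> ereal"
    and \<sigma> \<delta> :: "'a \<Rightarrow> 'a"
  defines "P \<equiv> bounded_skew_series_ring S w \<sigma> \<delta>"
  assumes "ring S"
    and "ring_filtration S w"
    and "filtration_complete S w"
    and "commuting_skew_derivation S \<sigma> \<delta>"
    and "quasi_compatible S w \<sigma> \<delta>"
  shows
    "((\<forall>a\<in>carrier P. \<forall>b\<in>carrier P. \<forall>k. \<forall>e\<le>k.
         filtration_summable S w (skew_term S \<sigma> \<delta> a b k e)) \<and>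
      ring P \<and>
      subring (finite_seqs S) P \<and>
      is_skew_polynomial_ring S \<sigma> \<delta> (P\<lparr>carrier := finite_seqs S\<rparr>) (const_series S) (series_X S)) \<and>
     (\<exists>\<epsilon>\<^sub>0::real. 0 < \<epsilon>\<^sub>0 \<and> (\<forall>\<epsilon>::real. \<epsilon> \<in> \<rat> \<and> 0 < \<epsilon> \<and> \<epsilon> < \<epsilon>\<^sub>0 \<longrightarrow>
        (\<forall>f\<in>carrier P. \<exists>n. series_filtration w \<epsilon> f = w (f n) + ereal (\<epsilon> * real n)) \<and>
        left_module_filtration S w P (series_smult S)
          {real_of_int m + \<epsilon> * real_of_int n | m n. True} (series_filtration w \<epsilon>) \<and>
        topological_ring P (filtration_topology P (series_filtration w \<epsilon>)) \<and>
        (\<forall>s\<in>carrier S. series_filtration w \<epsilon> (const_series S s) = w s) \<and>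
        filtration_topology P (series_filtration w \<epsilon>) closure_of finite_seqs S = carrier P \<and>
        (positive_filtration S w \<longrightarrow> filtration_complete P (series_filtration w \<epsilon>)))) \<and>
     (positive_filtration S w \<longrightarrow> P = skew_series_ring S w \<sigma> \<delta>) \<and>
     (\<forall>A T.
        subring A S \<and>
        filtration_complete (S\<lparr>carrier := A\<rparr>) w \<and>
        positive_filtration (S\<lparr>carrier := A\<rparr>) w \<and>
        \<sigma> ` A \<subseteq> A \<and> \<delta> ` A \<subseteq> A \<and>
        left_denominator_set (S\<lparr>carrier := A\<rparr>) T \<and>
        \<sigma> ` T \<subseteq> T \<and>
        is_left_localization (S\<lparr>carrier := A\<rparr>) T S id \<and>
        (\<forall>s. bounded_seq S w s \<longrightarrow> (\<exists>t\<in>T. \<forall>n. t \<otimes> s n \<in> A)) \<longrightarrow>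
        (let Q = skew_series_ring (S\<lparr>carrier := A\<rparr>) w \<sigma> \<delta> in
           ring Q \<and>
           left_denominator_set Q (const_series S ` T) \<and>
           is_left_localization Q (const_series S ` T) P id \<and>
           (\<exists>h. h \<in> iso (tensor_product (S\<lparr>carrier := A\<rparr>) S (\<otimes>) Q (series_smult S)) (add_monoid P) \<and>
             (\<forall>s\<in>carrier S. \<forall>f\<in>carrier Q.
                h (pure_tensor (S\<lparr>carrier := A\<rparr>) S (\<otimes>) Q (series_smult S) s f) =
                const_series S s \<otimes>\<^bsub>P\<^esub> f))))"
proof -
  obtain c C \<theta> where "skew_series S w c \<sigma> \<delta> C \<theta>"
    using quasi_compatible_skew_series assms(2-6) by blast
  then interpret skew_series S w c \<sigma> \<delta> C \<theta> .
  have P: "P = bounded_skew_series_ring S w \<sigma> \<delta>" by (simp add: P_def)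
  have w_mult: "w a + w b \<le> w (a \<otimes> b)" if "a \<in> carrier S" "b \<in> carrier S" for a b
    using assms(3) that by (simp add: ring_filtration_def)
  have i: "(\<forall>a\<in>carrier P. \<forall>b\<in>carrier P. \<forall>k. \<forall>e\<le>k.
         filtration_summable S w (skew_term S \<sigma> \<delta> a b k e)) \<and>
      ring P \<and>
      subring (finite_seqs S) P \<and>
      is_skew_polynomial_ring S \<sigma> \<delta> (P\<lparr>carrier := finite_seqs S\<rparr>) (const_series S) (series_X S)"
    unfolding P
    by (intro conjI ballI allI impI skew_term_summable P_bounded ring_P finite_seqs_subring
        is_skew_polynomial_ring_finite_seqs)
  have v: "(\<forall>f\<in>carrier P. \<exists>n. series_filtration w \<epsilon> f = w (f n) + ereal (\<epsilon> * real n)) \<and>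
        left_module_filtration S w P (series_smult S)
          {real_of_int m + \<epsilon> * real_of_int n | m n. True} (series_filtration w \<epsilon>) \<and>
        topological_ring P (filtration_topology P (series_filtration w \<epsilon>)) \<and>
        (\<forall>s\<in>carrier S. series_filtration w \<epsilon> (const_series S s) = w s) \<and>
        filtration_topology P (series_filtration w \<epsilon>) closure_of finite_seqs S = carrier P \<and>
        (positive_filtration S w \<longrightarrow> filtration_complete P (series_filtration w \<epsilon>))"
    if "0 < \<epsilon>" "\<epsilon> < \<theta>" for \<epsilon>
  proof -
    interpret skew_series_slope S w c \<sigma> \<delta> C \<theta> \<epsilon>
      by unfold_locales (use that in auto)
    have "left_module_filtration S w P (series_smult S)
        {real_of_int m + \<epsilon> * real_of_int n | m n. True} v"
      unfolding left_module_filtration_def P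
    proof (intro conjI ballI)
      fix f assume f: "f \<in> carrier (bounded_skew_series_ring S w \<sigma> \<delta>)"
      \<comment> \<open>Since the minimum is attained and w has integer values, v takes values in
        the group generated by 1 and \<epsilon>, or \<infinity>.\<close>
      obtain n where n: "v f = w (f n) + ereal (\<epsilon> * real n)" using v_attained[OF f] by blast
      from ring_filtration_values[OF assms(3), of "f n"] f consider "w (f n) = \<infinity>" | m :: int where "w (f n) = ereal (real_of_int m)"
        by auto
      then show "v f \<in> ereal ` {real_of_int m + \<epsilon> * real_of_int n | m n. True} \<union> {\<infinity>}"
      proof cases
        case 2
        then have "v f = ereal (real_of_int m + \<epsilon> * real_of_int (int n))" using n by simp
        then show ?thesis by blast
      qed (use n in simp)
      show "v f = \<infinity> \<longleftrightarrow> f = \<zero>\<^bsub>bounded_skew_series_ring S w \<sigma> \<delta>\<^esub>" by (rule v_eq_infinity[OF f])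
      fix g assume "g \<in> carrier (bounded_skew_series_ring S w \<sigma> \<delta>)"
      then show "min (v f) (v g) \<le> v (f \<oplus>\<^bsub>bounded_skew_series_ring S w \<sigma> \<delta>\<^esub> g)" by (rule v_add[OF f])
    next
      fix r f assume r: "r \<in> carrier S" and f: "f \<in> carrier (bounded_skew_series_ring S w \<sigma> \<delta>)"
      show "w r + v f \<le> v (series_smult S r f)"
        unfolding le_v_iff
      proof
        fix n
        have "w r + v f \<le> w r + (w (f n) + ereal (\<epsilon> * real n))" by (intro add_left_mono v_le)
        also have "\<dots> = (w r + w (f n)) + ereal (\<epsilon> * real n)" by (simp add: add.assoc)
        also have "\<dots> \<le> w (r \<otimes> f n) + ereal (\<epsilon> * real n)"
          using r f by (intro add_right_mono w_mult) auto
        finally show "w r + v f \<le> w (series_smult S r f n) + ereal (\<epsilon> * real n)"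
          by (simp add: series_smult_def)
      qed
    qed
    then show ?thesis
      using v_attained V.topological_ring v_const_series finite_seqs_dense positive_complete
      unfolding P by blast
  qed
  have ii: "positive_filtration S w \<longrightarrow> P = skew_series_ring S w \<sigma> \<delta>"
  proof
    assume "positive_filtration S w"
    then have "{s. bounded_seq S w s} = {s. \<forall>n. s n \<in> carrier S}"
      by (auto simp: bounded_seq_def positive_filtration_def zero_ereal_def intro!: exI[of _ 0])
    then show "P = skew_series_ring S w \<sigma> \<delta>"
      unfolding P bounded_skew_series_ring_def by (simp only:) (simp add: skew_series_ring_def)
  qed
  have iii: "let Q = skew_series_ring (S\<lparr>carrier := A\<rparr>) w \<sigma> \<delta> in
           ring Q \<and>
           left_denominator_set Q (const_series S ` T) \<and>
           is_left_localization Q (const_series S ` T) P id \<and>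
           (\<exists>h. h \<in> iso (tensor_product (S\<lparr>carrier := A\<rparr>) S (\<otimes>) Q (series_smult S)) (add_monoid P) \<and>
             (\<forall>s\<in>carrier S. \<forall>f\<in>carrier Q.
                h (pure_tensor (S\<lparr>carrier := A\<rparr>) S (\<otimes>) Q (series_smult S) s f) =
                const_series S s \<otimes>\<^bsub>P\<^esub> f))"
    if h: "subring A S \<and>
        filtration_complete (S\<lparr>carrier := A\<rparr>) w \<and>
        positive_filtration (S\<lparr>carrier := A\<rparr>) w \<and>
        \<sigma> ` A \<subseteq> A \<and> \<delta> ` A \<subseteq> A \<and>
        left_denominator_set (S\<lparr>carrier := A\<rparr>) T \<and>
        \<sigma> ` T \<subseteq> T \<and>
        is_left_localization (S\<lparr>carrier := A\<rparr>) T S id \<and>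
        (\<forall>s. bounded_seq S w s \<longrightarrow> (\<exists>t\<in>T. \<forall>n. t \<otimes> s n \<in> A))" for A T
  proof -
    interpret L: skew_series_localization S w c \<sigma> \<delta> C \<theta> A T
    proof (intro skew_series_localization.intro skew_series_axioms skew_series_localization_axioms.intro)
      show "subring A S" "filtration_complete (S\<lparr>carrier := A\<rparr>) w"
        "positive_filtration (S\<lparr>carrier := A\<rparr>) w" "\<sigma> ` A \<subseteq> A" "\<delta> ` A \<subseteq> A"
        "left_denominator_set (S\<lparr>carrier := A\<rparr>) T" "is_left_localization (S\<lparr>carrier := A\<rparr>) T S id"
        by (simp_all only: h)
      have "\<forall>s. bounded_seq S w s \<longrightarrow> (\<exists>t\<in>T. \<forall>n. t \<otimes> s n \<in> A)"
        using h by (elim conjE)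
      then show "\<exists>t\<in>T. \<forall>n. t \<otimes> s n \<in> A" if "bounded_seq S w s" for s
        using that by blast
    qed
    show ?thesis
      unfolding Let_def P
      by (intro conjI L.ring_Q L.left_denominator_set_Q L.is_left_localization_Q L.tensor_iso)
  qed
  show ?thesis
  \<comment> \<open>The growth rate \<theta> serves as the threshold for the admissible
    slopes.\<close>
  proof (intro conjI[OF i] conjI[OF exI[of _ \<theta>]] conjI[OF ii] conjI[OF \<theta>_pos] allI impI)
    fix \<epsilon> :: real assume "\<epsilon> \<in> \<rat> \<and> 0 < \<epsilon> \<and> \<epsilon> < \<theta>"
    then have "0 < \<epsilon>" "\<epsilon> < \<theta>" by blast+
    then show "(\<forall>f\<in>carrier P. \<exists>n. series_filtration w \<epsilon> f = w (f n) + ereal (\<epsilon> * real n)) \<and>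
        left_module_filtration S w P (series_smult S)
          {real_of_int m + \<epsilon> * real_of_int n | m n. True} (series_filtration w \<epsilon>) \<and>
        topological_ring P (filtration_topology P (series_filtration w \<epsilon>)) \<and>
        (\<forall>s\<in>carrier S. series_filtration w \<epsilon> (const_series S s) = w s) \<and>
        filtration_topology P (series_filtration w \<epsilon>) closure_of finite_seqs S = carrier P \<and>
        (positive_filtration S w \<longrightarrow> filtration_complete P (series_filtration w \<epsilon>))" by (rule v)
  qed (rule iii)
qed

end
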